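(* Let $\Gamma$ be a compact metric graph, $\kappa,\tau>0$, $\alpha>\frac12$, $\widetilde\alpha=\min\{\alpha-\frac12,\frac12\}$, and let $u$ be the solution of $L^{\alpha/2}(\tau u)=\mathcal{W}$ on $\Gamma$, where $L=\kappa^2-\Delta_\Gamma$ with $\Delta_\Gamma$ the Kirchhoff Laplacian and $\mathcal{W}$ is Gaussian white noise on $L_2(\Gamma)$. Let $\lfloor a\rfloor$ denote the largest integer smaller than or equal to $a$. Then: (i) for $0<\gamma<\widetilde\alpha$, $u$ has a modification with $\gamma$-Hölder continuous sample paths; (ii) if $\lfloor\alpha\rfloor$ is even and $\alpha-\lfloor\alpha\rfloor>\frac12$, then for every $\tilde\gamma$ with $0<\tilde\gamma<\alpha-\lfloor\alpha\rfloor-\frac12$, $D^{\lfloor\alpha\rfloor}u$ has a modification with $\tilde\gamma$-Hölder continuous sample paths; (iii) if $\alpha\ge2$ and $\lfloor\alpha\rfloor$ is odd, then for every $0<\gamma<\min\{\alpha-\lfloor\alpha\rfloor,\frac12\}$, $D^{\lfloor\alpha\rfloor-1}u$ has a modification with $\gamma$-Hölder continuous sample paths; (iv) if $\alpha\ge3$, then for every $0<\gamma<\frac12$ and every $j=0,\dots,\lfloor\frac{\alpha-3}{2}\rfloor$, $D^{2j}u$ has a modification with $\gamma$-Hölder continuous sample paths.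
   Context: Graph. A compact metric graph $\Gamma$ is a connected graph with a finite set $\mathcal{V}$ of vertices and a finite set $\mathcal{E}$ of edges (loops and multiple edges allowed); each edge $e$ joins a pair of vertices, has a length $\ell_e\in(0,\infty)$, and is identified with the interval $[0,\ell_e]$, its endpoints being identified with its vertices. $\mathcal{E}_v$ denotes the edges incident to $v\in\mathcal{V}$; $d(\cdot,\cdot)$ is the shortest path distance on $\Gamma$. A function $f$ on $\Gamma$ is a collection $\{f_e\}_{e\in\mathcal{E}}$ of functions on $[0,\ell_e]$. $L_2(\Gamma)=\bigoplus_{e}L_2(e)$ (Lebesgue measure on each edge); $C(\Gamma)$ is the space of continuous functions on $\Gamma$; $\widetilde H^k(\Gamma)=\bigoplus_e H^k(e)$. $D^jf$ is the edgewise weak derivative of order $j$ ($D^0f=f$). A function $f$ on $\Gamma$ is $\gamma$-Hölder continuous if $f\in C(\Gamma)$ and $\sup_{s\ne s'}|f(s)-f(s')|/d(s,s')^\gamma<\infty$. Operator. The Kirchhoff Laplacian $\Delta_\Gamma$ acts as $f_e\mapsto f_e''$ on each edge, with domain $\{f\in\widetilde H^2(\Gamma)\cap C(\Gamma): \sum_{e\in\mathcal{E}_v}\partial_e f(v)=0\ \forall v\in\mathcal{V}\}$, where $\partial_e$ is the derivative along $e$ in the direction away from $v$ (a loop at $v$ contributes one term for each of its two ends). $L=\kappa^2-\Delta_\Gamma$ is self-adjoint, positive definite, with discrete spectrum; $\{\varphi_i\}_{i\in\mathbb{N}}$ is an $L_2(\Gamma)$-orthonormal eigenbasis with eigenvalues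 $0<\lambda_1\le\lambda_2\le\cdots$, and $L^{\beta}\phi=\sum_i\lambda_i^{\beta}(\phi,\varphi_i)_{L_2(\Gamma)}\varphi_i$. Field. $\mathcal{W}$ is Gaussian white noise on $L_2(\Gamma)$ over a complete probability space: a centered Gaussian family $\{\mathcal{W}(h):h\in L_2(\Gamma)\}$ with $\mathbb{E}[\mathcal{W}(h)\mathcal{W}(g)]=(h,g)_{L_2(\Gamma)}$. For $\alpha>\frac12$, the equation $L^{\alpha/2}(\tau u)=\mathcal{W}$ has a unique solution, the centered Gaussian $L_2(\Gamma)$-valued random variable with $(u,\psi)_{L_2(\Gamma)}=\mathcal{W}(\tau^{-1}L^{-\alpha/2}\psi)$ a.s. for all $\psi\in L_2(\Gamma)$. For an $L_2(\Gamma)$-valued random variable $w$ (such as $u$ or $D^ju$), "$w$ has a modification with $\gamma$-Hölder continuous sample paths" means that there is a random field $\{\bar w(s)\}_{s\in\Gamma}$ with $\gamma$-Hölder continuous sample paths such that $\bar w=w$ in $L_2(\Gamma)$ $\mathbb{P}$-a.s. *)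

theory Defs
  imports "HOL-Probability.Probability" "Graph_Theory.Digraph_Component"
begin

section \<open>Compact metric graphs\<close>

text \<open>
  Every edge \<open>e\<close> carries an arbitrary orientation, given by \<open>tail\<close> and \<open>head\<close>: it is identified
  with \<open>[0, len e]\<close> so that \<open>0\<close> is glued to \<open>tail e\<close> and \<open>len e\<close> to \<open>head e\<close>.
\<close>

record ('v, 'e) metric_graph = "('v, 'e) pre_digraph" +
  len :: "'e \<Rightarrow> real"

text \<open>
  \<^const>\<open>Digraph_Component.connected\<close> is connectedness of the underlying undirected graph; loops and
  multiple arcs are allowed in a \<^const>\<open>fin_digraph\<close>.
\<close>

definition compact_metric_graph :: "('v, 'e) metric_graph \<Rightarrow> bool" where
  "compact_metric_graph G \<longleftrightarrow>
     fin_digraph (pre_digraph.truncate G) \<and>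
     Digraph_Component.connected (pre_digraph.truncate G) \<and>
     (\<forall>e\<in>arcs G. 0 < len G e)"

text \<open>
  A point of the graph is represented by a pair \<open>(e, t)\<close>; two pairs may represent the same vertex.
  A function on the graph is a family \<open>f e t\<close>, whose values for \<open>e \<notin> arcs G\<close> or
  \<open>t \<notin> {0..len G e}\<close> are never used.
\<close>

definition points :: "('v, 'e) metric_graph \<Rightarrow> ('e \<times> real) set" where
  "points G = (SIGMA e:arcs G. {0..len G e})"

definition represents_vertex :: "('v, 'e) metric_graph \<Rightarrow> 'v \<Rightarrow> 'e \<times> real \<Rightarrow> bool" where
  "represents_vertex G v = (\<lambda>(e, t). e \<in> arcs G \<and>
     (t = 0 \<and> tail G e = v \<or> t = len G e \<and> head G e = v))"

text \<open>
  \<open>path_length G p q a\<close>: some path from \<open>p\<close> to \<open>q\<close>, composed of finitely many segments of edges,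
  has length \<open>a\<close>.
\<close>

inductive path_length ::
  "('v, 'e) metric_graph \<Rightarrow> 'e \<times> real \<Rightarrow> 'e \<times> real \<Rightarrow> real \<Rightarrow> bool" for G where
  segment: "(e, s) \<in> points G \<Longrightarrow> (e, t) \<in> points G \<Longrightarrow> path_length G (e, s) (e, t) \<bar>s - t\<bar>"
| same_vertex: "represents_vertex G v p \<Longrightarrow> represents_vertex G v q \<Longrightarrow> path_length G p q 0"
| join: "path_length G p q a \<Longrightarrow> path_length G q r b \<Longrightarrow> path_length G p r (a + b)"

definition graph_dist :: "('v, 'e) metric_graph \<Rightarrow> 'e \<times> real \<Rightarrow> 'e \<times> real \<Rightarrow> real" where
  "graph_dist G p q = Inf {a. path_length G p q a}"

text \<open>
  Continuity with respect to the quotient topology of the disjoint union of the closed edges.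
\<close>

definition graph_continuous :: "('v, 'e) metric_graph \<Rightarrow> ('e \<Rightarrow> real \<Rightarrow> real) \<Rightarrow> bool" where
  "graph_continuous G f \<longleftrightarrow>
     (\<forall>e\<in>arcs G. continuous_on {0..len G e} (f e)) \<and>
     (\<forall>v e s e' t. represents_vertex G v (e, s) \<longrightarrow> represents_vertex G v (e', t) \<longrightarrow>
        f e s = f e' t)"

definition graph_holder :: "('v, 'e) metric_graph \<Rightarrow> real \<Rightarrow> ('e \<Rightarrow> real \<Rightarrow> real) \<Rightarrow> bool" where
  "graph_holder G \<gamma> f \<longleftrightarrow> graph_continuous G f \<and>
     (\<exists>C. \<forall>(e, s)\<in>points G. \<forall>(e', t)\<in>points G.
        \<bar>f e s - f e' t\<bar> \<le> C * graph_dist G (e, s) (e', t) powr \<gamma>)"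


section \<open>The spaces \<open>L\<^sub>2\<close> and \<open>H\<^sup>k\<close>\<close>

text \<open>
  Elements of \<open>L\<^sub>2\<close> are represented by functions; equality in \<open>L\<^sub>2\<close> is \<open>L2_eq\<close> below.
\<close>

definition edge_L2 :: "real \<Rightarrow> (real \<Rightarrow> real) set" where
  "edge_L2 l = {f. f \<in> borel_measurable (lebesgue_on {0..l}) \<and>
                   integrable (lebesgue_on {0..l}) (\<lambda>t. (f t)\<^sup>2)}"

definition graph_L2 :: "('v, 'e) metric_graph \<Rightarrow> ('e \<Rightarrow> real \<Rightarrow> real) set" where
  "graph_L2 G = {f. \<forall>e\<in>arcs G. f e \<in> edge_L2 (len G e)}"

definition L2_eq ::
  "('v, 'e) metric_graph \<Rightarrow> ('e \<Rightarrow> real \<Rightarrow> real) \<Rightarrow> ('e \<Rightarrow> real \<Rightarrow> real) \<Rightarrow> bool" where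
  "L2_eq G f g \<longleftrightarrow> (\<forall>e\<in>arcs G. AE t in lebesgue_on {0..len G e}. f e t = g e t)"

definition L2_inner ::
  "('v, 'e) metric_graph \<Rightarrow> ('e \<Rightarrow> real \<Rightarrow> real) \<Rightarrow> ('e \<Rightarrow> real \<Rightarrow> real) \<Rightarrow> real" where
  "L2_inner G f g = (\<Sum>e\<in>arcs G. LINT t|lebesgue_on {0..len G e}. f e t * g e t)"

definition L2_norm :: "('v, 'e) metric_graph \<Rightarrow> ('e \<Rightarrow> real \<Rightarrow> real) \<Rightarrow> real" where
  "L2_norm G f = sqrt (L2_inner G f f)"

definition L2_open :: "('v, 'e) metric_graph \<Rightarrow> ('e \<Rightarrow> real \<Rightarrow> real) set \<Rightarrow> bool" where
  "L2_open G U \<longleftrightarrow> U \<subseteq> graph_L2 G \<and>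
     (\<forall>f\<in>U. \<exists>\<epsilon>>0. \<forall>g\<in>graph_L2 G. L2_norm G (\<lambda>e t. g e t - f e t) < \<epsilon> \<longrightarrow> g \<in> U)"

definition L2_borel :: "('v, 'e) metric_graph \<Rightarrow> ('e \<Rightarrow> real \<Rightarrow> real) measure" where
  "L2_borel G = sigma (graph_L2 G) {U. L2_open G U}"

definition L2_sums ::
  "('v, 'e) metric_graph \<Rightarrow> (nat \<Rightarrow> 'e \<Rightarrow> real \<Rightarrow> real) \<Rightarrow> ('e \<Rightarrow> real \<Rightarrow> real) \<Rightarrow> bool" where
  "L2_sums G F g \<longleftrightarrow> g \<in> graph_L2 G \<and>
     (\<lambda>n. L2_norm G (\<lambda>e t. g e t - (\<Sum>i<n. F i e t))) \<longlonglongrightarrow> 0"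

definition test_function :: "real \<Rightarrow> (real \<Rightarrow> real) \<Rightarrow> bool" where
  "test_function l \<eta> \<longleftrightarrow>
     (\<forall>n. (deriv ^^ n) \<eta> differentiable_on UNIV) \<and>
     (\<exists>K. compact K \<and> K \<subseteq> {0<..<l} \<and> (\<forall>t. t \<notin> K \<longrightarrow> \<eta> t = 0))"

definition weak_deriv :: "real \<Rightarrow> nat \<Rightarrow> (real \<Rightarrow> real) \<Rightarrow> (real \<Rightarrow> real) \<Rightarrow> bool" where
  "weak_deriv l j f g \<longleftrightarrow>
     (\<forall>\<eta>. test_function l \<eta> \<longrightarrow>
        (LINT t|lebesgue_on {0..l}. f t * (deriv ^^ j) \<eta> t) =
        (-1) ^ j * (LINT t|lebesgue_on {0..l}. g t * \<eta> t))"

definition edge_sobolev :: "nat \<Rightarrow> real \<Rightarrow> (real \<Rightarrow> real) set" where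
  "edge_sobolev k l = {f \<in> edge_L2 l. \<forall>j\<le>k. \<exists>g\<in>edge_L2 l. weak_deriv l j f g}"

definition graph_sobolev :: "('v, 'e) metric_graph \<Rightarrow> nat \<Rightarrow> ('e \<Rightarrow> real \<Rightarrow> real) set" where
  "graph_sobolev G k = {f. \<forall>e\<in>arcs G. f e \<in> edge_sobolev k (len G e)}"

text \<open>
  The edgewise weak derivative of order \<open>j\<close> is unique up to \<^const>\<open>L2_eq\<close>; this picks a
  representative, which is meaningful only for arguments in \<open>graph_sobolev G j\<close>.
\<close>

definition edgewise_deriv ::
  "('v, 'e) metric_graph \<Rightarrow> nat \<Rightarrow> ('e \<Rightarrow> real \<Rightarrow> real) \<Rightarrow> 'e \<Rightarrow> real \<Rightarrow> real" where
  "edgewise_deriv G j f =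
     (\<lambda>e. SOME g. g \<in> edge_L2 (len G e) \<and> weak_deriv (len G e) j (f e) g)"


section \<open>The operator \<open>L = \<kappa>\<^sup>2 - \<Delta>\<close>\<close>

text \<open>
  Derivatives at \<open>v\<close> are taken away from \<open>v\<close>, hence the sign at the head of an edge. A loop
  contributes to both sums. The one-sided classical derivatives exist for functions in
  \<open>graph_sobolev G 2\<close> that are continuous on the closed edges.
\<close>

definition outward_deriv_sum :: "('v, 'e) metric_graph \<Rightarrow> ('e \<Rightarrow> real \<Rightarrow> real) \<Rightarrow> 'v \<Rightarrow> real" where
  "outward_deriv_sum G f v =
     (\<Sum>e | e \<in> arcs G \<and> tail G e = v.
        vector_derivative (f e) (at 0 within {0..len G e})) +
     (\<Sum>e | e \<in> arcs G \<and> head G e = v.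
        - vector_derivative (f e) (at (len G e) within {0..len G e}))"

definition kirchhoff_domain :: "('v, 'e) metric_graph \<Rightarrow> ('e \<Rightarrow> real \<Rightarrow> real) set" where
  "kirchhoff_domain G = {f \<in> graph_sobolev G 2. graph_continuous G f \<and>
     (\<forall>v\<in>verts G. outward_deriv_sum G f v = 0)}"

definition kirchhoff_op ::
  "('v, 'e) metric_graph \<Rightarrow> real \<Rightarrow> ('e \<Rightarrow> real \<Rightarrow> real) \<Rightarrow> 'e \<Rightarrow> real \<Rightarrow> real" where
  "kirchhoff_op G \<kappa> f = (\<lambda>e t. \<kappa>\<^sup>2 * f e t - edgewise_deriv G 2 f e t)"

definition orthonormal_eigenbasis ::
  "('v, 'e) metric_graph \<Rightarrow> real \<Rightarrow> (nat \<Rightarrow> 'e \<Rightarrow> real \<Rightarrow> real) \<Rightarrow> (nat \<Rightarrow> real) \<Rightarrow> bool" where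
  "orthonormal_eigenbasis G \<kappa> \<phi> \<mu> \<longleftrightarrow>
     (\<forall>i. \<phi> i \<in> kirchhoff_domain G \<and>
          L2_eq G (kirchhoff_op G \<kappa> (\<phi> i)) (\<lambda>e t. \<mu> i * \<phi> i e t)) \<and>
     (\<forall>i j. L2_inner G (\<phi> i) (\<phi> j) = (if i = j then 1 else 0)) \<and>
     (\<forall>f\<in>graph_L2 G. L2_sums G (\<lambda>i e t. L2_inner G f (\<phi> i) * \<phi> i e t) f) \<and>
     0 < \<mu> 0 \<and> incseq \<mu>"

text \<open>The sum of the series is unique up to \<^const>\<open>L2_eq\<close>.\<close>

definition spectral_power ::
  "('v, 'e) metric_graph \<Rightarrow> (nat \<Rightarrow> 'e \<Rightarrow> real \<Rightarrow> real) \<Rightarrow> (nat \<Rightarrow> real) \<Rightarrow> real \<Rightarrow>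
     ('e \<Rightarrow> real \<Rightarrow> real) \<Rightarrow> 'e \<Rightarrow> real \<Rightarrow> real" where
  "spectral_power G \<phi> \<mu> \<beta> \<psi> =
     (SOME g. L2_sums G (\<lambda>i e t. \<mu> i powr \<beta> * L2_inner G \<psi> (\<phi> i) * \<phi> i e t) g)"


section \<open>White noise, solutions and modifications\<close>

text \<open>The degenerate distribution counts as Gaussian.\<close>

definition centered_gaussian :: "'w measure \<Rightarrow> ('w \<Rightarrow> real) \<Rightarrow> bool" where
  "centered_gaussian M X \<longleftrightarrow> X \<in> borel_measurable M \<and>
     ((AE \<omega> in M. X \<omega> = 0) \<or> (\<exists>\<sigma>>0. distributed M lborel X (normal_density 0 \<sigma>)))"

definition white_noise ::
  "('v, 'e) metric_graph \<Rightarrow> 'w measure \<Rightarrow> (('e \<Rightarrow> real \<Rightarrow> real) \<Rightarrow> 'w \<Rightarrow> real) \<Rightarrow> bool" where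
  "white_noise G M W \<longleftrightarrow>
     (\<forall>F c. finite F \<longrightarrow> F \<subseteq> graph_L2 G \<longrightarrow>
        centered_gaussian M (\<lambda>\<omega>. \<Sum>h\<in>F. c h * W h \<omega>)) \<and>
     (\<forall>h\<in>graph_L2 G. \<forall>g\<in>graph_L2 G. (LINT \<omega>|M. W h \<omega> * W g \<omega>) = L2_inner G h g)"

text \<open>
  The solution \<open>u\<close> of \<open>L\<^bsup>\<alpha>/2\<^esup> (\<tau> u) = W\<close>. Its Gaussianity follows from that of \<open>W\<close>.
\<close>

definition spde_solution ::
  "('v, 'e) metric_graph \<Rightarrow> 'w measure \<Rightarrow> (nat \<Rightarrow> 'e \<Rightarrow> real \<Rightarrow> real) \<Rightarrow> (nat \<Rightarrow> real) \<Rightarrow>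
     real \<Rightarrow> real \<Rightarrow> (('e \<Rightarrow> real \<Rightarrow> real) \<Rightarrow> 'w \<Rightarrow> real) \<Rightarrow> ('w \<Rightarrow> 'e \<Rightarrow> real \<Rightarrow> real) \<Rightarrow> bool" where
  "spde_solution G M \<phi> \<mu> \<tau> \<alpha> W u \<longleftrightarrow>
     u \<in> measurable M (L2_borel G) \<and>
     (\<forall>\<psi>\<in>graph_L2 G. AE \<omega> in M. L2_inner G (u \<omega>) \<psi> =
        W (\<lambda>e t. inverse \<tau> * spectral_power G \<phi> \<mu> (- \<alpha> / 2) \<psi> e t) \<omega>)"

text \<open>
  Measurability of \<open>w\<close> itself is not required here: over a complete probability space it follows,
  up to a null set, from the existence of the continuous random field \<open>v\<close>.
\<close>

definition has_holder_modification ::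
  "('v, 'e) metric_graph \<Rightarrow> 'w measure \<Rightarrow> ('w \<Rightarrow> 'e \<Rightarrow> real \<Rightarrow> real) \<Rightarrow> real \<Rightarrow> bool" where
  "has_holder_modification G M w \<gamma> \<longleftrightarrow>
     (\<exists>v. (\<forall>(e, t)\<in>points G. (\<lambda>\<omega>. v \<omega> e t) \<in> borel_measurable M) \<and>
          (\<forall>\<omega>\<in>space M. graph_holder G \<gamma> (v \<omega>)) \<and>
          (AE \<omega> in M. L2_eq G (v \<omega>) (w \<omega>)))"

text \<open>
  The first conjunct says that \<open>D\<^sup>j u\<close> exists almost surely, so that the choice in
  \<^const>\<open>edgewise_deriv\<close> is meaningful.
\<close>

definition deriv_has_holder_modification ::
  "('v, 'e) metric_graph \<Rightarrow> 'w measure \<Rightarrow> nat \<Rightarrow> ('w \<Rightarrow> 'e \<Rightarrow> real \<Rightarrow> real) \<Rightarrow> real \<Rightarrow> bool" where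
  "deriv_has_holder_modification G M j u \<gamma> \<longleftrightarrow>
     (AE \<omega> in M. u \<omega> \<in> graph_sobolev G j) \<and>
     has_holder_modification G M (\<lambda>\<omega>. edgewise_deriv G j (u \<omega>)) \<gamma>"

end

theory Submission
  imports Defs
begin

text \<open>
  On every edge the eigenfunctions satisfy \<open>\<phi> i'' = (\<kappa>\<^sup>2 - \<mu> i) \<phi> i\<close>. Hence, in the eigenbasis, the
  derivative of order \<open>2 * j\<close> of the solution has independent Gaussian coefficients whose variances
  are at most of order \<open>\<mu> i powr - \<beta>\<close> with \<open>\<beta> = \<alpha> - 2 * j\<close>, and the four claims are instances of a
  single one: if \<open>\<beta> > 1 / 2\<close>, this derivative has a modification that is \<open>\<gamma>\<close>-Hoelder continuous, for
  every positive \<open>\<gamma> < min (\<beta> - 1 / 2) (1 / 2)\<close> (\<open>even_derivative_modification\<close>).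

  The spectral input is dual to one-dimensional Sobolev inequalities. For a linear functional \<open>T\<close> the
  sum of \<open>(T (\<phi> i))\<^sup>2 / (\<mu> i + r)\<close> is the squared norm of \<open>T\<close> with respect to the energy
  \<open>\<integral> f'\<^sup>2 + (\<kappa>\<^sup>2 + r) f\<^sup>2\<close>, because the Kirchhoff conditions cancel all boundary terms in Green's identity
  (\<open>energy_identity\<close>, \<open>dual_bound\<close>). The evaluation at a point has squared norm of order
  \<open>r powr - (1 / 2)\<close>, the difference of two evaluations at distance \<open>h\<close> has squared norm at most \<open>h\<close>.
  Up to constants the same holds for the means over two neighbouring cells of length at most \<open>h\<close>.
  Interpolating these bounds and summing over dyadic \<open>r\<close> gives
  \<open>(\<Sum>i. \<mu> i powr - \<beta> * (T (\<phi> i))\<^sup>2) \<le> K * h powr \<theta>\<close> for the difference \<open>T\<close> of two such means, whenever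
  \<open>0 \<le> \<theta> \<le> 1\<close> and \<open>\<theta> < 2 * \<beta> - 1\<close> (\<open>cell_difference_variance\<close>). The bound for a single evaluation,
  integrated over the graph, shows in the same way that the sum of all \<open>\<mu> i powr - \<beta>\<close> is finite
  (\<open>negative_powers_summable\<close>).

  The passage to sample paths is Kolmogorov's argument, applied to means over dyadic cells of the
  edges rather than to point values. The means of a random series are inner products with elements
  of \<open>L\<^sub>2\<close>, so they converge as soon as the coefficients are square summable. The variance bound
  controls their Gaussian moments, and summing over all levels shows that almost surely the means over
  any two touching cells of level \<open>n\<close> differ by at most \<open>K * 2 powr (- \<gamma> * n)\<close>
  (\<open>random_series_regular_coeffs\<close>). The means over nested cells then converge to a function that is
  Hoelder continuous on each edge and has matching values at the vertices; its pairing with a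
  test function is the series of the pairings (\<open>reconstruction_moments\<close>). Short paths meet at most
  one vertex, so the estimate extends to the path distance (\<open>graph_holder_if_edgewise\<close>).

  Finally, moving derivatives from the test function to the eigenfunctions identifies the function
  reconstructed from the coefficients of order \<open>2 * j\<close> as a weak derivative of the solution. The odd
  derivatives exist because a continuous weak second derivative of a continuous function is
  classical (\<open>weak_second_derivative_classical\<close>), a consequence of the fundamental lemma of the calculus
  of variations.
\<close>

section \<open>Smooth cutoff functions\<close>

text \<open>
  For \<open>p = 1\<close> this is the classical smooth function that vanishes exactly on the nonpositive reals.
  The polynomial factor makes the family closed under differentiation, which proves smoothness.
\<close>

definition flat_exp :: "real poly \<Rightarrow> real \<Rightarrow> real" where
  "flat_exp p x = (if x > 0 then poly p (1 / x) * exp (- (1 / x)) else 0)"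

lemma tendsto_poly_times_exp_neg: "((\<lambda>z. poly p z * exp (- z)) \<longlongrightarrow> (0::real)) at_top"
proof -
  have "((\<lambda>z. \<Sum>i\<le>degree p. coeff p i * (z ^ i / exp z)) \<longlongrightarrow> (\<Sum>i\<le>degree p. coeff p i * 0)) at_top"
    by (intro tendsto_intros tendsto_power_div_exp_0)
  then show ?thesis
    by (simp add: poly_altdef exp_minus sum_distrib_right divide_inverse mult.assoc)
qed

lemma flat_exp_has_derivative:
  "(flat_exp p has_real_derivative flat_exp ([:0, 0, 1:] * (p - pderiv p)) x) (at x)"
proof -
  consider "x > 0" | "x < 0" | "x = 0" by linarith
  then show ?thesis
  proof cases
    case 1
    have "((\<lambda>x. poly p (1 / x) * exp (- (1 / x))) has_real_derivative
        flat_exp ([:0, 0, 1:] * (p - pderiv p)) x) (at x)"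
      using 1 by (auto intro!: derivative_eq_intros simp: flat_exp_def field_simps power2_eq_square)
    then show ?thesis
      by (rule has_field_derivative_transform_within_open[of _ _ _ "{0<..}"])
        (use 1 in \<open>auto simp: flat_exp_def\<close>)
  next
    case 2
    have "((\<lambda>x. 0) has_real_derivative flat_exp ([:0, 0, 1:] * (p - pderiv p)) x) (at x)"
      using 2 by (auto simp: flat_exp_def)
    then show ?thesis
      by (rule has_field_derivative_transform_within_open[of _ _ _ "{..<0}"])
        (use 2 in \<open>auto simp: flat_exp_def\<close>)
  next
    case 3
    have right: "((\<lambda>y. flat_exp p y / y) \<longlongrightarrow> 0) (at_right 0)"
    proof -
      have "((\<lambda>z. poly ([:0, 1:] * p) z * exp (- z)) \<longlongrightarrow> (0::real)) at_top"
        by (rule tendsto_poly_times_exp_neg)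
      then have "((\<lambda>y. poly ([:0, 1:] * p) (inverse y) * exp (- inverse y)) \<longlongrightarrow> (0::real)) (at_right 0)"
        by (rule filterlim_compose) (rule filterlim_inverse_at_top_right)
      then show ?thesis
        by (rule Lim_transform_eventually)
          (auto simp: eventually_at_right_field flat_exp_def field_simps intro!: exI[of _ 1])
    qed
    have left: "((\<lambda>y. flat_exp p y / y) \<longlongrightarrow> 0) (at_left 0)"
      by (rule Lim_transform_eventually[of "\<lambda>_. 0"])
        (auto simp: eventually_at_left_field flat_exp_def intro!: exI[of _ "-1"])
    have "((\<lambda>y. flat_exp p y / y) \<longlongrightarrow> 0) (at 0)"
      using left right by (simp add: filterlim_split_at)
    then show ?thesis
      using 3 by (simp add: has_field_derivative_iff flat_exp_def)
  qed
qed

definition smooth_fun :: "(real \<Rightarrow> real) \<Rightarrow> bool" where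
  "smooth_fun f \<longleftrightarrow> (\<forall>n. (deriv ^^ n) f differentiable_on UNIV)"

lemma smooth_funD: "smooth_fun f \<Longrightarrow> ((deriv ^^ n) f has_real_derivative (deriv ^^ Suc n) f x) (at x)"
  by (simp add: smooth_fun_def differentiable_on_def DERIV_deriv_iff_real_differentiable)

text \<open>
  Smoothness by coinduction: it suffices to exhibit a set of functions that contains the derivative
  of each of its members.
\<close>

lemma smooth_funI:
  assumes "f \<in> S" and "\<And>g. g \<in> S \<Longrightarrow> \<exists>g'\<in>S. \<forall>x. (g has_real_derivative g' x) (at x)"
  shows "smooth_fun f"
proof -
  have mem: "(deriv ^^ n) f \<in> S" for n
  proof (induction n)
    case (Suc n)
    from assms(2)[OF this] obtain g' where "g' \<in> S" "\<forall>x. ((deriv ^^ n) f has_real_derivative g' x) (at x)"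
      by blast
    moreover from this have "deriv ((deriv ^^ n) f) = g'"
      by (intro ext DERIV_imp_deriv) auto
    ultimately show ?case by simp
  qed (use assms in simp)
  show ?thesis
    unfolding smooth_fun_def differentiable_on_def
    using assms(2)[OF mem] by (metis real_differentiable_def)
qed

inductive_set cutoff_algebra :: "(real \<Rightarrow> real) set" where
  flat: "(\<lambda>x. flat_exp p (c * x + d)) \<in> cutoff_algebra"
| add: "f \<in> cutoff_algebra \<Longrightarrow> g \<in> cutoff_algebra \<Longrightarrow> (\<lambda>x. f x + g x) \<in> cutoff_algebra"
| mult: "f \<in> cutoff_algebra \<Longrightarrow> g \<in> cutoff_algebra \<Longrightarrow> (\<lambda>x. f x * g x) \<in> cutoff_algebra"
| scale: "f \<in> cutoff_algebra \<Longrightarrow> (\<lambda>x. c * f x) \<in> cutoff_algebra"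

lemma cutoff_algebra_derivative:
  assumes "f \<in> cutoff_algebra"
  shows "\<exists>f'\<in>cutoff_algebra. \<forall>x. (f has_real_derivative f' x) (at x)"
  using assms
proof induction
  case (flat p c d)
  show ?case
  proof (rule bexI, rule allI)
    fix x
    have "((\<lambda>x. c * x + d) has_real_derivative c) (at x)"
      by (auto intro!: derivative_eq_intros)
    from DERIV_chain2[OF flat_exp_has_derivative this]
    show "((\<lambda>x. flat_exp p (c * x + d)) has_real_derivative
        c * flat_exp ([:0, 0, 1:] * (p - pderiv p)) (c * x + d)) (at x)"
      by (simp only: mult.commute)
  qed (intro cutoff_algebra.intros)
next
  case (add f g)
  then obtain f' g' where "f' \<in> cutoff_algebra" "g' \<in> cutoff_algebra"
    "\<And>x. (f has_real_derivative f' x) (at x)" "\<And>x. (g has_real_derivative g' x) (at x)" by blast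
  then show ?case
    by (intro bexI[of _ "\<lambda>x. f' x + g' x"]) (auto intro!: cutoff_algebra.intros DERIV_add)
next
  case (mult f g)
  then obtain f' g' where "f' \<in> cutoff_algebra" "g' \<in> cutoff_algebra"
    "\<And>x. (f has_real_derivative f' x) (at x)" "\<And>x. (g has_real_derivative g' x) (at x)" by blast
  then show ?case using mult(1,2)
    by (intro bexI[of _ "\<lambda>x. f' x * g x + g' x * f x"])
      (auto intro!: cutoff_algebra.intros DERIV_mult)
next
  case (scale f c)
  then obtain f' where "f' \<in> cutoff_algebra" "\<And>x. (f has_real_derivative f' x) (at x)" by blast
  then show ?case
    by (intro bexI[of _ "\<lambda>x. c * f' x"]) (auto intro!: cutoff_algebra.intros DERIV_cmult)
qed

lemma smooth_fun_cutoff_algebra: "f \<in> cutoff_algebra \<Longrightarrow> smooth_fun f"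
  by (rule smooth_funI[of _ cutoff_algebra]) (auto intro: cutoff_algebra_derivative)

lemma higher_deriv_lincomb:
  assumes "smooth_fun f" "smooth_fun g"
  shows "(deriv ^^ n) (\<lambda>x. f x + c * g x) = (\<lambda>x. (deriv ^^ n) f x + c * (deriv ^^ n) g x)"
proof (induction n)
  case (Suc n)
  show ?case
    unfolding funpow.simps o_def Suc
    by (intro ext DERIV_imp_deriv)
      (use assms[THEN smooth_funD, of n] in \<open>auto intro!: derivative_eq_intros\<close>)
qed simp

lemma smooth_fun_lincomb:
  assumes "smooth_fun f" "smooth_fun g"
  shows "smooth_fun (\<lambda>x. f x + c * g x)"
proof -
  have "((deriv ^^ n) (\<lambda>x. f x + c * g x) has_real_derivative
      (deriv ^^ Suc n) f x + c * (deriv ^^ Suc n) g x) (at x)" for n x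
    unfolding higher_deriv_lincomb[OF assms]
    by (intro DERIV_add DERIV_cmult assms[THEN smooth_funD])
  then show ?thesis
    by (auto simp: smooth_fun_def differentiable_on_def real_differentiable_def)
qed

lemma smooth_fun_deriv: "smooth_fun f \<Longrightarrow> smooth_fun (deriv f)"
  unfolding smooth_fun_def by (metis funpow_Suc_right o_apply)

lemma smooth_fun_antiderivative:
  assumes "smooth_fun f" "\<And>x. (F has_real_derivative f x) (at x)"
  shows "smooth_fun F"
proof -
  have "deriv F = f" using assms(2) by (intro ext DERIV_imp_deriv)
  moreover have "F differentiable_on UNIV"
    using assms(2) by (auto simp: differentiable_on_def real_differentiable_def)
  ultimately have "(deriv ^^ n) F differentiable_on UNIV" for n
    using assms(1) by (cases n) (auto simp: smooth_fun_def funpow_Suc_right simp del: funpow.simps)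
  then show ?thesis by (simp add: smooth_fun_def)
qed


section \<open>Test functions\<close>

text \<open>
  A compact subset of the open edge lies in a closed interval strictly inside, and this form of the
  support condition is what antiderivatives preserve.
\<close>

lemma test_function_iff:
  assumes "0 < l"
  shows "test_function l \<eta> \<longleftrightarrow>
    smooth_fun \<eta> \<and> (\<exists>a b. 0 < a \<and> a < b \<and> b < l \<and> (\<forall>t. t \<notin> {a..b} \<longrightarrow> \<eta> t = 0))"
proof
  assume "test_function l \<eta>"
  then obtain K where K: "compact K" "K \<subseteq> {0<..<l}" "\<And>t. t \<notin> K \<Longrightarrow> \<eta> t = 0" and "smooth_fun \<eta>"
    by (auto simp: test_function_def smooth_fun_def)
  let ?K = "insert (l/3) (insert (2*l/3) K)"
  have cK: "compact ?K" "?K \<noteq> {}" "?K \<subseteq> {0<..<l}" using K assms by auto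
  obtain a where a: "a \<in> ?K" "\<And>t. t \<in> ?K \<Longrightarrow> a \<le> t" using compact_attains_inf[OF cK(1,2)] by blast
  obtain b where b: "b \<in> ?K" "\<And>t. t \<in> ?K \<Longrightarrow> t \<le> b" using compact_attains_sup[OF cK(1,2)] by blast
  have "a \<le> l/3" "2*l/3 \<le> b" by (rule a(2), simp) (rule b(2), simp)
  then have "a < b" using assms by linarith
  moreover have "0 < a" "b < l" using a b cK by auto
  moreover have "\<forall>t. t \<notin> {a..b} \<longrightarrow> \<eta> t = 0" using K(3) a(2) b(2) by auto
  ultimately show "smooth_fun \<eta> \<and> (\<exists>a b. 0 < a \<and> a < b \<and> b < l \<and> (\<forall>t. t \<notin> {a..b} \<longrightarrow> \<eta> t = 0))"
    using \<open>smooth_fun \<eta>\<close> by blast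
next
  assume "smooth_fun \<eta> \<and> (\<exists>a b. 0 < a \<and> a < b \<and> b < l \<and> (\<forall>t. t \<notin> {a..b} \<longrightarrow> \<eta> t = 0))"
  then obtain a b where "smooth_fun \<eta>" "0 < a" "a < b" "b < l" "\<forall>t. t \<notin> {a..b} \<longrightarrow> \<eta> t = 0"
    by blast
  then show "test_function l \<eta>"
    by (auto simp: test_function_def smooth_fun_def intro!: exI[of _ "{a..b}"])
qed

lemma test_function_smooth: "test_function l \<eta> \<Longrightarrow> smooth_fun \<eta>"
  by (simp add: test_function_def smooth_fun_def)

lemma test_function_has_derivative:
  "test_function l \<eta> \<Longrightarrow> (\<eta> has_real_derivative deriv \<eta> x) (at x)"
  using smooth_funD[OF test_function_smooth, of l \<eta> 0] by simp

lemma test_function_continuous: "test_function l \<eta> \<Longrightarrow> continuous_on S \<eta>"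
  by (meson DERIV_continuous_on has_field_derivative_at_within test_function_has_derivative)

lemma test_function_endpoints: "test_function l \<eta> \<Longrightarrow> \<eta> 0 = 0" "test_function l \<eta> \<Longrightarrow> \<eta> l = 0"
  unfolding test_function_def by auto

lemma test_function_deriv:
  assumes "test_function l \<eta>" shows "test_function l (deriv \<eta>)"
proof -
  obtain K where K: "compact K" "K \<subseteq> {0<..<l}" "\<And>t. t \<notin> K \<Longrightarrow> \<eta> t = 0"
    using assms by (auto simp: test_function_def)
  have "deriv \<eta> t = 0" if "t \<notin> K" for t
  proof (rule DERIV_imp_deriv)
    have "open (- K)" using K(1) by (simp add: compact_imp_closed open_Compl)
    with that K(3) show "(\<eta> has_real_derivative 0) (at t)"
      by (intro has_field_derivative_transform_within_open[of "\<lambda>_. 0" 0 t "- K" \<eta>]) auto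
  qed
  then show ?thesis
    using K smooth_fun_deriv[OF test_function_smooth[OF assms]]
    by (auto simp: test_function_def smooth_fun_def)
qed

lemma test_function_higher_deriv: "test_function l \<eta> \<Longrightarrow> test_function l ((deriv ^^ n) \<eta>)"
  by (induction n) (auto simp: test_function_deriv)

lemma test_function_lincomb:
  assumes "0 < l" "test_function l \<eta>" "test_function l \<rho>"
  shows "test_function l (\<lambda>t. \<eta> t + c * \<rho> t)"
proof -
  obtain K where K: "compact K" "K \<subseteq> {0<..<l}" "\<And>t. t \<notin> K \<Longrightarrow> \<eta> t = 0"
    using assms by (auto simp: test_function_def)
  obtain K' where K': "compact K'" "K' \<subseteq> {0<..<l}" "\<And>t. t \<notin> K' \<Longrightarrow> \<rho> t = 0"
    using assms by (auto simp: test_function_def)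
  show ?thesis
    unfolding test_function_def
  proof (intro conjI exI[of _ "K \<union> K'"] allI impI)
    show "(deriv ^^ n) (\<lambda>t. \<eta> t + c * \<rho> t) differentiable_on UNIV" for n
      using smooth_fun_lincomb[OF assms(2,3)[THEN test_function_smooth], of c]
      by (simp add: smooth_fun_def)
    show "\<eta> t + c * \<rho> t = 0" if "t \<notin> K \<union> K'" for t
      using that K(3)[of t] K'(3)[of t] by simp
  qed (use K K' in auto)
qed

text \<open>
  The primitive of \<open>\<theta>\<close> from \<open>0\<close> is constant beyond the support of \<open>\<theta>\<close>, and that constant is the
  integral of \<open>\<theta>\<close>.
\<close>

lemma test_function_antiderivative:
  assumes "0 < l" "test_function l \<theta>" "integral {0..l} \<theta> = 0"
  obtains H where "test_function l H" "deriv H = \<theta>"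
proof -
  obtain a b where ab: "0 < a" "a < b" "b < l" "\<And>t. t \<notin> {a..b} \<Longrightarrow> \<theta> t = 0"
    using assms(1,2) test_function_iff by blast
  define H where "H x = integral {0..x} \<theta>" for x
  have cont: "continuous_on S \<theta>" for S using test_function_continuous[OF assms(2)] .
  have left: "H x = 0" if "x < a" for x
  proof -
    have "integral {0..x} \<theta> = integral {0..x} (\<lambda>_. 0)"
      by (rule integral_cong) (use that ab in auto)
    then show ?thesis by (simp add: H_def)
  qed
  have right: "H x = 0" if "x > b" for x
  proof -
    have eq: "integral {0..y} \<theta> = integral {0..b} \<theta>" if "y > b" for y
    proof -
      have "integral {0..b} \<theta> + integral {b..y} \<theta> = integral {0..y} \<theta>"
        using ab that by (intro Henstock_Kurzweil_Integration.integral_combine integrable_continuous_interval cont) auto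
      moreover have "integral {b..y} \<theta> = integral {b..y} (\<lambda>_. 0)"
      proof (rule integral_spike[of "{b}"])
        show "0 = \<theta> x" if "x \<in> {b..y} - {b}" for x using that ab(4)[of x] by auto
      qed auto
      ultimately show ?thesis by simp
    qed
    show ?thesis using eq[OF that] eq[of l] assms(3) ab by (simp add: H_def)
  qed
  have der: "(H has_real_derivative \<theta> x) (at x)" for x
  proof (cases "x < a")
    case True
    have "((\<lambda>_. 0) has_real_derivative \<theta> x) (at x)" using ab(4)[of x] True by auto
    then show ?thesis
      by (rule has_field_derivative_transform_within_open[of _ _ _ "{..<a}"]) (use True left in auto)
  next
    case False
    have "(H has_real_derivative \<theta> x) (at x within {0..x+1})"
      unfolding H_def by (rule integral_has_real_derivative) (use False ab cont in auto)
    moreover have "at x within {0..x+1} = at x"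
      using False ab by (intro at_within_interior) auto
    ultimately show ?thesis by simp
  qed
  have "smooth_fun H"
    using test_function_smooth[OF assms(2)] der by (rule smooth_fun_antiderivative)
  then have "test_function l H"
    unfolding test_function_iff[OF assms(1)] using ab left right
    by (intro conjI exI[of _ a] exI[of _ b]) auto
  moreover have "deriv H = \<theta>" using der by (intro ext DERIV_imp_deriv)
  ultimately show ?thesis using that by blast
qed

text \<open>
  Since \<open>exp (- 1 / x)\<close> increases to \<open>1\<close>, these products converge boundedly to the indicator of
  \<open>{a<..<b}\<close>.
\<close>

definition interval_cutoff :: "real \<Rightarrow> real \<Rightarrow> nat \<Rightarrow> real \<Rightarrow> real" where
  "interval_cutoff a b n x = flat_exp 1 (real (Suc n) * (x - a)) * flat_exp 1 (real (Suc n) * (b - x))"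

lemma test_function_interval_cutoff:
  assumes "0 < a" "a < b" "b < l"
  shows "test_function l (interval_cutoff a b n)"
proof -
  have "(\<lambda>x. flat_exp 1 (real (Suc n) * x + (- real (Suc n) * a)) *
      flat_exp 1 (- real (Suc n) * x + real (Suc n) * b)) \<in> cutoff_algebra"
    by (intro cutoff_algebra.intros)
  moreover have "(\<lambda>x. flat_exp 1 (real (Suc n) * x + (- real (Suc n) * a)) *
      flat_exp 1 (- real (Suc n) * x + real (Suc n) * b)) = interval_cutoff a b n"
    by (auto simp: interval_cutoff_def fun_eq_iff algebra_simps)
  ultimately have "smooth_fun (interval_cutoff a b n)" using smooth_fun_cutoff_algebra by metis
  moreover have "\<forall>t. t \<notin> {a..b} \<longrightarrow> interval_cutoff a b n t = 0"
    by (auto simp: interval_cutoff_def flat_exp_def zero_less_mult_iff)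
  moreover have "0 < l" using assms by linarith
  ultimately show ?thesis
    using assms unfolding test_function_iff[OF \<open>0 < l\<close>] by blast
qed

lemma flat_exp_1_bounds: "0 \<le> flat_exp 1 x" "flat_exp 1 x \<le> 1"
  by (auto simp: flat_exp_def)

lemma interval_cutoff_bounds: "0 \<le> interval_cutoff a b n x" "interval_cutoff a b n x \<le> 1"
  by (auto simp: interval_cutoff_def flat_exp_1_bounds mult_le_one)

lemma interval_cutoff_tendsto: "(\<lambda>n. interval_cutoff a b n x) \<longlonglongrightarrow> indicator {a<..<b} x"
proof -
  have flat: "(\<lambda>n. flat_exp 1 (real (Suc n) * y)) \<longlonglongrightarrow> (if y > 0 then 1 else 0)" for y
  proof (cases "y > 0")
    case True
    have "(\<lambda>n. exp (- (inverse (real (Suc n)) * (1 / y)))) \<longlonglongrightarrow> exp (- (0 * (1 / y)))"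
      by (intro tendsto_intros LIMSEQ_inverse_real_of_nat)
    then show ?thesis using True by (simp add: flat_exp_def zero_less_mult_iff inverse_eq_divide)
  qed (auto simp: flat_exp_def zero_less_mult_iff)
  show ?thesis
    unfolding interval_cutoff_def
    using tendsto_mult[OF flat[of "x - a"] flat[of "b - x"]]
    by (auto simp: indicator_def split: if_splits elim!: tendsto_eq_rhs)
qed


section \<open>Square integrable functions on an interval\<close>

lemma integrable_continuous_interval_on:
  "continuous_on {0..l} f \<Longrightarrow> integrable (lebesgue_on {0..l}) (f :: real \<Rightarrow> real)"
  by (rule continuous_imp_integrable_real)

lemma LINT_continuous_eq_integral:
  "continuous_on {0..l} f \<Longrightarrow> (LINT t|lebesgue_on {0..l}. f t) = integral {0..l} (f :: real \<Rightarrow> real)"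
  by (intro lebesgue_integral_eq_integral integrable_continuous_interval_on) auto

lemma edge_L2_measurable: "f \<in> edge_L2 l \<Longrightarrow> f \<in> borel_measurable (lebesgue_on {0..l})"
  by (simp add: edge_L2_def)

lemma abs_mult_le_power2_sum: "\<bar>x * y\<bar> \<le> x\<^sup>2 + (y :: real)\<^sup>2"
proof -
  have "2 * \<bar>x * y\<bar> \<le> x\<^sup>2 + y\<^sup>2"
    using sum_squares_bound[of "\<bar>x\<bar>" "\<bar>y\<bar>"] by (simp add: abs_mult)
  then show ?thesis using abs_ge_zero[of "x * y"] by linarith
qed

lemma edge_L2_mult_integrable:
  assumes "f \<in> edge_L2 l" "g \<in> edge_L2 l"
  shows "integrable (lebesgue_on {0..l}) (\<lambda>t. f t * g t)"
proof (rule Bochner_Integration.integrable_bound)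
  show "integrable (lebesgue_on {0..l}) (\<lambda>t. (f t)\<^sup>2 + (g t)\<^sup>2)"
    using assms by (auto simp: edge_L2_def)
  show "(\<lambda>t. f t * g t) \<in> borel_measurable (lebesgue_on {0..l})"
    using assms[THEN edge_L2_measurable] by (rule borel_measurable_times)
  show "AE t in lebesgue_on {0..l}. norm (f t * g t) \<le> norm ((f t)\<^sup>2 + (g t)\<^sup>2)"
    using abs_mult_le_power2_sum by simp
qed

lemma edge_L2_continuous: "continuous_on {0..l} f \<Longrightarrow> f \<in> edge_L2 l"
  unfolding edge_L2_def
  by (auto intro!: integrable_continuous_interval_on continuous_intros
        continuous_imp_measurable_on_sets_lebesgue)

lemma edge_L2_scale: "f \<in> edge_L2 l \<Longrightarrow> (\<lambda>t. c * f t) \<in> edge_L2 l"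
  by (auto simp: edge_L2_def power_mult_distrib)

lemma edge_L2_add:
  assumes "f \<in> edge_L2 l" "g \<in> edge_L2 l" shows "(\<lambda>t. f t + g t) \<in> edge_L2 l"
proof -
  have "integrable (lebesgue_on {0..l}) (\<lambda>t. (f t)\<^sup>2 + (g t)\<^sup>2 + 2 * (f t * g t))"
    using assms edge_L2_mult_integrable[OF assms]
    by (intro Bochner_Integration.integrable_add integrable_mult_right) (auto simp: edge_L2_def)
  moreover have "(\<lambda>t. f t + g t) \<in> borel_measurable (lebesgue_on {0..l})"
    using assms[THEN edge_L2_measurable] by (rule borel_measurable_add)
  ultimately show ?thesis by (simp add: edge_L2_def power2_sum algebra_simps)
qed

lemma edge_L2_integrable: "f \<in> edge_L2 l \<Longrightarrow> integrable (lebesgue_on {0..l}) f"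
  using edge_L2_mult_integrable[of f l "\<lambda>_. 1"] edge_L2_continuous[of l "\<lambda>_. 1"] by simp

lemma edge_L2_indicator:
  assumes "f \<in> edge_L2 l" and "A \<in> sets lebesgue"
  shows "(\<lambda>t. indicator A t * f t) \<in> edge_L2 l"
proof -
  have A: "A \<inter> {0..l} \<in> sets (lebesgue_on {0..l})"
    using assms(2) by (auto simp: sets_restrict_space)
  have [measurable]: "f \<in> borel_measurable (lebesgue_on {0..l})"
    using assms by (simp add: edge_L2_def)
  have [measurable]: "(\<lambda>t. indicator A t :: real) \<in> borel_measurable (lebesgue_on {0..l})"
    using assms(2) by (intro measurable_restrict_space1) simp
  have "integrable (lebesgue_on {0..l}) (\<lambda>t. (indicator A t * f t)\<^sup>2)"
  proof (rule Bochner_Integration.integrable_bound[of _ "\<lambda>t. (f t)\<^sup>2"])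
    show "(\<lambda>t. (indicator A t * f t)\<^sup>2) \<in> borel_measurable (lebesgue_on {0..l})" by measurable
  qed (use assms in \<open>auto simp: edge_L2_def indicator_def\<close>)
  then show ?thesis by (simp add: edge_L2_def)
qed

lemma AE_lebesgue_on_neq: "AE t in lebesgue_on {0..l}. t \<noteq> (a::real)"
proof -
  have "AE t in lebesgue. t \<noteq> a" by (intro AE_completion AE_lborel_singleton)
  then show ?thesis by (auto simp: AE_restrict_space_iff elim: eventually_mono)
qed

lemma AE_zero_imp_zero_continuous:
  assumes "0 < l" "continuous_on {0..l} f" "AE t in lebesgue_on {0..l}. f t = (0::real)" "(t::real) \<in> {0..l}"
  shows "f t = 0"
proof -
  have c: "continuous_on {0..l} (\<lambda>t. (f t)\<^sup>2)" using assms(2) by (intro continuous_intros)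
  have "integral {0..l} (\<lambda>t. (f t)\<^sup>2) = (LINT t|lebesgue_on {0..l}. (f t)\<^sup>2)"
    using LINT_continuous_eq_integral[OF c] by simp
  also have "\<dots> = 0" using assms(3) by (intro integral_eq_zero_AE) auto
  finally have "((\<lambda>t. (f t)\<^sup>2) has_integral 0) (cbox 0 l)"
    using integrable_continuous_interval[OF c] by (simp add: has_integral_iff)
  then have "(f t)\<^sup>2 = 0"
    by (rule has_integral_0_cbox_imp_0[rotated 2]) (use assms c in auto)
  then show ?thesis by simp
qed


section \<open>The fundamental lemma of the calculus of variations\<close>

lemma bounded_limit_integral_zero:
  fixes k :: "'a \<Rightarrow> real"
  assumes k: "integrable M k" and meas: "\<And>n. s n \<in> borel_measurable M"
    and bound: "\<And>n t. \<bar>s n t\<bar> \<le> 1" and lim: "\<And>t. (\<lambda>n. s n t) \<longlonglongrightarrow> g t"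
    and zero: "\<And>n. (LINT t|M. k t * s n t) = 0"
  shows "(LINT t|M. k t * g t) = (0 :: real)"
proof -
  have g: "g \<in> borel_measurable M" by (rule borel_measurable_LIMSEQ_real[OF lim meas])
  have "(\<lambda>n. LINT t|M. k t * s n t) \<longlonglongrightarrow> (LINT t|M. k t * g t)"
  proof (rule integral_dominated_convergence[where w = "\<lambda>t. \<bar>k t\<bar>"])
    show "(\<lambda>t. k t * g t) \<in> borel_measurable M" "(\<lambda>t. k t * s n t) \<in> borel_measurable M" for n
      by (intro borel_measurable_times borel_measurable_integrable[OF k] g meas)+
  qed (use k bound in \<open>auto intro!: tendsto_intros lim simp: abs_mult mult_left_le\<close>)
  then show ?thesis using zero by (simp add: LIMSEQ_const_iff)
qed

text \<open>
  Interval cutoffs are test functions, so dominated convergence turns vanishing moments into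
  vanishing integrals over intervals. Half lines are enough to determine a measure.
\<close>

lemma null_moments_imp_null_tails:
  assumes "0 < l" "integrable (lebesgue_on {0..l}) k"
    and test: "\<And>\<eta>. test_function l \<eta> \<Longrightarrow> (LINT t|lebesgue_on {0..l}. k t * \<eta> t) = 0"
  shows "(LINT t|lebesgue_on {0..l}. k t * indicator {x<..} t) = 0"
proof -
  have [measurable]: "k \<in> borel_measurable (lebesgue_on {0..l})" using assms(2) by auto
  have ind: "(indicator A :: real \<Rightarrow> real) \<in> borel_measurable (lebesgue_on {0..l})"
    if "A \<in> sets borel" for A
    using that by (intro measurable_restrict_space1 measurable_completion) auto
  have inner: "(LINT t|lebesgue_on {0..l}. k t * indicator {a<..<b} t) = 0"
    if ab: "0 < a" "a < b" "b < l" for a b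
  proof (rule bounded_limit_integral_zero[OF assms(2)])
    show "interval_cutoff a b n \<in> borel_measurable (lebesgue_on {0..l})" for n
      by (intro continuous_imp_measurable_on_sets_lebesgue
            test_function_continuous[OF test_function_interval_cutoff[OF ab]]) auto
    show "(LINT t|lebesgue_on {0..l}. k t * interval_cutoff a b n t) = 0" for n
      by (rule test[OF test_function_interval_cutoff[OF ab]])
  qed (use interval_cutoff_bounds interval_cutoff_tendsto in auto)
  define a where "a = max x 0"
  have sub: "(LINT t|lebesgue_on {0..l}. k t * indicator {x<..} t)
      = (LINT t|lebesgue_on {0..l}. k t * indicator {a<..<l} t)"
  proof (rule integral_cong_AE)
    show "AE t in lebesgue_on {0..l}. k t * indicator {x<..} t = k t * indicator {a<..<l} t"
      using AE_lebesgue_on_neq[where l = l and a = 0] AE_lebesgue_on_neq[where l = l and a = l]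
        AE_space
      by eventually_elim (auto simp: a_def indicator_def)
  qed (auto intro!: borel_measurable_times ind)
  show ?thesis
  proof (cases "a < l")
    case True
    (* test functions vanish near the ends of the edge, so (a, l) is exhausted from inside *)
    define d where "d n = (l - a) / real (n + 3)" for n
    have d0: "d \<longlonglongrightarrow> 0"
      unfolding d_def using LIMSEQ_ignore_initial_segment[OF lim_const_over_n[of "l - a"], of 3] by simp
    have dpos: "0 < d n" "d n < (l - a) / 2" for n
    proof -
      show "0 < d n" using True by (simp add: d_def)
      have "(l - a) / real (n + 3) < (l - a) / 2"
        using True by (intro divide_strict_left_mono) auto
      then show "d n < (l - a) / 2" by (simp add: d_def)
    qed
    have "(LINT t|lebesgue_on {0..l}. k t * indicator {a<..<l} t) = 0"
    proof (rule bounded_limit_integral_zero[OF assms(2)])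
      show "(\<lambda>n. indicator {a + d n<..<l - d n} t :: real) \<longlonglongrightarrow> indicator {a<..<l} t" for t
      proof (cases "t \<in> {a<..<l}")
        case True
        then have "\<forall>\<^sub>F n in sequentially. d n < min (t - a) (l - t)"
          by (intro order_tendstoD(2)[OF d0]) auto
        then show ?thesis
          by (intro tendsto_eventually) (use True in \<open>auto elim!: eventually_mono simp: indicator_def\<close>)
      next
        case False
        have "indicator {a + d n<..<l - d n} t = (0::real)" for n
          using False dpos[of n] by (simp add: indicator_def not_less) linarith
        with False show ?thesis by simp
      qed
      show "(LINT t|lebesgue_on {0..l}. k t * indicator {a + d n<..<l - d n} t) = 0" for n
        using dpos[of n] True by (intro inner) (auto simp: a_def field_simps)
      show "(indicator {a + d n<..<l - d n} :: real \<Rightarrow> real) \<in> borel_measurable (lebesgue_on {0..l})" for n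
        by (intro ind) simp
    qed (auto simp: indicator_def)
    then show ?thesis using sub by simp
  next
    case False
    then show ?thesis using sub by simp
  qed
qed

text \<open>
  The positive and the negative part of \<open>k\<close> are
  densities of finite measures that agree on half lines, hence are equal. As \<open>k\<close> is only Lebesgue
  measurable, the argument is made for a Borel function \<open>g\<close> that agrees with it almost everywhere.
\<close>

lemma fundamental_lemma:
  assumes "0 < l" "integrable (lebesgue_on {0..l}) k"
    and test: "\<And>\<eta>. test_function l \<eta> \<Longrightarrow> (LINT t|lebesgue_on {0..l}. k t * \<eta> t) = 0"
  shows "AE t in lebesgue_on {0..l}. k t = 0"
proof -
  define k0 where "k0 t = indicator {0..l} t * k t" for t
  have k0: "integrable lebesgue k0"
    using assms(2) by (simp add: k0_def[abs_def] integrable_restrict_space)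
  then obtain g where [measurable]: "g \<in> borel_measurable lborel" and AE_g: "AE t in lborel. k0 t = g t"
    using completion_ex_borel_measurable_real[of k0 lborel] borel_measurable_integrable by blast
  have AE_g': "AE t in lebesgue. k0 t = g t" using AE_g by (rule AE_completion)
  have [measurable]: "g \<in> borel_measurable lebesgue"
    using \<open>g \<in> borel_measurable lborel\<close> by (rule measurable_completion)
  have [measurable]: "k0 \<in> borel_measurable lebesgue" using k0 by auto
  have ind[measurable]: "(indicator {x<..} :: real \<Rightarrow> real) \<in> borel_measurable lebesgue" for x
    by (intro measurable_completion) auto
  have int_g: "integrable lborel g"
    using integrable_cong_AE[of k0 lebesgue g] k0 AE_g' by (simp add: integrable_completion)
  have tail: "(LINT t|lborel. g t * indicator {x<..} t) = 0" for x
  proof -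
    have "(LINT t|lborel. g t * indicator {x<..} t) = (LINT t|lebesgue. g t * indicator {x<..} t)"
      by (intro integral_completion[symmetric]) measurable
    also have "\<dots> = (LINT t|lebesgue. k0 t * indicator {x<..} t)"
      by (intro integral_cong_AE) (use AE_g' in auto)
    also have "\<dots> = (LINT t|lebesgue_on {0..l}. k t * indicator {x<..} t)"
      by (simp add: integral_restrict_space k0_def mult.assoc)
    also have "\<dots> = 0" by (rule null_moments_imp_null_tails) fact+
    finally show ?thesis .
  qed
  have tail_parts: "(\<integral>\<^sup>+t. ennreal (g t) * indicator {x<..} t \<partial>lborel) =
      (\<integral>\<^sup>+t. ennreal (- g t) * indicator {x<..} t \<partial>lborel)"
    and tail_finite: "(\<integral>\<^sup>+t. ennreal (g t) * indicator {x<..} t \<partial>lborel) < \<infinity>" for x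
  proof -
    have int: "integrable lborel (\<lambda>t. g t * indicator {x<..} t)"
      using int_g by (rule integrable_mult_indicator[of "{x<..}" lborel g, simplified mult.commute real_scaleR_def, rotated]) auto
    have eq: "ennreal (g t) * indicator {x<..} t = ennreal (g t * indicator {x<..} t)"
      "ennreal (- g t) * indicator {x<..} t = ennreal (- (g t * indicator {x<..} t))" for t
      by (auto simp: indicator_def)
    obtain r q where "0 \<le> r" "0 \<le> q"
      and r: "(\<integral>\<^sup>+t. ennreal (g t * indicator {x<..} t) \<partial>lborel) = ennreal r"
      and q: "(\<integral>\<^sup>+t. ennreal (- (g t * indicator {x<..} t)) \<partial>lborel) = ennreal q"
      and "(LINT t|lborel. g t * indicator {x<..} t) = r - q"
      by (rule integrableE[OF int])
    then show "(\<integral>\<^sup>+t. ennreal (g t) * indicator {x<..} t \<partial>lborel) =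
      (\<integral>\<^sup>+t. ennreal (- g t) * indicator {x<..} t \<partial>lborel)"
      "(\<integral>\<^sup>+t. ennreal (g t) * indicator {x<..} t \<partial>lborel) < \<infinity>"
      using tail[of x] by (auto simp: eq)
  qed
  have "density lborel (\<lambda>t. ennreal (g t)) = density lborel (\<lambda>t. ennreal (- g t))"
    by (rule measure_eqI_lessThan) (use tail_parts tail_finite in \<open>auto simp: emeasure_density\<close>)
  then have "AE t in lborel. ennreal (g t) = ennreal (- g t)"
    by (subst (asm) sigma_finite_measure.density_unique_iff[OF sigma_finite_lborel]) auto
  then have "AE t in lborel. k0 t = 0"
    using AE_g
  proof eventually_elim
    case (elim t)
    then show ?case by (cases "g t \<ge> 0") (auto simp: ennreal_eq_0_iff ennreal_neg)
  qed
  then have "AE t in lebesgue. k0 t = 0" by (rule AE_completion)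
  then show ?thesis
    by (auto simp: AE_restrict_space_iff k0_def elim!: eventually_mono)
qed

lemma weak_deriv_unique:
  assumes "0 < l" "g \<in> edge_L2 l" "h \<in> edge_L2 l" "weak_deriv l j f g" "weak_deriv l j f h"
  shows "AE t in lebesgue_on {0..l}. g t = h t"
proof -
  have "AE t in lebesgue_on {0..l}. g t - h t = 0"
  proof (rule fundamental_lemma[OF assms(1)])
    fix \<eta> assume \<eta>: "test_function l \<eta>"
    have \<eta>2: "\<eta> \<in> edge_L2 l" by (intro edge_L2_continuous test_function_continuous[OF \<eta>])
    have "(-1) ^ j * (LINT t|lebesgue_on {0..l}. g t * \<eta> t) = (-1) ^ j * (LINT t|lebesgue_on {0..l}. h t * \<eta> t)"
      using assms(4)[unfolded weak_deriv_def, rule_format, OF \<eta>]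
        assms(5)[unfolded weak_deriv_def, rule_format, OF \<eta>] by simp
    then show "(LINT t|lebesgue_on {0..l}. (g t - h t) * \<eta> t) = 0"
      using edge_L2_mult_integrable[OF assms(2) \<eta>2] edge_L2_mult_integrable[OF assms(3) \<eta>2]
      by (simp add: left_diff_distrib)
  qed (use assms edge_L2_integrable in auto)
  then show ?thesis by simp
qed


section \<open>A continuous weak second derivative is classical\<close>

lemma test_function_by_parts:
  assumes "0 < l" "\<And>t. t \<in> {0..l} \<Longrightarrow> (f has_real_derivative f' t) (at t within {0..l})"
    and "continuous_on {0..l} f'" "test_function l \<eta>"
  shows "integral {0..l} (\<lambda>t. f t * deriv \<eta> t) = - integral {0..l} (\<lambda>t. f' t * \<eta> t)"
proof -
  have cf: "continuous_on {0..l} f" using assms(2) DERIV_continuous_on by blast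
  note c = test_function_continuous[OF assms(4), of "{0..l}"]
    test_function_continuous[OF test_function_deriv[OF assms(4)], of "{0..l}"]
  have "((\<lambda>t. f t * \<eta> t) has_vector_derivative f' t * \<eta> t + f t * deriv \<eta> t) (at t within {0..l})"
    if "t \<in> {0..l}" for t
    using DERIV_mult[OF assms(2)[OF that]
        has_field_derivative_at_within[OF test_function_has_derivative[OF assms(4)]]]
    by (simp add: has_real_derivative_iff_has_vector_derivative mult.commute)
  from fundamental_theorem_of_calculus[OF _ this]
  have "((\<lambda>t. f' t * \<eta> t + f t * deriv \<eta> t) has_integral f l * \<eta> l - f 0 * \<eta> 0) {0..l}"
    using assms(1) by simp
  then have "integral {0..l} (\<lambda>t. f' t * \<eta> t + f t * deriv \<eta> t) = 0"
    using test_function_endpoints[OF assms(4)] by (simp add: integral_unique)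
  moreover have "integral {0..l} (\<lambda>t. f' t * \<eta> t + f t * deriv \<eta> t) =
      integral {0..l} (\<lambda>t. f' t * \<eta> t) + integral {0..l} (\<lambda>t. f t * deriv \<eta> t)"
    by (intro Henstock_Kurzweil_Integration.integral_add integrable_continuous_interval continuous_on_mult cf c assms(3))
  ultimately show ?thesis by simp
qed

lemma normalized_test_function:
  assumes "0 < l" obtains \<rho> where "test_function l \<rho>" "integral {0..l} \<rho> = 1"
proof -
  define \<psi> where "\<psi> = interval_cutoff (l/3) (2*l/3) 0"
  have \<psi>: "test_function l \<psi>"
    unfolding \<psi>_def by (rule test_function_interval_cutoff) (use assms in auto)
  have "integral {0..l} \<psi> \<noteq> 0"
  proof
    assume "integral {0..l} \<psi> = 0"
    then have "(\<psi> has_integral 0) (cbox 0 l)"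
      using integrable_continuous_interval[OF test_function_continuous[OF \<psi>, of "{0..l}"]]
      by (simp add: has_integral_iff)
    then have "\<psi> (l/2) = 0"
      by (rule has_integral_0_cbox_imp_0[rotated 2])
        (use assms test_function_continuous[OF \<psi>] in \<open>auto simp: \<psi>_def interval_cutoff_bounds\<close>)
    then show False using assms by (simp add: \<psi>_def interval_cutoff_def flat_exp_def)
  qed
  moreover have "test_function l (\<lambda>t. \<psi> t + (inverse (integral {0..l} \<psi>) - 1) * \<psi> t)"
    by (rule test_function_lincomb[OF assms \<psi> \<psi>])
  ultimately show ?thesis
    using that[of "\<lambda>t. \<psi> t * inverse (integral {0..l} \<psi>)"] by (simp add: algebra_simps)
qed

text \<open>
  With \<open>\<rho>\<close> of integral one, \<open>\<eta> - (\<integral>\<eta>) \<rho>\<close> has vanishing integral, so it is the derivative of a test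
  function. Testing with that function removes one derivative from a weak equation at the price of
  an unknown constant.
\<close>

lemma test_function_split:
  assumes "0 < l" "test_function l \<rho>" "integral {0..l} \<rho> = 1" "test_function l \<eta>"
  obtains H where "test_function l H" "\<And>t. deriv H t = \<eta> t - integral {0..l} \<eta> * \<rho> t"
    "\<And>t. deriv (deriv H) t = deriv \<eta> t - integral {0..l} \<eta> * deriv \<rho> t"
proof -
  let ?c = "- integral {0..l} \<eta>"
  have t: "test_function l (\<lambda>t. \<eta> t + ?c * \<rho> t)" by (rule test_function_lincomb) fact+
  moreover have "integral {0..l} (\<lambda>t. \<eta> t + ?c * \<rho> t) = integral {0..l} \<eta> + integral {0..l} (\<lambda>t. ?c * \<rho> t)"
    by (intro Henstock_Kurzweil_Integration.integral_add integrable_continuous_interval continuous_intros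
        test_function_continuous[OF assms(2)] test_function_continuous[OF assms(4)])
  then have "integral {0..l} (\<lambda>t. \<eta> t + ?c * \<rho> t) = 0"
    using assms(3) by simp
  ultimately obtain H where H: "test_function l H" "deriv H = (\<lambda>t. \<eta> t + ?c * \<rho> t)"
    using test_function_antiderivative[OF assms(1)] by blast
  have "deriv (\<lambda>t. \<eta> t + ?c * \<rho> t) t = deriv \<eta> t + ?c * deriv \<rho> t" for t
    by (intro DERIV_imp_deriv DERIV_add DERIV_cmult test_function_has_derivative[OF assms(2)]
        test_function_has_derivative[OF assms(4)])
  then show ?thesis using that[OF H(1)] H(2) by simp
qed

lemma integral_zero_moments_continuous:
  assumes "0 < l" "continuous_on {0..l} f"
    and "\<And>\<eta>. test_function l \<eta> \<Longrightarrow> integral {0..l} (\<lambda>t. f t * \<eta> t) = 0" and "t \<in> {0..l}"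
  shows "f t = (0::real)"
proof (rule AE_zero_imp_zero_continuous[OF assms(1,2) _ assms(4)])
  show "AE t in lebesgue_on {0..l}. f t = 0"
  proof (rule fundamental_lemma[OF assms(1) integrable_continuous_interval_on[OF assms(2)]])
    fix \<eta> assume \<eta>: "test_function l \<eta>"
    have "continuous_on {0..l} (\<lambda>t. f t * \<eta> t)"
      by (intro continuous_intros assms test_function_continuous[OF \<eta>])
    then show "(LINT t|lebesgue_on {0..l}. f t * \<eta> t) = 0"
      using assms(3)[OF \<eta>] by (simp add: LINT_continuous_eq_integral)
  qed
qed

text \<open>
  The du Bois-Reymond lemma of order one, for the equation \<open>f' = - c\<close>.
\<close>

lemma weak_first_derivative_constant:
  assumes "0 < l" "continuous_on {0..l} f"
    and "\<And>\<eta>. test_function l \<eta> \<Longrightarrow> integral {0..l} (\<lambda>t. f t * deriv \<eta> t) = c * integral {0..l} \<eta>"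
  obtains b where "\<And>t. t \<in> {0..l} \<Longrightarrow> f t = b - c * (t::real)"
proof -
  obtain \<rho> where \<rho>: "test_function l \<rho>" "integral {0..l} \<rho> = 1"
    using normalized_test_function[OF assms(1)] .
  define h where "h t = f t + c * t" for t
  define b where "b = integral {0..l} (\<lambda>t. h t * \<rho> t)"
  have ch: "continuous_on {0..l} h" unfolding h_def by (intro continuous_intros assms)
  have der: "integral {0..l} (\<lambda>t. h t * deriv H t) = 0" if H: "test_function l H" for H
  proof -
    note cH = test_function_continuous[OF test_function_deriv[OF H], of "{0..l}"]
    have "integral {0..l} (\<lambda>t. c * t * deriv H t) = - integral {0..l} (\<lambda>t. c * H t)"
      by (rule test_function_by_parts[OF assms(1) _ _ H]) (auto intro!: derivative_eq_intros)
    moreover have "integral {0..l} (\<lambda>t. f t * deriv H t + c * t * deriv H t) =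
        integral {0..l} (\<lambda>t. f t * deriv H t) + integral {0..l} (\<lambda>t. c * t * deriv H t)"
      by (intro Henstock_Kurzweil_Integration.integral_add integrable_continuous_interval continuous_intros assms cH)
    ultimately show ?thesis
      using assms(3)[OF H] by (simp add: h_def distrib_right)
  qed
  have "h t - b = 0" if "t \<in> {0..l}" for t
  proof (rule integral_zero_moments_continuous[OF assms(1) _ _ that])
    show "continuous_on {0..l} (\<lambda>t. h t - b)" by (intro continuous_intros ch)
    fix \<eta> assume \<eta>: "test_function l \<eta>"
    obtain H where H: "test_function l H" "\<And>t. deriv H t = \<eta> t - integral {0..l} \<eta> * \<rho> t"
      by (rule test_function_split[OF assms(1) \<rho> \<eta>]) (rule that)
    note c = test_function_continuous[OF \<eta>, of "{0..l}"] test_function_continuous[OF \<rho>(1), of "{0..l}"] ch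
    have "0 = integral {0..l} (\<lambda>t. h t * \<eta> t - integral {0..l} \<eta> * (h t * \<rho> t))"
      using der[OF H(1)] by (simp add: H(2) algebra_simps)
    also have "\<dots> = integral {0..l} (\<lambda>t. h t * \<eta> t) - integral {0..l} (\<lambda>t. integral {0..l} \<eta> * (h t * \<rho> t))"
      by (intro Henstock_Kurzweil_Integration.integral_diff integrable_continuous_interval continuous_intros c)
    also have "\<dots> = integral {0..l} (\<lambda>t. h t * \<eta> t) - integral {0..l} (\<lambda>t. b * \<eta> t)"
      by (simp add: b_def mult.commute)
    also have "\<dots> = integral {0..l} (\<lambda>t. h t * \<eta> t - b * \<eta> t)"
      by (intro Henstock_Kurzweil_Integration.integral_diff[symmetric] integrable_continuous_interval continuous_intros c)
    finally show "integral {0..l} (\<lambda>t. (h t - b) * \<eta> t) = 0" by (simp add: left_diff_distrib)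
  qed
  then show ?thesis using that[of b] by (simp add: h_def algebra_simps)
qed

text \<open>
  By the splitting of test functions, \<open>f'' = 0\<close> in the weak sense implies that \<open>f'\<close> is weakly the
  constant \<open>- c\<close>, where \<open>c\<close> is the moment of \<open>f\<close> against \<open>\<rho>'\<close>.
\<close>

lemma weak_second_derivative_zero:
  assumes "0 < l" "continuous_on {0..l} f"
    and zero: "\<And>\<eta>. test_function l \<eta> \<Longrightarrow> integral {0..l} (\<lambda>t. f t * deriv (deriv \<eta>) t) = 0"
  obtains b c where "\<And>t. t \<in> {0..l} \<Longrightarrow> f t = b - c * (t::real)"
proof -
  obtain \<rho> where \<rho>: "test_function l \<rho>" "integral {0..l} \<rho> = 1"
    using normalized_test_function[OF assms(1)] .
  define c where "c = integral {0..l} (\<lambda>t. f t * deriv \<rho> t)"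
  have "integral {0..l} (\<lambda>t. f t * deriv \<eta> t) = c * integral {0..l} \<eta>" if \<eta>: "test_function l \<eta>" for \<eta>
  proof -
    obtain H where H: "test_function l H" "\<And>t. deriv (deriv H) t = deriv \<eta> t - integral {0..l} \<eta> * deriv \<rho> t"
      by (rule test_function_split[OF assms(1) \<rho> \<eta>]) (rule that)
    note cs = test_function_continuous[OF test_function_deriv[OF \<eta>], of "{0..l}"]
      test_function_continuous[OF test_function_deriv[OF \<rho>(1)], of "{0..l}"] assms(2)
    have "0 = integral {0..l} (\<lambda>t. f t * deriv \<eta> t - integral {0..l} \<eta> * (f t * deriv \<rho> t))"
      using zero[OF H(1)] by (simp add: H(2) algebra_simps)
    also have "\<dots> = integral {0..l} (\<lambda>t. f t * deriv \<eta> t) - integral {0..l} (\<lambda>t. integral {0..l} \<eta> * (f t * deriv \<rho> t))"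
      by (intro Henstock_Kurzweil_Integration.integral_diff integrable_continuous_interval continuous_intros cs)
    finally show ?thesis by (simp add: c_def)
  qed
  then show ?thesis using weak_first_derivative_constant[OF assms(1,2)] that by blast
qed

text \<open>
  Integrating \<open>g\<close> twice gives a classical solution \<open>G2\<close> of \<open>G2'' = g\<close>; the difference \<open>f - G2\<close> has
  weak second derivative zero, hence is affine. This serves twice: it makes eigenfunctions classical
  up to the ends of the edges, and it supplies the odd derivatives of the solution.
\<close>

lemma weak_second_derivative_classical:
  assumes "0 < l" "continuous_on {0..l} f" "continuous_on {0..l} g" "weak_deriv l 2 f g"
  obtains f' where "\<And>t. t \<in> {0..l} \<Longrightarrow> (f has_real_derivative f' t) (at t within {0..l})"
    "\<And>t. t \<in> {0..l} \<Longrightarrow> (f' has_real_derivative g t) (at t within {0..l})"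
proof -
  define G1 where "G1 t = integral {0..t} g" for t
  have G1: "(G1 has_real_derivative g t) (at t within {0..l})" if "t \<in> {0..l}" for t
    unfolding G1_def using integral_has_real_derivative[OF assms(3)] that by blast
  then have cG1: "continuous_on {0..l} G1" using DERIV_continuous_on by blast
  define G2 where "G2 t = integral {0..t} G1" for t
  have G2: "(G2 has_real_derivative G1 t) (at t within {0..l})" if "t \<in> {0..l}" for t
    unfolding G2_def using integral_has_real_derivative[OF cG1] that by blast
  then have cG2: "continuous_on {0..l} G2" using DERIV_continuous_on by blast
  have "integral {0..l} (\<lambda>t. (f t - G2 t) * deriv (deriv \<eta>) t) = 0" if \<eta>: "test_function l \<eta>" for \<eta>
  proof -
    note \<eta>' = test_function_deriv[OF \<eta>]
    note c = test_function_continuous[OF \<eta>, of "{0..l}"]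
      test_function_continuous[OF test_function_deriv[OF \<eta>'], of "{0..l}"] assms(2,3) cG2
    have "integral {0..l} (\<lambda>t. G2 t * deriv (deriv \<eta>) t) = integral {0..l} (\<lambda>t. g t * \<eta> t)"
      using test_function_by_parts[OF assms(1) G2 cG1 \<eta>'] test_function_by_parts[OF assms(1) G1 assms(3) \<eta>]
      by simp
    also have "\<dots> = integral {0..l} (\<lambda>t. f t * deriv (deriv \<eta>) t)"
    proof -
      have "continuous_on {0..l} (\<lambda>t. f t * deriv (deriv \<eta>) t)" "continuous_on {0..l} (\<lambda>t. g t * \<eta> t)"
        by (intro continuous_intros c)+
      then show ?thesis
        using assms(4) \<eta> by (auto simp: weak_deriv_def numeral_2_eq_2 LINT_continuous_eq_integral)
    qed
    finally have "integral {0..l} (\<lambda>t. f t * deriv (deriv \<eta>) t) - integral {0..l} (\<lambda>t. G2 t * deriv (deriv \<eta>) t) = 0"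
      by simp
    also have "integral {0..l} (\<lambda>t. f t * deriv (deriv \<eta>) t) - integral {0..l} (\<lambda>t. G2 t * deriv (deriv \<eta>) t) =
        integral {0..l} (\<lambda>t. f t * deriv (deriv \<eta>) t - G2 t * deriv (deriv \<eta>) t)"
      by (intro Henstock_Kurzweil_Integration.integral_diff[symmetric] integrable_continuous_interval continuous_intros c)
    finally show ?thesis by (simp add: left_diff_distrib)
  qed
  moreover have "continuous_on {0..l} (\<lambda>t. f t - G2 t)" by (intro continuous_intros assms cG2)
  ultimately obtain b c where bc: "\<And>t. t \<in> {0..l} \<Longrightarrow> f t - G2 t = b - c * t"
    using weak_second_derivative_zero[OF assms(1), of "\<lambda>t. f t - G2 t"] by blast
  show ?thesis
  proof (rule that[of "\<lambda>t. G1 t - c"])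
    fix t assume t: "t \<in> {0..l}"
    have "((\<lambda>t. G2 t + (b - c * t)) has_real_derivative G1 t - c) (at t within {0..l})"
      using G2[OF t] by (auto intro!: derivative_eq_intros)
    then show "(f has_real_derivative G1 t - c) (at t within {0..l})"
      by (rule has_field_derivative_transform_within[OF _ zero_less_one t]) (use bc in \<open>auto simp: algebra_simps\<close>)
    show "((\<lambda>t. G1 t - c) has_real_derivative g t) (at t within {0..l})"
      using G1[OF t] by (auto intro!: derivative_eq_intros)
  qed
qed


section \<open>The Hilbert space geometry of \<open>L\<^sub>2\<close> of a graph\<close>

locale metric_graph_space =
  fixes G :: "('v, 'e) metric_graph"
  assumes compact_graph: "compact_metric_graph G"
begin

lemma fin_digraph_truncate: "fin_digraph (pre_digraph.truncate G)"
  using compact_graph by (simp add: compact_metric_graph_def)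

lemma finite_arcs [simp]: "finite (arcs G)"
  using fin_digraph.finite_arcs[OF fin_digraph_truncate] by (simp add: pre_digraph.defs)

lemma finite_verts [simp]: "finite (verts G)"
  using fin_digraph.finite_verts[OF fin_digraph_truncate] by (simp add: pre_digraph.defs)

lemma len_pos: "e \<in> arcs G \<Longrightarrow> 0 < len G e"
  using compact_graph by (simp add: compact_metric_graph_def)

lemma tail_head_verts:
  assumes "e \<in> arcs G" shows "tail G e \<in> verts G" "head G e \<in> verts G"
  using wf_digraph.tail_in_verts[OF fin_digraph.axioms(1)[OF fin_digraph_truncate], of e]
    wf_digraph.head_in_verts[OF fin_digraph.axioms(1)[OF fin_digraph_truncate], of e] assms
  by (simp_all add: pre_digraph.defs)

lemma graph_L2_scale: "f \<in> graph_L2 G \<Longrightarrow> (\<lambda>e t. c * f e t) \<in> graph_L2 G"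
  by (simp add: graph_L2_def edge_L2_scale)

lemma graph_L2_add: "f \<in> graph_L2 G \<Longrightarrow> g \<in> graph_L2 G \<Longrightarrow> (\<lambda>e t. f e t + g e t) \<in> graph_L2 G"
  by (simp add: graph_L2_def edge_L2_add)

lemma graph_L2_diff:
  assumes "f \<in> graph_L2 G" "g \<in> graph_L2 G" shows "(\<lambda>e t. f e t - g e t) \<in> graph_L2 G"
  using graph_L2_add[OF assms(1) graph_L2_scale[OF assms(2), of "-1"]] by simp

lemma graph_L2_zero: "(\<lambda>e t. 0) \<in> graph_L2 G"
  by (simp add: graph_L2_def edge_L2_continuous)

lemma graph_L2_sum:
  assumes "\<And>i. i \<in> I \<Longrightarrow> f i \<in> graph_L2 G" shows "(\<lambda>e t. \<Sum>i\<in>I. f i e t) \<in> graph_L2 G"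
  using assms by (induction I rule: infinite_finite_induct) (auto intro: graph_L2_add graph_L2_zero)

lemma graph_L2_continuous:
  "(\<And>e. e \<in> arcs G \<Longrightarrow> continuous_on {0..len G e} (f e)) \<Longrightarrow> f \<in> graph_L2 G"
  by (simp add: graph_L2_def edge_L2_continuous)

lemma graph_L2_mult_integrable:
  "f \<in> graph_L2 G \<Longrightarrow> g \<in> graph_L2 G \<Longrightarrow> e \<in> arcs G \<Longrightarrow>
    integrable (lebesgue_on {0..len G e}) (\<lambda>t. f e t * g e t)"
  by (simp add: graph_L2_def edge_L2_mult_integrable)

lemma L2_inner_commute: "L2_inner G f g = L2_inner G g f"
  by (simp add: L2_inner_def mult.commute)

lemma L2_inner_scale: "L2_inner G (\<lambda>e t. c * f e t) g = c * L2_inner G f g"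
  by (simp add: L2_inner_def sum_distrib_left mult.assoc)

lemma L2_inner_add:
  assumes "f \<in> graph_L2 G" "g \<in> graph_L2 G" "h \<in> graph_L2 G"
  shows "L2_inner G (\<lambda>e t. f e t + g e t) h = L2_inner G f h + L2_inner G g h"
  using assms unfolding L2_inner_def
  by (simp add: distrib_right graph_L2_mult_integrable flip: sum.distrib)

lemma L2_inner_diff:
  assumes "f \<in> graph_L2 G" "g \<in> graph_L2 G" "h \<in> graph_L2 G"
  shows "L2_inner G (\<lambda>e t. f e t - g e t) h = L2_inner G f h - L2_inner G g h"
  using L2_inner_add[OF assms(1) graph_L2_scale[OF assms(2), of "-1"] assms(3)] L2_inner_scale[of "-1" g h]
  by simp

lemma L2_inner_sum:
  assumes "\<And>i. i \<in> I \<Longrightarrow> f i \<in> graph_L2 G" "h \<in> graph_L2 G"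
  shows "L2_inner G (\<lambda>e t. \<Sum>i\<in>I. f i e t) h = (\<Sum>i\<in>I. L2_inner G (f i) h)"
  using assms
proof (induction I rule: infinite_finite_induct)
  case (insert i I)
  then show ?case using L2_inner_add[of "f i" "\<lambda>e t. \<Sum>i\<in>I. f i e t" h] by (simp add: graph_L2_sum)
qed (auto simp: L2_inner_def)

lemma L2_inner_lincomb:
  assumes "\<And>i. i \<in> I \<Longrightarrow> f i \<in> graph_L2 G" "h \<in> graph_L2 G"
  shows "L2_inner G (\<lambda>e t. \<Sum>i\<in>I. x i * f i e t) h = (\<Sum>i\<in>I. x i * L2_inner G (f i) h)"
  using L2_inner_sum[of I "\<lambda>i e t. x i * f i e t" h] assms by (simp add: graph_L2_scale L2_inner_scale)

lemma L2_inner_nonneg: "0 \<le> L2_inner G f f"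
  unfolding L2_inner_def by (intro sum_nonneg Bochner_Integration.integral_nonneg) auto



lemma L2_norm_power2: "(L2_norm G f)\<^sup>2 = L2_inner G f f" by (simp add: L2_norm_def L2_inner_nonneg)

lemma L2_inner_Cauchy_Schwarz:
  assumes "f \<in> graph_L2 G" "g \<in> graph_L2 G"
  shows "\<bar>L2_inner G f g\<bar> \<le> L2_norm G f * L2_norm G g"
proof -
  let ?A = "L2_inner G f f" and ?B = "L2_inner G f g" and ?C = "L2_inner G g g"
  have quad: "0 \<le> ?A + 2 * x * ?B + x\<^sup>2 * ?C" for x
  proof -
    have m: "(\<lambda>e t. x * g e t) \<in> graph_L2 G" "(\<lambda>e t. f e t + x * g e t) \<in> graph_L2 G"
      using assms by (auto intro!: graph_L2_add graph_L2_scale)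
    have "0 \<le> L2_inner G (\<lambda>e t. f e t + x * g e t) (\<lambda>e t. f e t + x * g e t)" by (rule L2_inner_nonneg)
    also have "\<dots> = L2_inner G f (\<lambda>e t. f e t + x * g e t) + x * L2_inner G g (\<lambda>e t. f e t + x * g e t)"
      using L2_inner_add[OF assms(1) m(1) m(2)] by (simp add: L2_inner_scale)
    also have "\<dots> = L2_inner G (\<lambda>e t. f e t + x * g e t) f + x * L2_inner G (\<lambda>e t. f e t + x * g e t) g"
      by (simp only: L2_inner_commute[of f] L2_inner_commute[of g])
    also have "\<dots> = ?A + 2 * x * ?B + x\<^sup>2 * ?C"
      using L2_inner_add[OF assms(1) m(1) assms(1)] L2_inner_add[OF assms(1) m(1) assms(2)]
      unfolding L2_inner_scale L2_inner_commute[of g f] by (simp add: power2_eq_square algebra_simps)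
    finally show ?thesis .
  qed
  have "?B\<^sup>2 \<le> ?A * ?C"
  proof (cases "?C = 0")
    case True
    have "?B = 0"
    proof (rule ccontr)
      assume "?B \<noteq> 0"
      with quad[of "- (?A + 1) / (2 * ?B)"] True show False by (simp add: field_simps)
    qed
    then show ?thesis using True by simp
  next
    case False
    then have C: "?C > 0" using L2_inner_nonneg[of g] by simp
    (* the quadratic polynomial in x is minimal at - ?B / ?C *)
    have "0 \<le> ?A - ?B\<^sup>2 / ?C"
      using quad[of "- ?B / ?C"] C by (simp add: field_simps power2_eq_square)
    then show ?thesis using C by (simp add: field_simps)
  qed
  then have "sqrt (?B\<^sup>2) \<le> sqrt (?A * ?C)" by (rule real_sqrt_le_mono)
  then show ?thesis by (simp add: L2_norm_def real_sqrt_mult)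
qed

lemma L2_sums_inner:
  assumes "L2_sums G F g" "\<And>i. F i \<in> graph_L2 G" "h \<in> graph_L2 G"
  shows "(\<lambda>i. L2_inner G (F i) h) sums L2_inner G g h"
proof -
  let ?S = "\<lambda>n e t. \<Sum>i<n. F i e t"
  have g: "g \<in> graph_L2 G" and lim: "(\<lambda>n. L2_norm G (\<lambda>e t. g e t - ?S n e t)) \<longlonglongrightarrow> 0"
    using assms(1) by (auto simp: L2_sums_def)
  have S: "?S n \<in> graph_L2 G" for n by (intro graph_L2_sum assms)
  have "(\<lambda>n. L2_inner G g h - L2_inner G (?S n) h) \<longlonglongrightarrow> 0"
  proof (rule Lim_null_comparison)
    show "\<forall>\<^sub>F n in sequentially. norm (L2_inner G g h - L2_inner G (?S n) h)
        \<le> L2_norm G (\<lambda>e t. g e t - ?S n e t) * L2_norm G h"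
      using L2_inner_Cauchy_Schwarz[OF graph_L2_diff[OF g S] assms(3)]
      by (simp add: L2_inner_diff[OF g S assms(3)])
    show "(\<lambda>n. L2_norm G (\<lambda>e t. g e t - ?S n e t) * L2_norm G h) \<longlonglongrightarrow> 0"
      using tendsto_mult_right[OF lim, of "L2_norm G h"] by simp
  qed
  then have "(\<lambda>n. L2_inner G g h - (L2_inner G g h - L2_inner G (?S n) h)) \<longlonglongrightarrow> L2_inner G g h - 0"
    by (intro tendsto_intros)
  then show ?thesis
    using assms by (simp add: sums_def L2_inner_sum)
qed

lemma L2_inner_continuous:
  assumes "\<And>e. e \<in> arcs G \<Longrightarrow> continuous_on {0..len G e} (f e)"
    and "\<And>e. e \<in> arcs G \<Longrightarrow> continuous_on {0..len G e} (g e)"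
  shows "L2_inner G f g = (\<Sum>e\<in>arcs G. integral {0..len G e} (\<lambda>t. f e t * g e t))"
  unfolding L2_inner_def
  by (intro sum.cong refl LINT_continuous_eq_integral continuous_on_mult assms)

lemma edge_integral_le_L2_inner:
  assumes "f \<in> graph_L2 G" "e \<in> arcs G"
  shows "(LINT t|lebesgue_on {0..len G e}. (f e t)\<^sup>2) \<le> L2_inner G f f"
proof -
  have "L2_inner G f f = (\<Sum>e\<in>arcs G. LINT t|lebesgue_on {0..len G e}. (f e t)\<^sup>2)"
    by (simp add: L2_inner_def power2_eq_square)
  then show ?thesis
    using sum_nonneg_leq_bound[of "arcs G" "\<lambda>e. LINT t|lebesgue_on {0..len G e}. (f e t)\<^sup>2"] assms(2)
    by (auto intro!: member_le_sum)
qed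

end


section \<open>One-dimensional Sobolev inequalities\<close>

text \<open>
  The integral of \<open>(f' - m)\<^sup>2\<close> is nonnegative for the mean slope \<open>m\<close>.
\<close>

lemma Cauchy_Schwarz_increment:
  assumes "a \<le> b" "\<And>t. t \<in> {a..b} \<Longrightarrow> (f has_real_derivative f' t) (at t within {a..b})"
    and "continuous_on {a..b} f'"
  shows "(f b - f a)\<^sup>2 \<le> (b - a) * integral {a..b} (\<lambda>t. (f' t)\<^sup>2)"
proof (cases "a = b")
  case False
  with assms(1) have ab: "0 < b - a" by simp
  have "(f' has_integral f b - f a) {a..b}"
    using assms(1,2) by (intro fundamental_theorem_of_calculus)
      (auto simp flip: has_real_derivative_iff_has_vector_derivative)
  then have I: "integral {a..b} f' = f b - f a" by (rule integral_unique)
  define m where "m = (f b - f a) / (b - a)"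
  have c: "continuous_on {a..b} (\<lambda>t. (f' t)\<^sup>2)" "continuous_on {a..b} (\<lambda>t. 2 * m * f' t)"
    "continuous_on {a..b} (\<lambda>t. m\<^sup>2)" "continuous_on {a..b} (\<lambda>t. (f' t)\<^sup>2 - 2 * m * f' t)"
    by (intro continuous_intros assms(3))+
  have "0 \<le> integral {a..b} (\<lambda>t. (f' t - m)\<^sup>2)"
    by (intro integral_nonneg integrable_continuous_interval continuous_intros assms(3)) auto
  also have "\<dots> = integral {a..b} (\<lambda>t. (f' t)\<^sup>2 - 2 * m * f' t + m\<^sup>2)"
    by (simp add: power2_diff algebra_simps)
  also have "\<dots> = integral {a..b} (\<lambda>t. (f' t)\<^sup>2) - 2 * m * (f b - f a) + m\<^sup>2 * (b - a)"
    using c[THEN integrable_continuous_interval] ab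
    by (simp add: Henstock_Kurzweil_Integration.integral_add Henstock_Kurzweil_Integration.integral_diff I)
  also have "\<dots> = integral {a..b} (\<lambda>t. (f' t)\<^sup>2) - (f b - f a)\<^sup>2 / (b - a)"
  proof -
    have "m * (b - a) = f b - f a" using ab by (simp add: m_def)
    then have "m\<^sup>2 * (b - a) = m * (f b - f a)" by (simp add: power2_eq_square)
    then show ?thesis by (simp add: m_def power2_eq_square)
  qed
  finally show ?thesis using ab by (simp add: field_simps)
qed simp

lemma increment_power2_le_energy:
  assumes "\<And>t. t \<in> {0..l} \<Longrightarrow> (f has_real_derivative f' t) (at t within {0..l})"
    and "continuous_on {0..l} f'" "s \<in> {0..l}" "t \<in> {0..l}"
  shows "(f s - f t)\<^sup>2 \<le> \<bar>s - t\<bar> * integral {0..l} (\<lambda>t. (f' t)\<^sup>2)"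
proof -
  have main: "(f b - f a)\<^sup>2 \<le> (b - a) * integral {0..l} (\<lambda>t. (f' t)\<^sup>2)"
    if ab: "a \<le> b" "a \<in> {0..l}" "b \<in> {0..l}" for a b
  proof -
    have sub: "{a..b} \<subseteq> {0..l}" using ab by auto
    have "(f b - f a)\<^sup>2 \<le> (b - a) * integral {a..b} (\<lambda>t. (f' t)\<^sup>2)"
      using assms(1) sub
      by (intro Cauchy_Schwarz_increment ab continuous_on_subset[OF assms(2) sub])
        (meson DERIV_subset subsetD)
    also have "integral {a..b} (\<lambda>t. (f' t)\<^sup>2) \<le> integral {0..l} (\<lambda>t. (f' t)\<^sup>2)"
      by (intro integral_subset_le sub integrable_continuous_interval continuous_intros
          continuous_on_subset[OF assms(2)]) auto
    finally show ?thesis using ab by (simp add: mult_left_mono)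
  qed
  show ?thesis
    using main[of s t] main[of t s] assms(3,4) by (cases "s \<le> t") (auto simp: power2_commute)
qed

text \<open>
  Between any two points \<open>f\<^sup>2\<close> changes by at most the integral of \<open>\<bar>2 f f'\<bar> \<le> q f\<^sup>2 + f'\<^sup>2 / q\<close>;
  averaging over the second point gives the claim. The free parameter \<open>q\<close> is taken to be \<open>sqrt r\<close>
  below, which yields the decay in \<open>r\<close> of the resolvent bounds.
\<close>

lemma sup_power2_le_energy:
  assumes "0 < l" "\<And>t. t \<in> {0..l} \<Longrightarrow> (f has_real_derivative f' t) (at t within {0..l})"
    and "continuous_on {0..l} f'" "s \<in> {0..l}" "0 < q"
  shows "(f s)\<^sup>2 \<le> (1 / l + q) * integral {0..l} (\<lambda>t. (f t)\<^sup>2) + integral {0..l} (\<lambda>t. (f' t)\<^sup>2) / q"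
proof -
  have cf: "continuous_on {0..l} f" using assms(2) DERIV_continuous_on by blast
  define I where "I = q * integral {0..l} (\<lambda>t. (f t)\<^sup>2) + integral {0..l} (\<lambda>t. (f' t)\<^sup>2) / q"
  have I: "I = integral {0..l} (\<lambda>t. q * (f t)\<^sup>2 + (f' t)\<^sup>2 / q)"
    unfolding I_def using assms(3,5) cf
    by (subst Henstock_Kurzweil_Integration.integral_add) (auto intro!: integrable_continuous_interval continuous_intros)
  have amgm: "\<bar>2 * x * y\<bar> \<le> q * x\<^sup>2 + y\<^sup>2 / q" for x y
  proof -
    have "0 \<le> (sqrt q * \<bar>x\<bar> - \<bar>y\<bar> / sqrt q)\<^sup>2" by simp
    also have "\<dots> = q * x\<^sup>2 + y\<^sup>2 / q - \<bar>2 * x * y\<bar>"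
      using assms(5) by (simp add: power2_diff power_mult_distrib power_divide abs_mult)
    finally show ?thesis by simp
  qed
  have incr: "\<bar>(f b)\<^sup>2 - (f a)\<^sup>2\<bar> \<le> I" if ab: "a \<le> b" "a \<in> {0..l}" "b \<in> {0..l}" for a b
  proof -
    have sub: "{a..b} \<subseteq> {0..l}" using ab by auto
    have "((\<lambda>t. (f t)\<^sup>2) has_vector_derivative 2 * f t * f' t) (at t within {a..b})" if "t \<in> {a..b}" for t
    proof -
      have "(f has_real_derivative f' t) (at t within {a..b})"
        using assms(2)[of t] that sub by (meson DERIV_subset subsetD)
      then have "((\<lambda>t. (f t)\<^sup>2) has_real_derivative 2 * f t * f' t) (at t within {a..b})"
        by (auto intro!: derivative_eq_intros)
      then show ?thesis by (simp add: has_real_derivative_iff_has_vector_derivative)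
    qed
    from fundamental_theorem_of_calculus[OF ab(1) this]
    have "(f b)\<^sup>2 - (f a)\<^sup>2 = integral {a..b} (\<lambda>t. 2 * f t * f' t)" by (simp add: integral_unique)
    also have "\<bar>\<dots>\<bar> \<le> integral {a..b} (\<lambda>t. q * (f t)\<^sup>2 + (f' t)\<^sup>2 / q)"
      unfolding real_norm_def[symmetric]
      by (rule integral_norm_bound_integral; (intro integrable_continuous_interval continuous_intros
          continuous_on_subset[OF cf sub] continuous_on_subset[OF assms(3) sub])?)
        (use amgm assms(5) in auto)
    also have "\<dots> \<le> I" unfolding I
      by (intro integral_subset_le sub integrable_continuous_interval continuous_intros
          continuous_on_subset[OF cf] continuous_on_subset[OF assms(3)]) (use assms(5) in auto)
    finally show ?thesis .
  qed
  have le: "(f s)\<^sup>2 - I \<le> (f t)\<^sup>2" if "t \<in> {0..l}" for t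
    using incr[of s t] incr[of t s] that assms(4) by (cases "s \<le> t") auto
  have "integral {0..l} (\<lambda>t. (f s)\<^sup>2 - I) \<le> integral {0..l} (\<lambda>t. (f t)\<^sup>2)"
    using le by (intro integral_le integrable_continuous_interval continuous_intros cf)
  then have "l * ((f s)\<^sup>2 - I) \<le> integral {0..l} (\<lambda>t. (f t)\<^sup>2)" using assms(1) by simp
  then have "(f s)\<^sup>2 - I \<le> integral {0..l} (\<lambda>t. (f t)\<^sup>2) / l"
    using assms(1) by (simp add: field_simps)
  then show ?thesis by (simp add: I_def distrib_right)
qed


section \<open>Eigenfunctions are classical and satisfy Green's identity\<close>

locale graph_eigenbasis = metric_graph_space G
  for G :: "('v, 'e) metric_graph" +
  fixes \<kappa> :: real and \<phi> :: "nat \<Rightarrow> 'e \<Rightarrow> real \<Rightarrow> real" and \<mu> :: "nat \<Rightarrow> real"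
  assumes kappa_pos: "0 < \<kappa>" and basis: "orthonormal_eigenbasis G \<kappa> \<phi> \<mu>"
begin

lemma mu_ge: "\<mu> 0 \<le> \<mu> i" and mu0_pos: "0 < \<mu> 0"
  using basis by (auto simp: orthonormal_eigenbasis_def incseq_def)

lemma mu_pos: "0 < \<mu> i" using mu_ge[of i] mu0_pos by simp

lemma phi_domain: "\<phi> i \<in> kirchhoff_domain G"
  using basis by (simp add: orthonormal_eigenbasis_def)

lemma phi_graph_continuous: "graph_continuous G (\<phi> i)"
  using phi_domain by (simp add: kirchhoff_domain_def)

lemma phi_continuous: "e \<in> arcs G \<Longrightarrow> continuous_on {0..len G e} (\<phi> i e)"
  using phi_graph_continuous by (simp add: graph_continuous_def)

lemma phi_L2: "\<phi> i \<in> graph_L2 G"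
  by (intro graph_L2_continuous phi_continuous)

lemma phi_orthonormal: "L2_inner G (\<phi> i) (\<phi> j) = (if i = j then 1 else 0)"
  using basis by (simp add: orthonormal_eigenbasis_def)

lemma phi_lincomb_inner:
  "L2_inner G (\<lambda>e t. \<Sum>i<n. x i * \<phi> i e t) (\<lambda>e t. \<Sum>i<n. x i * \<phi> i e t) = (\<Sum>i<n. (x i)\<^sup>2)"
proof -
  have m: "(\<lambda>e t. \<Sum>i<n. x i * \<phi> i e t) \<in> graph_L2 G"
    by (intro graph_L2_sum graph_L2_scale phi_L2)
  have "L2_inner G (\<phi> i) (\<lambda>e t. \<Sum>j<n. x j * \<phi> j e t) = x i" if "i < n" for i
    using that by (subst L2_inner_commute)
      (simp add: L2_inner_lincomb phi_L2 phi_orthonormal if_distrib[of "\<lambda>y. _ * y"] cong: if_cong)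
  then show ?thesis
    by (simp add: L2_inner_lincomb[OF phi_L2 m] power2_eq_square)
qed

lemma Bessel_inequality:
  assumes "f \<in> graph_L2 G" shows "(\<Sum>i<n. (L2_inner G f (\<phi> i))\<^sup>2) \<le> L2_inner G f f"
proof -
  let ?p = "\<lambda>e t. \<Sum>i<n. L2_inner G f (\<phi> i) * \<phi> i e t"
  let ?s = "\<Sum>i<n. (L2_inner G f (\<phi> i))\<^sup>2"
  have p: "?p \<in> graph_L2 G" by (intro graph_L2_sum graph_L2_scale phi_L2)
  have pf: "L2_inner G ?p f = ?s"
    by (simp add: L2_inner_lincomb[OF phi_L2 assms] L2_inner_commute[of "\<phi> _" f] power2_eq_square)
  have "?s \<le> L2_norm G ?p * L2_norm G f"
    using L2_inner_Cauchy_Schwarz[OF p assms] pf by simp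
  then have "?s\<^sup>2 \<le> (L2_norm G ?p * L2_norm G f)\<^sup>2"
    by (intro power_mono sum_nonneg) auto
  then have "?s\<^sup>2 \<le> ?s * L2_inner G f f"
    by (simp add: power_mult_distrib L2_norm_power2 phi_lincomb_inner)
  moreover have "0 \<le> ?s" by (intro sum_nonneg) auto
  ultimately show ?thesis
    using L2_inner_nonneg[of f] by (cases "?s = 0") (auto simp: power2_eq_square)
qed

lemma Parseval:
  assumes "f \<in> graph_L2 G" "h \<in> graph_L2 G"
  shows "(\<lambda>i. L2_inner G f (\<phi> i) * L2_inner G h (\<phi> i)) sums L2_inner G f h"
proof -
  have "L2_sums G (\<lambda>i e t. L2_inner G f (\<phi> i) * \<phi> i e t) f"
    using basis assms(1) by (simp add: orthonormal_eigenbasis_def)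
  from L2_sums_inner[OF this graph_L2_scale[OF phi_L2] assms(2)] show ?thesis
    by (simp add: L2_inner_scale L2_inner_commute[of "\<phi> _" h])
qed

lemma phi_weak_deriv:
  assumes e: "e \<in> arcs G"
  shows "weak_deriv (len G e) 2 (\<phi> i e) (\<lambda>t. (\<kappa>\<^sup>2 - \<mu> i) * \<phi> i e t)"
proof -
  let ?M = "lebesgue_on {0..len G e}"
  define g where "g = edgewise_deriv G 2 (\<phi> i) e"
  have "\<exists>g. g \<in> edge_L2 (len G e) \<and> weak_deriv (len G e) 2 (\<phi> i e) g"
  proof -
    have "\<phi> i e \<in> edge_sobolev 2 (len G e)"
      using phi_domain[of i] e by (auto simp: kirchhoff_domain_def graph_sobolev_def)
    then show ?thesis unfolding edge_sobolev_def by blast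
  qed
  from someI_ex[OF this] have g: "g \<in> edge_L2 (len G e)" "weak_deriv (len G e) 2 (\<phi> i e) g"
    by (simp_all add: g_def edgewise_deriv_def)
  have AE: "AE t in ?M. g t = (\<kappa>\<^sup>2 - \<mu> i) * \<phi> i e t"
  proof -
    have "AE t in ?M. \<kappa>\<^sup>2 * \<phi> i e t - g t = \<mu> i * \<phi> i e t"
      using basis e by (auto simp: orthonormal_eigenbasis_def L2_eq_def kirchhoff_op_def g_def)
    then show ?thesis by eventually_elim (simp add: algebra_simps)
  qed
  have "(LINT t|?M. g t * \<eta> t) = (LINT t|?M. (\<kappa>\<^sup>2 - \<mu> i) * \<phi> i e t * \<eta> t)"
    if \<eta>: "test_function (len G e) \<eta>" for \<eta>
  proof -
    have "continuous_on {0..len G e} (\<lambda>t. (\<kappa>\<^sup>2 - \<mu> i) * \<phi> i e t * \<eta> t)"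
      by (intro continuous_intros phi_continuous e test_function_continuous[OF \<eta>])
    from edge_L2_measurable[OF edge_L2_continuous[OF this]] show ?thesis
      using AE borel_measurable_times[OF edge_L2_measurable[OF g(1)]
          edge_L2_measurable[OF edge_L2_continuous[OF test_function_continuous[OF \<eta>]]]]
      by (intro integral_cong_AE) auto
  qed
  then show ?thesis using g(2) by (simp add: weak_deriv_def)
qed

text \<open>
  The classical derivative of an eigenfunction, including its one-sided values at the vertices.
\<close>

definition dphi :: "nat \<Rightarrow> 'e \<Rightarrow> real \<Rightarrow> real" where
  "dphi i e = (SOME f'. \<forall>t\<in>{0..len G e}. (\<phi> i e has_real_derivative f' t) (at t within {0..len G e}) \<and>
     (f' has_real_derivative (\<kappa>\<^sup>2 - \<mu> i) * \<phi> i e t) (at t within {0..len G e}))"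

lemma
  assumes e: "e \<in> arcs G" and t: "t \<in> {0..len G e}"
  shows phi_has_derivative: "(\<phi> i e has_real_derivative dphi i e t) (at t within {0..len G e})"
    and dphi_has_derivative:
      "(dphi i e has_real_derivative (\<kappa>\<^sup>2 - \<mu> i) * \<phi> i e t) (at t within {0..len G e})"
proof -
  have "continuous_on {0..len G e} (\<lambda>t. (\<kappa>\<^sup>2 - \<mu> i) * \<phi> i e t)"
    by (intro continuous_intros phi_continuous e)
  from weak_second_derivative_classical[OF len_pos[OF e] phi_continuous[OF e] this phi_weak_deriv[OF e]]
  obtain f' where "\<forall>t\<in>{0..len G e}. (\<phi> i e has_real_derivative f' t) (at t within {0..len G e}) \<and>
     (f' has_real_derivative (\<kappa>\<^sup>2 - \<mu> i) * \<phi> i e t) (at t within {0..len G e})" by metis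
  then have "\<exists>f'. \<forall>t\<in>{0..len G e}. (\<phi> i e has_real_derivative f' t) (at t within {0..len G e}) \<and>
     (f' has_real_derivative (\<kappa>\<^sup>2 - \<mu> i) * \<phi> i e t) (at t within {0..len G e})" by blast
  from someI_ex[OF this]
  have "\<forall>t\<in>{0..len G e}. (\<phi> i e has_real_derivative dphi i e t) (at t within {0..len G e}) \<and>
     (dphi i e has_real_derivative (\<kappa>\<^sup>2 - \<mu> i) * \<phi> i e t) (at t within {0..len G e})"
    by (simp only: dphi_def[symmetric])
  then show "(\<phi> i e has_real_derivative dphi i e t) (at t within {0..len G e})"
    "(dphi i e has_real_derivative (\<kappa>\<^sup>2 - \<mu> i) * \<phi> i e t) (at t within {0..len G e})"
    using t by auto
qed

lemma dphi_continuous: "e \<in> arcs G \<Longrightarrow> continuous_on {0..len G e} (dphi i e)"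
  by (rule DERIV_continuous_on[OF dphi_has_derivative])

lemma dphi_L2: "dphi i \<in> graph_L2 G"
  by (intro graph_L2_continuous dphi_continuous)

lemma dphi_vertex_sum:
  assumes "v \<in> verts G"
  shows "(\<Sum>e | e \<in> arcs G \<and> tail G e = v. dphi i e 0) - (\<Sum>e | e \<in> arcs G \<and> head G e = v. dphi i e (len G e)) = 0"
proof -
  have vd: "vector_derivative (\<phi> i e) (at t within {0..len G e}) = dphi i e t"
    if "e \<in> arcs G" "t \<in> {0..len G e}" for e t
    using vector_derivative_within_closed_interval[OF len_pos[OF that(1)] that(2)
        phi_has_derivative[OF that, unfolded has_real_derivative_iff_has_vector_derivative]] .
  have "outward_deriv_sum G (\<phi> i) v = 0"
    using phi_domain assms by (simp add: kirchhoff_domain_def)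
  also have "outward_deriv_sum G (\<phi> i) v = (\<Sum>e | e \<in> arcs G \<and> tail G e = v. dphi i e 0) +
      (\<Sum>e | e \<in> arcs G \<and> head G e = v. - dphi i e (len G e))"
    unfolding outward_deriv_sum_def
    by (intro arg_cong2[where f = "(+)"] sum.cong refl) (auto simp: vd less_imp_le[OF len_pos])
  finally show ?thesis by (simp add: sum_negf)
qed

text \<open>
  Grouping the endpoints of the edges by vertex, continuity takes the value of \<open>\<phi> i\<close> out of the
  sum and the Kirchhoff condition makes what remains vanish.
\<close>

lemma boundary_terms_cancel:
  "(\<Sum>e\<in>arcs G. \<phi> i e (len G e) * dphi k e (len G e) - \<phi> i e 0 * dphi k e 0) = 0"
proof -
  define V where "V v = (SOME y. \<exists>e t. represents_vertex G v (e, t) \<and> y = \<phi> i e t)" for v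
  have V: "V v = \<phi> i e t" if rep: "represents_vertex G v (e, t)" for v e t
  proof -
    have "\<exists>y e t. represents_vertex G v (e, t) \<and> y = \<phi> i e t" using rep by blast
    from someI_ex[OF this] obtain e' t' where "represents_vertex G v (e', t')" "V v = \<phi> i e' t'"
      unfolding V_def by blast
    moreover have "\<phi> i e' t' = \<phi> i e t"
      using phi_graph_continuous[of i, unfolded graph_continuous_def, THEN conjunct2, rule_format,
          OF calculation(1) rep] .
    ultimately show ?thesis by simp
  qed
  have V0: "\<phi> i e 0 = V (tail G e)" and V1: "\<phi> i e (len G e) = V (head G e)" if "e \<in> arcs G" for e
    using that by (auto intro!: V[symmetric] simp: represents_vertex_def)
  have "(\<Sum>e\<in>arcs G. \<phi> i e (len G e) * dphi k e (len G e) - \<phi> i e 0 * dphi k e 0) =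
      (\<Sum>e\<in>arcs G. V (head G e) * dphi k e (len G e)) - (\<Sum>e\<in>arcs G. V (tail G e) * dphi k e 0)"
    by (simp add: V0 V1 sum_subtractf)
  also have "(\<Sum>e\<in>arcs G. V (head G e) * dphi k e (len G e)) =
      (\<Sum>v\<in>verts G. \<Sum>e | e \<in> arcs G \<and> head G e = v. V (head G e) * dphi k e (len G e))"
    by (rule sum.group[symmetric]) (auto simp: tail_head_verts)
  also have "\<dots> = (\<Sum>v\<in>verts G. V v * (\<Sum>e | e \<in> arcs G \<and> head G e = v. dphi k e (len G e)))"
    by (simp add: sum_distrib_left)
  also have "(\<Sum>e\<in>arcs G. V (tail G e) * dphi k e 0) =
      (\<Sum>v\<in>verts G. \<Sum>e | e \<in> arcs G \<and> tail G e = v. V (tail G e) * dphi k e 0)"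
    by (rule sum.group[symmetric]) (auto simp: tail_head_verts)
  also have "\<dots> = (\<Sum>v\<in>verts G. V v * (\<Sum>e | e \<in> arcs G \<and> tail G e = v. dphi k e 0))"
    by (simp add: sum_distrib_left)
  also have "(\<Sum>v\<in>verts G. V v * (\<Sum>e | e \<in> arcs G \<and> head G e = v. dphi k e (len G e))) -
      (\<Sum>v\<in>verts G. V v * (\<Sum>e | e \<in> arcs G \<and> tail G e = v. dphi k e 0)) =
      - (\<Sum>v\<in>verts G. V v * ((\<Sum>e | e \<in> arcs G \<and> tail G e = v. dphi k e 0) -
          (\<Sum>e | e \<in> arcs G \<and> head G e = v. dphi k e (len G e))))"
    by (simp add: right_diff_distrib sum_subtractf)
  also have "\<dots> = 0" using dphi_vertex_sum by simp
  finally show ?thesis .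
qed

text \<open>
  Integration by parts on each edge, with \<open>\<phi> k'' = (\<kappa>\<^sup>2 - \<mu> k) \<phi> k\<close>; the boundary terms of all edges
  together cancel.
\<close>

lemma Green_identity: "L2_inner G (dphi i) (dphi k) = (\<mu> k - \<kappa>\<^sup>2) * L2_inner G (\<phi> i) (\<phi> k)"
proof -
  have edge: "integral {0..len G e} (\<lambda>t. dphi i e t * dphi k e t) =
      (\<phi> i e (len G e) * dphi k e (len G e) - \<phi> i e 0 * dphi k e 0)
      + (\<mu> k - \<kappa>\<^sup>2) * integral {0..len G e} (\<lambda>t. \<phi> i e t * \<phi> k e t)" if e: "e \<in> arcs G" for e
  proof -
    note c = phi_continuous[OF e] dphi_continuous[OF e]
    have "((\<lambda>t. \<phi> i e t * dphi k e t) has_vector_derivative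
        dphi i e t * dphi k e t + (\<kappa>\<^sup>2 - \<mu> k) * (\<phi> i e t * \<phi> k e t)) (at t within {0..len G e})"
      if "t \<in> {0..len G e}" for t
      unfolding has_real_derivative_iff_has_vector_derivative[symmetric]
      using DERIV_mult[OF phi_has_derivative[OF e that, of i] dphi_has_derivative[OF e that, of k]]
      by (rule DERIV_cong) (simp add: algebra_simps)
    from fundamental_theorem_of_calculus[OF _ this]
    have "integral {0..len G e} (\<lambda>t. dphi i e t * dphi k e t + (\<kappa>\<^sup>2 - \<mu> k) * (\<phi> i e t * \<phi> k e t))
        = \<phi> i e (len G e) * dphi k e (len G e) - \<phi> i e 0 * dphi k e 0"
      using len_pos[OF e] by (simp add: integral_unique)
    moreover have "integral {0..len G e} (\<lambda>t. dphi i e t * dphi k e t + (\<kappa>\<^sup>2 - \<mu> k) * (\<phi> i e t * \<phi> k e t))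
        = integral {0..len G e} (\<lambda>t. dphi i e t * dphi k e t) +
          integral {0..len G e} (\<lambda>t. (\<kappa>\<^sup>2 - \<mu> k) * (\<phi> i e t * \<phi> k e t))"
      by (intro Henstock_Kurzweil_Integration.integral_add integrable_continuous_interval continuous_intros c)
    ultimately have "integral {0..len G e} (\<lambda>t. dphi i e t * dphi k e t) =
        (\<phi> i e (len G e) * dphi k e (len G e) - \<phi> i e 0 * dphi k e 0)
        - (\<kappa>\<^sup>2 - \<mu> k) * integral {0..len G e} (\<lambda>t. \<phi> i e t * \<phi> k e t)" by simp
    then show ?thesis by (simp add: left_diff_distrib)
  qed
  show ?thesis
    using boundary_terms_cancel[of i k]
    by (simp add: L2_inner_continuous dphi_continuous phi_continuous edge sum.distrib sum_distrib_left)
qed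

text \<open>
  The eigenfunctions are orthogonal for the Dirichlet form as well. Adding \<open>\<kappa>\<^sup>2 + r\<close> times the squared
  norm, the energy of a linear combination is \<open>\<Sum>i. (\<mu> i + r) (x i)\<^sup>2\<close>.
\<close>

lemma energy_identity:
  "L2_inner G (\<lambda>e t. \<Sum>i<n. x i * dphi i e t) (\<lambda>e t. \<Sum>i<n. x i * dphi i e t) =
    (\<Sum>i<n. (\<mu> i - \<kappa>\<^sup>2) * (x i)\<^sup>2)"
proof -
  have m: "(\<lambda>e t. \<Sum>i<n. x i * dphi i e t) \<in> graph_L2 G"
    by (intro graph_L2_sum graph_L2_scale dphi_L2)
  have "L2_inner G (dphi i) (\<lambda>e t. \<Sum>j<n. x j * dphi j e t) = (\<mu> i - \<kappa>\<^sup>2) * x i" if "i < n" for i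
    using that by (subst L2_inner_commute)
      (simp add: L2_inner_lincomb dphi_L2 Green_identity phi_orthonormal if_distrib[of "\<lambda>y. _ * y"] cong: if_cong)
  then show ?thesis
    by (subst L2_inner_lincomb[OF dphi_L2 m]) (auto intro!: sum.cong simp: power2_eq_square)
qed

end


section \<open>Resolvent bounds for linear functionals\<close>

text \<open>
  The function whose inner product with \<open>f\<close> is the mean of \<open>f\<close> over the cell. Half-open cells
  make the average over a cell exactly the mean of the averages over its two halves.
\<close>

definition cell_average :: "'e \<Rightarrow> real \<Rightarrow> real \<Rightarrow> 'e \<Rightarrow> real \<Rightarrow> real" where
  "cell_average e a b e' t = (if e' = e \<and> t \<in> {a..<b} then 1 / (b - a) else 0)"

definition same_point :: "('v, 'e) metric_graph \<Rightarrow> 'e \<times> real \<Rightarrow> 'e \<times> real \<Rightarrow> bool" where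
  "same_point G p q \<longleftrightarrow> p = q \<or> (\<exists>v. represents_vertex G v p \<and> represents_vertex G v q)"

lemma graph_continuous_same_point:
  "graph_continuous G f \<Longrightarrow> same_point G (e, s) (e', t) \<Longrightarrow> f e s = f e' t"
  unfolding same_point_def graph_continuous_def by blast

context metric_graph_space
begin

definition is_cell :: "'e \<Rightarrow> real \<Rightarrow> real \<Rightarrow> bool" where
  "is_cell e a b \<longleftrightarrow> e \<in> arcs G \<and> 0 \<le> a \<and> a < b \<and> b \<le> len G e"

definition inv_len :: real where "inv_len = (\<Sum>e\<in>arcs G. 1 / len G e)"

lemma inv_len_ge: "e \<in> arcs G \<Longrightarrow> 1 / len G e \<le> inv_len"
  unfolding inv_len_def using len_pos
  by (intro member_le_sum[of e "arcs G" "\<lambda>e. 1 / len G e"]) (auto simp: less_imp_le)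

lemma inv_len_nonneg: "0 \<le> inv_len"
  unfolding inv_len_def using len_pos by (intro sum_nonneg) (simp add: less_imp_le)

lemma cell_average_L2:
  assumes "is_cell e a b" shows "cell_average e a b \<in> graph_L2 G"
proof -
  have "(\<lambda>t. indicator {a..<b} t * (1 / (b - a))) \<in> edge_L2 l" for l
    by (intro edge_L2_indicator edge_L2_continuous continuous_intros) auto
  moreover have "cell_average e a b e = (\<lambda>t. indicator {a..<b} t * (1 / (b - a)))"
    by (auto simp: cell_average_def)
  moreover have "cell_average e a b e' = (\<lambda>t. 0)" if "e' \<noteq> e" for e'
    using that by (auto simp: cell_average_def)
  ultimately show ?thesis
    using edge_L2_continuous[of _ "\<lambda>t. 0"] by (auto simp: graph_L2_def) (metis continuous_on_const)
qed

lemma cell_average_inner: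
  assumes "is_cell e a b" "continuous_on {0..len G e} (f e)"
  shows "L2_inner G (cell_average e a b) f = integral {a..b} (f e) / (b - a)"
proof -
  have e: "e \<in> arcs G" and ab: "0 \<le> a" "a < b" "b \<le> len G e" using assms(1) by (auto simp: is_cell_def)
  have "L2_inner G (cell_average e a b) f =
      (\<Sum>e'\<in>arcs G. if e' = e then LINT t|lebesgue_on {0..len G e}. indicator {a..b} t *\<^sub>R (f e t / (b - a)) else 0)"
  proof -
    have "(LINT t|lebesgue_on {0..len G e}. cell_average e a b e t * f e t) =
        (LINT t|lebesgue_on {0..len G e}. indicator {a..b} t *\<^sub>R (f e t / (b - a)))"
    proof (rule integral_cong_AE)
      show "AE t in lebesgue_on {0..len G e}.
          cell_average e a b e t * f e t = indicator {a..b} t *\<^sub>R (f e t / (b - a))"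
        using AE_lebesgue_on_neq[where l = "len G e" and a = b]
        by eventually_elim (auto simp: cell_average_def indicator_def)
      have "cell_average e a b e \<in> edge_L2 (len G e)"
        using cell_average_L2[OF assms(1)] e by (simp add: graph_L2_def)
      from borel_measurable_times[OF edge_L2_measurable[OF this] edge_L2_measurable[OF edge_L2_continuous[OF assms(2)]]]
      show "(\<lambda>t. cell_average e a b e t * f e t) \<in> borel_measurable (lebesgue_on {0..len G e})" .
      have "(\<lambda>t. indicator {a..b} t * (f e t / (b - a))) \<in> edge_L2 (len G e)"
        using ab by (intro edge_L2_indicator edge_L2_continuous continuous_intros assms(2)) auto
      from edge_L2_measurable[OF this]
      show "(\<lambda>t. indicator {a..b} t *\<^sub>R (f e t / (b - a))) \<in> borel_measurable (lebesgue_on {0..len G e})"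
        by simp
    qed
    moreover have "cell_average e a b e' t = 0" if "e' \<noteq> e" for e' t
      using that by (simp add: cell_average_def)
    ultimately show ?thesis
      unfolding L2_inner_def by (intro sum.cong refl) auto
  qed
  also have "\<dots> = (LINT t|lebesgue_on {0..len G e}. indicator {a..b} t *\<^sub>R (f e t / (b - a)))"
    using e by simp
  also have "\<dots> = (LINT t|lebesgue_on {a..b}. f e t / (b - a))"
  proof -
    have "{a..b} \<inter> space (lebesgue_on {0..len G e}) \<in> sets (lebesgue_on {0..len G e})"
      by (auto simp: sets_restrict_space)
    moreover have "restrict_space (lebesgue_on {0..len G e}) {a..b} = lebesgue_on {a..b}"
      using ab by (simp add: restrict_restrict_space Int_absorb1)
    ultimately show ?thesis using integral_restrict_space[of "{a..b}" "lebesgue_on {0..len G e}"] by metis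
  qed
  also have "\<dots> = integral {a..b} (\<lambda>t. f e t / (b - a))"
    using ab by (intro lebesgue_integral_eq_integral continuous_imp_integrable_real continuous_intros
        continuous_on_subset[OF assms(2)]) auto
  finally show ?thesis by simp
qed

lemma cell_average_inner_near:
  assumes "is_cell e a b" "continuous_on {0..len G e} (f e)" "\<And>t. t \<in> {a..b} \<Longrightarrow> \<bar>f e t - c\<bar> \<le> R"
  shows "\<bar>L2_inner G (cell_average e a b) f - c\<bar> \<le> R"
proof -
  have ab: "0 \<le> a" "a < b" "b \<le> len G e" using assms(1) by (auto simp: is_cell_def)
  have sub: "{a..b} \<subseteq> {0..len G e}" using ab by auto
  have int: "f e integrable_on {a..b}"
    by (intro integrable_continuous_interval continuous_on_subset[OF assms(2) sub])
  have bnd: "c - R \<le> f e t" "f e t \<le> c + R" if "t \<in> {a..b}" for t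
    using assms(3)[OF that] by linarith+
  have "integral {a..b} (\<lambda>_. c - R) \<le> integral {a..b} (f e)"
    by (rule integral_le) (use int bnd in auto)
  moreover have "integral {a..b} (f e) \<le> integral {a..b} (\<lambda>_. c + R)"
    by (rule integral_le) (use int bnd in auto)
  ultimately have "(b - a) * (c - R) \<le> integral {a..b} (f e)" "integral {a..b} (f e) \<le> (b - a) * (c + R)"
    using ab by simp_all
  then have "c - R \<le> integral {a..b} (f e) / (b - a)" "integral {a..b} (f e) / (b - a) \<le> c + R"
    using ab by (simp_all add: field_simps)
  then show ?thesis
    using cell_average_inner[where e = e and a = a and b = b and f = f, OF assms(1,2)] by linarith
qed

end

context graph_eigenbasis
begin

lemma lincomb_has_derivative:
  assumes "e \<in> arcs G" "t \<in> {0..len G e}"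
  shows "((\<lambda>t. \<Sum>i<n. x i * \<phi> i e t) has_real_derivative (\<Sum>i<n. x i * dphi i e t)) (at t within {0..len G e})"
  by (intro DERIV_sum DERIV_cmult phi_has_derivative assms)

lemma lincomb_continuous:
  assumes "e \<in> arcs G"
  shows "continuous_on {0..len G e} (\<lambda>t. \<Sum>i<n. x i * \<phi> i e t)"
    and "continuous_on {0..len G e} (\<lambda>t. \<Sum>i<n. x i * dphi i e t)"
  by (intro continuous_intros phi_continuous dphi_continuous assms)+

lemma lincomb_graph_continuous: "graph_continuous G (\<lambda>e t. \<Sum>i<n. x i * \<phi> i e t)"
proof -
  have "\<phi> i e s = \<phi> i e' t" if "represents_vertex G v (e, s)" "represents_vertex G v (e', t)" for i v e s e' t
    using phi_graph_continuous that unfolding graph_continuous_def by blast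
  then have "(\<Sum>i<n. x i * \<phi> i e s) = (\<Sum>i<n. x i * \<phi> i e' t)"
    if "represents_vertex G v (e, s)" "represents_vertex G v (e', t)" for v e s e' t
    using that by (intro sum.cong refl) metis
  then show ?thesis using lincomb_continuous unfolding graph_continuous_def by blast
qed

lemma edge_energy_le:
  assumes e: "e \<in> arcs G"
  shows "integral {0..len G e} (\<lambda>t. (\<Sum>i<n. x i * \<phi> i e t)\<^sup>2) \<le> (\<Sum>i<n. (x i)\<^sup>2)"
    and "integral {0..len G e} (\<lambda>t. (\<Sum>i<n. x i * dphi i e t)\<^sup>2) \<le> (\<Sum>i<n. (\<mu> i - \<kappa>\<^sup>2) * (x i)\<^sup>2)"
proof -
  have "integral {0..len G e} (\<lambda>t. (\<Sum>i<n. x i * \<phi> i e t)\<^sup>2) =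
      (LINT t|lebesgue_on {0..len G e}. (\<Sum>i<n. x i * \<phi> i e t)\<^sup>2)"
    by (intro LINT_continuous_eq_integral[symmetric] continuous_intros phi_continuous e)
  also have "\<dots> \<le> L2_inner G (\<lambda>e t. \<Sum>i<n. x i * \<phi> i e t) (\<lambda>e t. \<Sum>i<n. x i * \<phi> i e t)"
    by (rule edge_integral_le_L2_inner[OF _ e]) (intro graph_L2_continuous lincomb_continuous)
  finally show "integral {0..len G e} (\<lambda>t. (\<Sum>i<n. x i * \<phi> i e t)\<^sup>2) \<le> (\<Sum>i<n. (x i)\<^sup>2)"
    by (simp only: phi_lincomb_inner)
  have "integral {0..len G e} (\<lambda>t. (\<Sum>i<n. x i * dphi i e t)\<^sup>2) =
      (LINT t|lebesgue_on {0..len G e}. (\<Sum>i<n. x i * dphi i e t)\<^sup>2)"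
    by (intro LINT_continuous_eq_integral[symmetric] continuous_intros dphi_continuous e)
  also have "\<dots> \<le> L2_inner G (\<lambda>e t. \<Sum>i<n. x i * dphi i e t) (\<lambda>e t. \<Sum>i<n. x i * dphi i e t)"
    by (rule edge_integral_le_L2_inner[OF _ e]) (intro graph_L2_continuous lincomb_continuous)
  finally show "integral {0..len G e} (\<lambda>t. (\<Sum>i<n. x i * dphi i e t)\<^sup>2) \<le> (\<Sum>i<n. (\<mu> i - \<kappa>\<^sup>2) * (x i)\<^sup>2)"
    by (simp only: energy_identity)
qed

text \<open>
  With \<open>q = sqrt r\<close> the term \<open>1 / l\<close> of the Sobolev inequality is absorbed using \<open>r \<ge> \<mu> 0\<close>.
\<close>

definition sup_const :: real where "sup_const = 1 + inv_len / sqrt (\<mu> 0)"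

lemma sup_const_pos: "0 < sup_const"
proof -
  have "0 \<le> inv_len / sqrt (\<mu> 0)" using inv_len_nonneg mu0_pos by simp
  then show ?thesis unfolding sup_const_def by linarith
qed

text \<open>
  By the Sobolev inequality with \<open>q = sqrt r\<close>, point evaluation has squared norm of order
  \<open>r powr - (1 / 2)\<close> for the energy with parameter \<open>r\<close>.
\<close>

lemma lincomb_sup_bound:
  assumes e: "e \<in> arcs G" "t \<in> {0..len G e}" and r: "\<mu> 0 \<le> r"
  shows "(\<Sum>i<n. x i * \<phi> i e t)\<^sup>2 \<le> sup_const / sqrt r * (\<Sum>i<n. (\<mu> i + r) * (x i)\<^sup>2)"
proof -
  define F where "F = (\<Sum>i<n. (x i)\<^sup>2)"
  define D where "D = (\<Sum>i<n. (\<mu> i - \<kappa>\<^sup>2) * (x i)\<^sup>2)"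
  have r0: "0 < r" using r mu0_pos by simp
  have F0: "0 \<le> F" unfolding F_def by (intro sum_nonneg) auto
  have D0: "0 \<le> D" unfolding D_def energy_identity[symmetric] by (rule L2_inner_nonneg)
  let ?l = "len G e"
  have "(\<Sum>i<n. x i * \<phi> i e t)\<^sup>2 \<le> (1 / ?l + sqrt r) * integral {0..?l} (\<lambda>t. (\<Sum>i<n. x i * \<phi> i e t)\<^sup>2)
      + integral {0..?l} (\<lambda>t. (\<Sum>i<n. x i * dphi i e t)\<^sup>2) / sqrt r"
    using sup_power2_le_energy[OF len_pos[OF e(1)] lincomb_has_derivative[OF e(1)] lincomb_continuous(2)[OF e(1)]
        e(2), where q = "sqrt r" and n1 = n and x1 = x] r0 by simp
  also have "\<dots> \<le> (1 / ?l + sqrt r) * F + D / sqrt r"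
    unfolding F_def D_def using r0 len_pos[OF e(1)] edge_energy_le[OF e(1)]
    by (intro add_mono mult_left_mono divide_right_mono) auto
  also have "\<dots> \<le> (inv_len + sqrt r) * F + D / sqrt r"
    using inv_len_ge[OF e(1)] F0 by (simp add: mult_right_mono)
  also have "\<dots> = ((inv_len * sqrt r + r) * F + D) / sqrt r"
    using r0 by (simp add: field_simps)
  also have "\<dots> \<le> (sup_const * r * F + sup_const * D) / sqrt r"
  proof (intro divide_right_mono add_mono mult_right_mono)
    have "sqrt r * 1 \<le> sqrt r * (sqrt r / sqrt (\<mu> 0))"
      using r r0 mu0_pos by (intro mult_left_mono) auto
    then have "sqrt r \<le> r / sqrt (\<mu> 0)" using r0 by simp
    then have "inv_len * sqrt r \<le> inv_len * (r / sqrt (\<mu> 0))"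
      using inv_len_nonneg by (rule mult_left_mono)
    then show "inv_len * sqrt r + r \<le> sup_const * r" by (simp add: sup_const_def algebra_simps)
    have "1 * D \<le> sup_const * D"
      using D0 inv_len_nonneg mu0_pos by (intro mult_right_mono) (auto simp: sup_const_def)
    then show "D \<le> sup_const * D" by simp
  qed (use F0 r0 in auto)
  also have "\<dots> = sup_const / sqrt r * (r * F + D)" by (simp add: algebra_simps)
  also have "\<dots> \<le> sup_const / sqrt r * (r * F + (D + \<kappa>\<^sup>2 * F))"
    using F0 r0 sup_const_pos by (intro mult_left_mono) auto
  also have "r * F + (D + \<kappa>\<^sup>2 * F) = (\<Sum>i<n. (\<mu> i + r) * (x i)\<^sup>2)"
    by (simp add: F_def D_def sum_distrib_left algebra_simps flip: sum.distrib)
  finally show ?thesis .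
qed

text \<open>
  By the fundamental theorem of calculus and Cauchy-Schwarz, the difference of two point evaluations
  has squared norm at most the distance of the points, uniformly in \<open>r\<close>.
\<close>

lemma lincomb_increment_bound:
  assumes e: "e \<in> arcs G" "s \<in> {0..len G e}" "t \<in> {0..len G e}" and r: "0 \<le> r"
  shows "((\<Sum>i<n. x i * \<phi> i e s) - (\<Sum>i<n. x i * \<phi> i e t))\<^sup>2 \<le> \<bar>s - t\<bar> * (\<Sum>i<n. (\<mu> i + r) * (x i)\<^sup>2)"
proof -
  have "((\<Sum>i<n. x i * \<phi> i e s) - (\<Sum>i<n. x i * \<phi> i e t))\<^sup>2
      \<le> \<bar>s - t\<bar> * integral {0..len G e} (\<lambda>t. (\<Sum>i<n. x i * dphi i e t)\<^sup>2)"
    by (rule increment_power2_le_energy[OF lincomb_has_derivative[OF e(1)] lincomb_continuous(2)[OF e(1)] e(2,3)])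
  also have "\<dots> \<le> \<bar>s - t\<bar> * (\<Sum>i<n. (\<mu> i - \<kappa>\<^sup>2) * (x i)\<^sup>2)"
    by (intro mult_left_mono edge_energy_le e) auto
  also have "\<dots> \<le> \<bar>s - t\<bar> * (\<Sum>i<n. (\<mu> i + r) * (x i)\<^sup>2)"
  proof -
    have "- \<kappa>\<^sup>2 \<le> r" using r zero_le_power2[of \<kappa>] by linarith
    then show ?thesis by (intro mult_left_mono sum_mono mult_right_mono) auto
  qed
  finally show ?thesis .
qed

text \<open>
  The left-hand side is the squared norm, with respect to the energy, of the linear functional with
  values \<open>b i\<close> on the span of the first \<open>n\<close> eigenfunctions. The norm is attained at \<open>x i = b i / (\<mu> i + r)\<close>, for which both
  sums of the hypothesis equal the left-hand side.
\<close>

lemma dual_bound: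
  assumes "0 \<le> B" "0 \<le> r" "\<And>x. (\<Sum>i<n. x i * b i)\<^sup>2 \<le> B * (\<Sum>i<n. (\<mu> i + r) * (x i)\<^sup>2)"
  shows "(\<Sum>i<n. (b i)\<^sup>2 / (\<mu> i + r)) \<le> B"
proof -
  let ?S = "\<Sum>i<n. (b i)\<^sup>2 / (\<mu> i + r)"
  have pos: "\<mu> i + r > 0" for i using mu_pos[of i] assms(2) by simp
  have S0: "0 \<le> ?S" using pos by (intro sum_nonneg) (auto simp: less_imp_le)
  have eq: "(\<mu> i + r) * (b i / (\<mu> i + r))\<^sup>2 = (b i)\<^sup>2 / (\<mu> i + r)" for i
    using pos[of i] by (simp add: power2_eq_square)
  have "?S\<^sup>2 \<le> B * ?S"
    using assms(3)[of "\<lambda>i. b i / (\<mu> i + r)"] unfolding eq by (simp add: power2_eq_square)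
  then show ?thesis
    using S0 assms(1) by (cases "?S = 0") (auto simp: power2_eq_square)
qed

lemma resolvent_bound_point:
  assumes "e \<in> arcs G" "t \<in> {0..len G e}" "\<mu> 0 \<le> r"
  shows "(\<Sum>i<n. (\<phi> i e t)\<^sup>2 / (\<mu> i + r)) \<le> sup_const / sqrt r"
proof (rule dual_bound)
  show "0 \<le> r" using assms(3) mu0_pos by simp
  then show "0 \<le> sup_const / sqrt r" using sup_const_pos by simp
  show "(\<Sum>i<n. x i * \<phi> i e t)\<^sup>2 \<le> sup_const / sqrt r * (\<Sum>i<n. (\<mu> i + r) * (x i)\<^sup>2)" for x
    by (rule lincomb_sup_bound[OF assms])
qed

text \<open>
  Two cells touch at a common point of one edge or at a vertex. Through such a point the two averages
  can be compared, because functions in the form domain are continuous there.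
\<close>

definition touching :: "'e \<Rightarrow> real \<Rightarrow> real \<Rightarrow> 'e \<Rightarrow> real \<Rightarrow> real \<Rightarrow> bool" where
  "touching e a b e' a' b' \<longleftrightarrow> is_cell e a b \<and> is_cell e' a' b' \<and>
     (\<exists>c\<in>{a..b}. \<exists>c'\<in>{a'..b'}. same_point G (e, c) (e', c'))"

text \<open>
  The difference of two averages is bounded by the oscillation around the common point, which gives
  \<open>4 * h\<close>, and by twice the supremum, which gives the second bound. The former is better for small
  \<open>h\<close>, the latter for large \<open>r\<close>.
\<close>

lemma resolvent_bound_cells:
  assumes touch: "touching e a b e' a' b'" and h: "b - a \<le> h" "b' - a' \<le> h" and r: "\<mu> 0 \<le> r"
  defines "\<psi> \<equiv> \<lambda>i. L2_inner G (cell_average e a b) (\<phi> i) - L2_inner G (cell_average e' a' b') (\<phi> i)"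
  shows "(\<Sum>i<n. (\<psi> i)\<^sup>2 / (\<mu> i + r)) \<le> min (4 * h) (4 * sup_const / sqrt r)"
proof -
  have r0: "0 \<le> r" using r mu0_pos by simp
  obtain c c' where cc: "c \<in> {a..b}" "c' \<in> {a'..b'}" "same_point G (e, c) (e', c')"
    using touch by (auto simp: touching_def)
  have cell: "is_cell e a b" "is_cell e' a' b'" using touch by (auto simp: touching_def)
  have h0: "0 \<le> h" using h cell by (simp add: is_cell_def)
  have arcs: "e \<in> arcs G" "e' \<in> arcs G" using cell by (auto simp: is_cell_def)
  have inI: "s \<in> {0..len G e}" if "s \<in> {a..b}" for s using that cell by (auto simp: is_cell_def)
  have inI': "s \<in> {0..len G e'}" if "s \<in> {a'..b'}" for s using that cell by (auto simp: is_cell_def)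
  define f where "f x = (\<lambda>e t. \<Sum>i<n. x i * \<phi> i e t)" for x
  define Q where "Q x = (\<Sum>i<n. (\<mu> i + r) * (x i)\<^sup>2)" for x
  have Q0: "0 \<le> Q x" for x
    unfolding Q_def using mu_pos r0 by (intro sum_nonneg mult_nonneg_nonneg) (auto simp: less_imp_le add_nonneg_nonneg)
  have lin: "(\<Sum>i<n. x i * \<psi> i) = L2_inner G (cell_average e a b) (f x) - L2_inner G (cell_average e' a' b') (f x)" for x
    using L2_inner_lincomb[of "{..<n}" \<phi> "cell_average e a b" x]
      L2_inner_lincomb[of "{..<n}" \<phi> "cell_average e' a' b'" x]
    by (simp add: phi_L2 cell_average_L2 cell f_def L2_inner_commute[of "cell_average _ _ _"] \<psi>_def
        right_diff_distrib sum_subtractf)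
  have bound: "(\<Sum>i<n. x i * \<psi> i)\<^sup>2 \<le> 4 * R * Q x"
    if "0 \<le> R" "\<And>s. s \<in> {a..b} \<Longrightarrow> (f x e s - y)\<^sup>2 \<le> R * Q x" "\<And>s. s \<in> {a'..b'} \<Longrightarrow> (f x e' s - y)\<^sup>2 \<le> R * Q x"
    for R x y
  proof -
    have 1: "\<bar>L2_inner G (cell_average e a b) (f x) - y\<bar> \<le> sqrt (R * Q x)"
      using that(2)
      by (intro cell_average_inner_near cell real_le_rsqrt) (simp_all add: f_def lincomb_continuous arcs)
    have 2: "\<bar>L2_inner G (cell_average e' a' b') (f x) - y\<bar> \<le> sqrt (R * Q x)"
      using that(3)
      by (intro cell_average_inner_near cell real_le_rsqrt) (simp_all add: f_def lincomb_continuous arcs)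
    have "\<bar>\<Sum>i<n. x i * \<psi> i\<bar> \<le> 2 * sqrt (R * Q x)" unfolding lin using 1 2 by linarith
    then have "\<bar>\<Sum>i<n. x i * \<psi> i\<bar>\<^sup>2 \<le> (2 * sqrt (R * Q x))\<^sup>2" by (rule power_mono) simp
    then show ?thesis using Q0[of x] that(1) by (simp add: power_mult_distrib)
  qed
  have "(\<Sum>i<n. (\<psi> i)\<^sup>2 / (\<mu> i + r)) \<le> 4 * h"
  proof (rule dual_bound)
    fix x
    have eq: "f x e c = f x e' c'"
      unfolding f_def by (rule graph_continuous_same_point[OF lincomb_graph_continuous cc(3)])
    have "\<bar>s - c\<bar> \<le> h" if "s \<in> {a..b}" for s using that cc h by auto
    moreover have "\<bar>s - c'\<bar> \<le> h" if "s \<in> {a'..b'}" for s using that cc h by auto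
    ultimately show "(\<Sum>i<n. x i * \<psi> i)\<^sup>2 \<le> 4 * h * (\<Sum>i<n. (\<mu> i + r) * (x i)\<^sup>2)"
      unfolding Q_def[symmetric]
    proof (intro bound[where y = "f x e c"] h0)
      fix s assume s: "s \<in> {a..b}" and h: "\<And>s. s \<in> {a..b} \<Longrightarrow> \<bar>s - c\<bar> \<le> h"
      show "(f x e s - f x e c)\<^sup>2 \<le> h * Q x"
        using lincomb_increment_bound[OF arcs(1) inI[OF s] inI[OF cc(1)] r0, where n = n and x = x]
          mult_right_mono[OF h[OF s] Q0[of x]]
        unfolding f_def Q_def by linarith
    next
      fix s assume s: "s \<in> {a'..b'}" and h: "\<And>s. s \<in> {a'..b'} \<Longrightarrow> \<bar>s - c'\<bar> \<le> h"
      show "(f x e' s - f x e c)\<^sup>2 \<le> h * Q x"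
        unfolding eq using lincomb_increment_bound[OF arcs(2) inI'[OF s] inI'[OF cc(2)] r0, where n = n and x = x]
          mult_right_mono[OF h[OF s] Q0[of x]]
        unfolding f_def Q_def by linarith
    qed
  qed (use h0 r0 in auto)
  moreover have "(\<Sum>i<n. (\<psi> i)\<^sup>2 / (\<mu> i + r)) \<le> 4 * (sup_const / sqrt r)"
  proof (rule dual_bound)
    show "(\<Sum>i<n. x i * \<psi> i)\<^sup>2 \<le> 4 * (sup_const / sqrt r) * (\<Sum>i<n. (\<mu> i + r) * (x i)\<^sup>2)" for x
      unfolding Q_def[symmetric]
    proof (rule bound[where y = 0])
      show "(f x e s - 0)\<^sup>2 \<le> sup_const / sqrt r * Q x" if "s \<in> {a..b}" for s
        using lincomb_sup_bound[OF arcs(1) inI[OF that] r, where n = n and x = x] by (simp add: f_def Q_def)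
      show "(f x e' s - 0)\<^sup>2 \<le> sup_const / sqrt r * Q x" if "s \<in> {a'..b'}" for s
        using lincomb_sup_bound[OF arcs(2) inI'[OF that] r, where n = n and x = x] by (simp add: f_def Q_def)
    qed (use sup_const_pos r0 in auto)
  qed (use sup_const_pos r0 in auto)
  ultimately show ?thesis by simp
qed


section \<open>From resolvent bounds to negative powers\<close>

lemma dyadic_level:
  obtains k where "\<mu> 0 * 2 ^ k \<le> \<mu> i" "\<mu> i < 2 * (\<mu> 0 * 2 ^ k)"
proof -
  define P where "P k \<longleftrightarrow> \<mu> i < \<mu> 0 * 2 ^ Suc k" for k
  obtain m where "\<mu> i / \<mu> 0 < 2 ^ m" using real_arch_pow[of 2 "\<mu> i / \<mu> 0"] by auto
  also have "(2::real) ^ m \<le> 2 ^ Suc m" by simp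
  finally have "P m" using mu0_pos by (simp add: P_def field_simps)
  then have P: "P (LEAST k. P k)" by (rule LeastI)
  have "\<mu> 0 * 2 ^ (LEAST k. P k) \<le> \<mu> i"
  proof (cases "LEAST k. P k")
    case 0
    then show ?thesis using mu_ge[of i] by simp
  next
    case (Suc k)
    then have "\<not> P k" by (intro not_less_Least) simp
    then show ?thesis using Suc by (simp add: P_def)
  qed
  then show ?thesis using P that by (simp add: P_def)
qed

text \<open>
  Three times the sum of \<open>r powr - \<delta>\<close> over the dyadic scales \<open>r = \<mu> 0 * 2 ^ k\<close>.
\<close>

definition dyadic_const :: "real \<Rightarrow> real" where
  "dyadic_const \<delta> = 3 * \<mu> 0 powr (- \<delta>) / (1 - 2 powr (- \<delta>))"

text \<open>
  For the dyadic number \<open>r\<close> with \<open>r \<le> \<mu> i < 2 * r\<close> one has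
  \<open>\<mu> i powr - \<beta> \<le> r powr - \<beta> \<le> 3 * r powr (1 - \<beta>) / (\<mu> i + r)\<close>. Summing this over all dyadic \<open>r\<close>
  reduces the claim to the resolvent bounds and a geometric series.
\<close>

lemma negative_power_sum_bound:
  assumes "0 \<le> A" "0 \<le> \<beta>" "1 < \<beta> + \<rho>"
    and resolvent: "\<And>r. \<mu> 0 \<le> r \<Longrightarrow> (\<Sum>i<n. (b i)\<^sup>2 / (\<mu> i + r)) \<le> A * r powr (- \<rho>)"
  shows "(\<Sum>i<n. \<mu> i powr (- \<beta>) * (b i)\<^sup>2) \<le> A * dyadic_const (\<beta> + \<rho> - 1)"
proof -
  define r where "r k = \<mu> 0 * 2 ^ k" for k :: nat
  define \<delta> where "\<delta> = \<beta> + \<rho> - 1"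
  have r_pos: "0 < r k" for k using mu0_pos by (simp add: r_def)
  have r_ge: "\<mu> 0 \<le> r k" for k using mu0_pos by (simp add: r_def)
  have "\<forall>i. \<exists>k. r k \<le> \<mu> i \<and> \<mu> i < 2 * r k"
    using dyadic_level unfolding r_def by metis
  then obtain level where level: "\<And>i. r (level i) \<le> \<mu> i" "\<And>i. \<mu> i < 2 * r (level i)" by metis
  (* the finitely many eigenvalues in the sum lie below level N *)
  define N where "N = Suc (Max (insert 0 (level ` {..<n})))"
  have level_N: "level i < N" if "i < n" for i
    using that by (auto simp: N_def less_Suc_eq_le intro!: Max_ge)
  have pw: "\<mu> i powr (- \<beta>) \<le> (\<Sum>k<N. 3 * r k powr (1 - \<beta>) / (\<mu> i + r k))" if "i < n" for i
  proof -
    let ?r = "r (level i)"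
    have "\<mu> i powr (- \<beta>) \<le> ?r powr (- \<beta>)"
      using level(1)[of i] r_pos assms(2) by (intro powr_mono2') auto
    also have "\<dots> \<le> ?r powr (- \<beta>) * (3 * ?r / (\<mu> i + ?r))"
    proof -
      have "1 \<le> 3 * ?r / (\<mu> i + ?r)"
        using level(2)[of i] r_pos[of "level i"] mu_pos[of i] by simp
      then show ?thesis using mult_left_mono[of 1 "3 * ?r / (\<mu> i + ?r)" "?r powr (- \<beta>)"] by simp
    qed
    also have "\<dots> = 3 * ?r powr (1 - \<beta>) / (\<mu> i + ?r)"
      using r_pos[of "level i"] by (simp add: powr_diff powr_minus field_simps)
    also have "\<dots> \<le> (\<Sum>k<N. 3 * r k powr (1 - \<beta>) / (\<mu> i + r k))"
      using level_N[OF that] r_pos mu_pos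
      by (intro member_le_sum[where f = "\<lambda>k. 3 * r k powr (1 - \<beta>) / (\<mu> i + r k)"]) (auto simp: less_imp_le add_nonneg_nonneg)
    finally show ?thesis .
  qed
  have "(\<Sum>i<n. \<mu> i powr (- \<beta>) * (b i)\<^sup>2) \<le> (\<Sum>i<n. (\<Sum>k<N. 3 * r k powr (1 - \<beta>) / (\<mu> i + r k)) * (b i)\<^sup>2)"
    using pw by (intro sum_mono mult_right_mono) auto
  also have "\<dots> = (\<Sum>k<N. 3 * r k powr (1 - \<beta>) * (\<Sum>i<n. (b i)\<^sup>2 / (\<mu> i + r k)))"
    by (simp add: sum_distrib_right sum_distrib_left) (subst sum.swap, simp)
  also have "\<dots> \<le> (\<Sum>k<N. 3 * r k powr (1 - \<beta>) * (A * r k powr (- \<rho>)))"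
    by (intro sum_mono mult_left_mono resolvent r_ge) auto
  also have "\<dots> = (\<Sum>k<N. 3 * A * \<mu> 0 powr (- \<delta>) * (2 powr (- \<delta>)) ^ k)"
  proof (intro sum.cong refl)
    fix k
    have "r k powr (1 - \<beta>) * r k powr (- \<rho>) = r k powr (- \<delta>)"
      by (simp add: \<delta>_def algebra_simps flip: powr_add)
    also have "\<dots> = \<mu> 0 powr (- \<delta>) * (2 powr (- \<delta>)) ^ k"
      using mu0_pos by (simp add: r_def powr_mult powr_powr mult.commute flip: powr_realpow)
    finally show "3 * r k powr (1 - \<beta>) * (A * r k powr (- \<rho>)) = 3 * A * \<mu> 0 powr (- \<delta>) * (2 powr (- \<delta>)) ^ k"
      by simp
  qed
  also have "\<dots> = 3 * A * \<mu> 0 powr (- \<delta>) * (\<Sum>k<N. (2 powr (- \<delta>)) ^ k)"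
    by (simp add: sum_distrib_left)
  also have "\<dots> \<le> 3 * A * \<mu> 0 powr (- \<delta>) * (1 / (1 - 2 powr (- \<delta>)))"
  proof (intro mult_left_mono)
    have q: "0 < 2 powr (- \<delta>)" "2 powr (- \<delta>) < 1"
      using assms(3) powr_less_mono[of "- \<delta>" 0 2] by (auto simp: \<delta>_def)
    have "(\<Sum>k<N. (2 powr (- \<delta>)) ^ k) \<le> (\<Sum>k. (2 powr (- \<delta>)) ^ k)"
      using q by (intro sum_le_suminf summable_geometric) auto
    then show "(\<Sum>k<N. (2 powr (- \<delta>)) ^ k) \<le> 1 / (1 - 2 powr (- \<delta>))"
      using q by (simp add: suminf_geometric)
  qed (use assms(1) in auto)
  also have "\<dots> = A * dyadic_const \<delta>" by (simp add: dyadic_const_def)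
  finally show ?thesis by (simp only: \<delta>_def)
qed

lemma dyadic_const_nonneg: "0 < \<delta> \<Longrightarrow> 0 \<le> dyadic_const \<delta>"
  using powr_less_mono[of "- \<delta>" 0 2] unfolding dyadic_const_def
  by (intro divide_nonneg_nonneg) auto

lemma geometric_interpolation:
  fixes x y z \<theta> :: real
  assumes "0 \<le> x" "x \<le> y" "x \<le> z" "0 \<le> \<theta>" "\<theta> \<le> 1"
  shows "x \<le> y powr \<theta> * z powr (1 - \<theta>)"
proof (cases "x = 0")
  case False
  then have "x = x powr \<theta> * x powr (1 - \<theta>)" using assms by (simp flip: powr_add)
  also have "\<dots> \<le> y powr \<theta> * z powr (1 - \<theta>)"
    using assms by (intro mult_mono powr_mono2) auto
  finally show ?thesis .
qed simp

text \<open>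
  The two resolvent bounds are interpolated geometrically, with weight \<open>\<theta>\<close> on the one that is small
  in \<open>h\<close>; the series over the dyadic scales converges exactly when \<open>\<theta> < 2 * \<beta> - 1\<close>. This is where
  the Hoelder exponent \<open>\<theta> / 2 < min (\<beta> - 1 / 2) (1 / 2)\<close> comes from.
\<close>

lemma cell_difference_variance:
  assumes "1 / 2 < \<beta>" "0 \<le> \<theta>" "\<theta> \<le> 1" "\<theta> < 2 * \<beta> - 1"
  obtains K where "0 \<le> K"
    "\<And>n e a b e' a' b' h. touching e a b e' a' b' \<Longrightarrow> b - a \<le> h \<Longrightarrow> b' - a' \<le> h \<Longrightarrow>
      (\<Sum>i<n. \<mu> i powr (- \<beta>) *
        (L2_inner G (cell_average e a b) (\<phi> i) - L2_inner G (cell_average e' a' b') (\<phi> i))\<^sup>2) \<le> K * h powr \<theta>"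
proof -
  define \<rho> where "\<rho> = (1 - \<theta>) / 2"
  define K where "K = 4 powr \<theta> * (4 * sup_const) powr (1 - \<theta>) * dyadic_const (\<beta> + \<rho> - 1)"
  have pos: "1 < \<beta> + \<rho>" using assms(4) unfolding \<rho>_def by argo
  have "0 \<le> K" using pos dyadic_const_nonneg by (simp add: K_def)
  moreover have "(\<Sum>i<n. \<mu> i powr (- \<beta>) *
        (L2_inner G (cell_average e a b) (\<phi> i) - L2_inner G (cell_average e' a' b') (\<phi> i))\<^sup>2) \<le> K * h powr \<theta>"
    if t: "touching e a b e' a' b'" "b - a \<le> h" "b' - a' \<le> h" for n e a b e' a' b' h
  proof -
    have h: "0 < h" using t by (auto simp: touching_def is_cell_def)
    define \<psi> where "\<psi> i = L2_inner G (cell_average e a b) (\<phi> i) - L2_inner G (cell_average e' a' b') (\<phi> i)" for i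
    have "(\<Sum>i<n. \<mu> i powr (- \<beta>) * (\<psi> i)\<^sup>2)
        \<le> (4 * h) powr \<theta> * (4 * sup_const) powr (1 - \<theta>) * dyadic_const (\<beta> + \<rho> - 1)"
    proof (rule negative_power_sum_bound[OF _ _ pos])
      fix r assume r: "\<mu> 0 \<le> r"
      then have r0: "0 < r" using mu0_pos by simp
      have res: "(\<Sum>i<n. (\<psi> i)\<^sup>2 / (\<mu> i + r)) \<le> min (4 * h) (4 * sup_const / sqrt r)"
        unfolding \<psi>_def by (rule resolvent_bound_cells[OF t r])
      have "(\<Sum>i<n. (\<psi> i)\<^sup>2 / (\<mu> i + r)) \<le> (4 * h) powr \<theta> * (4 * sup_const / sqrt r) powr (1 - \<theta>)"
        using res assms(2,3) mu_pos r0
        by (intro geometric_interpolation sum_nonneg) (auto simp: less_imp_le add_nonneg_nonneg)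
      also have "(4 * sup_const / sqrt r) powr (1 - \<theta>) = (4 * sup_const) powr (1 - \<theta>) * r powr (- \<rho>)"
        using r0 sup_const_pos
        by (simp add: powr_divide powr_half_sqrt[symmetric] powr_powr powr_minus \<rho>_def field_simps)
      finally show "(\<Sum>i<n. (\<psi> i)\<^sup>2 / (\<mu> i + r)) \<le> (4 * h) powr \<theta> * (4 * sup_const) powr (1 - \<theta>) * r powr (- \<rho>)"
        by (simp add: mult.assoc)
    qed (use assms(1) in auto)
    then show ?thesis using h by (simp add: K_def \<psi>_def powr_mult mult_ac)
  qed
  ultimately show ?thesis by (rule that)
qed

text \<open>
  The bound for point evaluations is uniform on the graph. Integrating it replaces each squared
  eigenfunction by its norm, which is one.
\<close>

lemma negative_powers_summable:
  assumes "1 / 2 < \<beta>" shows "summable (\<lambda>i. \<mu> i powr (- \<beta>))"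
proof (rule summableI_nonneg_bounded)
  fix n
  define K where "K = sup_const * dyadic_const (\<beta> + 1 / 2 - 1)"
  have pointwise: "(\<Sum>i<n. \<mu> i powr (- \<beta>) * (\<phi> i e t)\<^sup>2) \<le> K" if e: "e \<in> arcs G" "t \<in> {0..len G e}" for e t
    unfolding K_def
  proof (rule negative_power_sum_bound)
    fix r assume r: "\<mu> 0 \<le> r"
    then have "0 < r" using mu0_pos by simp
    then have "r powr - (1 / 2) = inverse (sqrt r)"
      using powr_minus[of r "1 / 2"] powr_half_sqrt[of r] by (simp only: less_imp_le)
    then show "(\<Sum>i<n. (\<phi> i e t)\<^sup>2 / (\<mu> i + r)) \<le> sup_const * r powr - (1 / 2)"
      using resolvent_bound_point[OF e r, of n] by (simp only: divide_inverse)
  qed (use assms sup_const_pos in auto)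
  have "(\<Sum>i<n. \<mu> i powr (- \<beta>)) = (\<Sum>i<n. \<mu> i powr (- \<beta>) * L2_inner G (\<phi> i) (\<phi> i))"
    by (simp add: phi_orthonormal)
  also have "\<dots> = (\<Sum>e\<in>arcs G. \<Sum>i<n. \<mu> i powr (- \<beta>) * integral {0..len G e} (\<lambda>t. \<phi> i e t * \<phi> i e t))"
    by (subst sum.swap) (simp add: L2_inner_continuous phi_continuous sum_distrib_left)
  also have "\<dots> = (\<Sum>e\<in>arcs G. integral {0..len G e} (\<lambda>t. \<Sum>i<n. \<mu> i powr (- \<beta>) * (\<phi> i e t)\<^sup>2))"
  proof (intro sum.cong refl)
    fix e assume e: "e \<in> arcs G"
    have "integral {0..len G e} (\<lambda>t. \<Sum>i<n. \<mu> i powr (- \<beta>) * (\<phi> i e t)\<^sup>2) =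
        (\<Sum>i<n. integral {0..len G e} (\<lambda>t. \<mu> i powr (- \<beta>) * (\<phi> i e t)\<^sup>2))"
      by (intro integral_sum integrable_continuous_interval continuous_intros phi_continuous e) auto
    then show "(\<Sum>i<n. \<mu> i powr (- \<beta>) * integral {0..len G e} (\<lambda>t. \<phi> i e t * \<phi> i e t)) =
        integral {0..len G e} (\<lambda>t. \<Sum>i<n. \<mu> i powr (- \<beta>) * (\<phi> i e t)\<^sup>2)"
      by (simp add: power2_eq_square)
  qed
  also have "\<dots> \<le> (\<Sum>e\<in>arcs G. integral {0..len G e} (\<lambda>t. K))"
    using pointwise by (intro sum_mono integral_le integrable_continuous_interval continuous_intros phi_continuous) auto
  also have "\<dots> = (\<Sum>e\<in>arcs G. len G e * K)"
    by (intro sum.cong refl) (simp add: less_imp_le[OF len_pos])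
  finally show "(\<Sum>i<n. \<mu> i powr (- \<beta>)) \<le> (\<Sum>e\<in>arcs G. len G e * (sup_const * dyadic_const (\<beta> + 1 / 2 - 1)))"
    by (simp add: K_def)
qed simp

end


section \<open>Reconstructing a Hoelder function from its dyadic averages\<close>

lemma geometric_increments_converge:
  fixes x :: "nat \<Rightarrow> real"
  assumes inc: "\<And>n. \<bar>x (Suc n) - x n\<bar> \<le> K * q ^ n" and q: "0 \<le> q" "q < 1" and K: "0 \<le> K"
  shows "x \<longlonglongrightarrow> lim x" "\<bar>lim x - x n\<bar> \<le> K / (1 - q) * q ^ n"
proof -
  have "summable (\<lambda>n. x (Suc n) - x n)"
    by (rule summable_comparison_test'[of "\<lambda>n. K * q ^ n" 0])
      (use q inc in \<open>auto intro!: summable_mult summable_geometric\<close>)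
  then obtain s where "(\<lambda>n. \<Sum>i<n. x (Suc i) - x i) \<longlonglongrightarrow> s"
    by (auto simp: summable_def sums_def)
  then have "(\<lambda>n. x n - x 0 + x 0) \<longlonglongrightarrow> s + x 0"
    unfolding sum_lessThan_telescope by (intro tendsto_intros)
  then have "convergent x" by (simp add: convergentI)
  then show lim: "x \<longlonglongrightarrow> lim x" by (simp only: convergent_LIMSEQ_iff)
  have part: "\<bar>x (n + m) - x n\<bar> \<le> K * q ^ n * (\<Sum>i<m. q ^ i)" for m
  proof (induction m)
    case (Suc m)
    have "\<bar>x (n + Suc m) - x n\<bar> \<le> \<bar>x (Suc (n + m)) - x (n + m)\<bar> + \<bar>x (n + m) - x n\<bar>" by simp
    also have "\<dots> \<le> K * q ^ (n + m) + K * q ^ n * (\<Sum>i<m. q ^ i)"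
      by (intro add_mono inc Suc)
    finally show ?case by (simp add: power_add algebra_simps)
  qed simp
  have "\<bar>x (n + m) - x n\<bar> \<le> K / (1 - q) * q ^ n" for m
  proof -
    have "(\<Sum>i<m. q ^ i) \<le> (\<Sum>i. q ^ i)"
      using q by (intro sum_le_suminf summable_geometric) auto
    also have "\<dots> = 1 / (1 - q)" using q by (simp add: suminf_geometric)
    finally have "K * q ^ n * (\<Sum>i<m. q ^ i) \<le> K * q ^ n * (1 / (1 - q))"
      using K q by (intro mult_left_mono) auto
    with part[of m] show ?thesis by simp
  qed
  moreover have "(\<lambda>m. \<bar>x (n + m) - x n\<bar>) \<longlonglongrightarrow> \<bar>lim x - x n\<bar>"
    using LIMSEQ_ignore_initial_segment[OF lim, of n] by (intro tendsto_intros) (simp add: add.commute)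
  ultimately show "\<bar>lim x - x n\<bar> \<le> K / (1 - q) * q ^ n"
    by (intro LIMSEQ_le_const2[of _ "\<bar>lim x - x n\<bar>"]) auto
qed

text \<open>
  The endpoint \<open>t = l\<close> is counted to the last cell, hence the minimum.
\<close>

definition cell_index :: "real \<Rightarrow> nat \<Rightarrow> real \<Rightarrow> nat" where
  "cell_index l n t = min (nat \<lfloor>t / l * 2 ^ n\<rfloor>) (2 ^ n - 1)"

lemma cell_index_less: "cell_index l n t < 2 ^ n"
  unfolding cell_index_def by (rule min.strict_coboundedI2) simp

lemma cell_index_eq_floor:
  assumes "0 < l" "0 \<le> t" "t < l" shows "cell_index l n t = nat \<lfloor>t / l * 2 ^ n\<rfloor>"
proof -
  have "t / l * 2 ^ n < 2 ^ n" using assms by (simp add: field_simps)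
  then have "\<lfloor>t / l * 2 ^ n\<rfloor> < 2 ^ n" by (simp add: floor_less_iff)
  then have "nat \<lfloor>t / l * 2 ^ n\<rfloor> < nat (2 ^ n)" by (subst zless_nat_conj) simp
  moreover have "nat (2 ^ n) = 2 ^ n" by (simp add: nat_power_eq)
  ultimately have "nat \<lfloor>t / l * 2 ^ n\<rfloor> \<le> 2 ^ n - 1" by linarith
  then show ?thesis unfolding cell_index_def by (rule min_absorb1)
qed

lemma cell_index_end: assumes "0 < l" shows "cell_index l n l = 2 ^ n - 1"
proof -
  have "nat \<lfloor>l / l * 2 ^ n\<rfloor> = 2 ^ n" using assms by (simp add: nat_power_eq)
  then show ?thesis unfolding cell_index_def by (simp only: min_absorb2 diff_le_self)
qed

lemma cell_index_Suc:
  assumes "0 < l" "t \<in> {0..l}" shows "cell_index l (Suc n) t div 2 = cell_index l n t"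
proof (cases "t = l")
  case True
  have "(2 * 2 ^ n - 1) div 2 = (2 ^ n - 1 :: nat)"
    by (cases "2 ^ n :: nat") auto
  then show ?thesis using True assms by (simp add: cell_index_end)
next
  case False
  then have t: "0 \<le> t" "t < l" using assms by auto
  have "\<lfloor>t / l * 2 ^ n\<rfloor> = \<lfloor>(t / l * 2 ^ Suc n) / real_of_int 2\<rfloor>" by simp
  also have "\<dots> = \<lfloor>t / l * 2 ^ Suc n\<rfloor> div 2" by (rule floor_divide_real_eq_div) simp
  finally show ?thesis
    using t assms(1) by (simp add: cell_index_eq_floor nat_div_distrib)
qed

lemma cell_index_in_cell:
  assumes "0 < l" "t \<in> {0..l}"
  shows "l * real (cell_index l n t) / 2 ^ n \<le> t" "t \<le> l * real (Suc (cell_index l n t)) / 2 ^ n"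
    and "t < l \<Longrightarrow> t < l * real (Suc (cell_index l n t)) / 2 ^ n"
proof -
  have "l * real (cell_index l n t) / 2 ^ n \<le> t \<and> t \<le> l * real (Suc (cell_index l n t)) / 2 ^ n \<and>
      (t < l \<longrightarrow> t < l * real (Suc (cell_index l n t)) / 2 ^ n)"
  proof (cases "t = l")
    case True
    then show ?thesis using assms by (simp add: cell_index_end of_nat_diff field_simps)
  next
    case False
    then have t: "0 \<le> t" "t < l" using assms by auto
    have "0 \<le> \<lfloor>t / l * 2 ^ n\<rfloor>" using assms by simp
    then have "real (cell_index l n t) = real_of_int \<lfloor>t / l * 2 ^ n\<rfloor>"
      using t assms(1) by (simp add: cell_index_eq_floor)
    then have "real (cell_index l n t) \<le> t / l * 2 ^ n" "t / l * 2 ^ n < real (Suc (cell_index l n t))"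
      by linarith+
    then show ?thesis using assms(1) by (simp add: field_simps)
  qed
  then show "l * real (cell_index l n t) / 2 ^ n \<le> t" "t \<le> l * real (Suc (cell_index l n t)) / 2 ^ n"
    "t < l \<Longrightarrow> t < l * real (Suc (cell_index l n t)) / 2 ^ n" by auto
qed

text \<open>
  If the index of \<open>s\<close> were larger by two, then \<open>t\<close> would have to be the right endpoint of its cell.
  This happens only at the end of the edge, and there are no further cells beyond it.
\<close>

lemma cell_index_near:
  assumes "0 < l" "s \<in> {0..l}" "t \<in> {0..l}" "\<bar>s - t\<bar> \<le> l / 2 ^ n"
  shows "cell_index l n s \<le> Suc (cell_index l n t)"
proof (rule ccontr)
  assume "\<not> ?thesis"
  then have "real (Suc (cell_index l n t)) + 1 \<le> real (cell_index l n s)" by linarith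
  moreover have "s * 2 ^ n \<le> t * 2 ^ n + l" using assms by (simp add: abs_le_iff field_simps)
  moreover have "l * real (cell_index l n s) \<le> s * 2 ^ n"
    using cell_index_in_cell(1)[OF assms(1,2), of n] by (simp add: field_simps)
  moreover have "t * 2 ^ n \<le> l * real (Suc (cell_index l n t))"
    using cell_index_in_cell(2)[OF assms(1,3), of n] by (simp add: field_simps)
  moreover have "l * (real (Suc (cell_index l n t)) + 1) \<le> l * real (cell_index l n s)"
    using calculation(1) assms(1) by simp
  ultimately have eq: "t * 2 ^ n = l * real (Suc (cell_index l n t))" and s: "s * 2 ^ n = l * real (cell_index l n s)"
    by (simp_all add: algebra_simps)
  have "\<not> t < l"
    using cell_index_in_cell(3)[OF assms(1,3), of n] eq by (auto simp: field_simps)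
  then have "t = l" using assms by auto
  then have "Suc (cell_index l n t) = 2 ^ n" using assms(1) by (simp add: cell_index_end)
  then show False
    using cell_index_less[of l n s] \<open>\<not> cell_index l n s \<le> Suc (cell_index l n t)\<close> by simp
qed

text \<open>
  \<open>A n k\<close> plays the role of the mean of a function over the cell \<open>k\<close> of level \<open>n\<close>. The decay of the
  differences of adjacent means is Kolmogorov's criterion for \<open>\<gamma>\<close>-Hoelder continuity.
\<close>

locale dyadic_averages =
  fixes l \<gamma> K :: real and A :: "nat \<Rightarrow> nat \<Rightarrow> real"
  assumes l_pos: "0 < l" and gamma: "0 < \<gamma>" and K_nonneg: "0 \<le> K"
    and average: "k < 2 ^ n \<Longrightarrow> A n k = (A (Suc n) (2 * k) + A (Suc n) (2 * k + 1)) / 2"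
    and adjacent: "Suc k < 2 ^ n \<Longrightarrow> \<bar>A n k - A n (Suc k)\<bar> \<le> K * (2 powr - \<gamma>) ^ n"
begin

abbreviation q :: real where "q \<equiv> 2 powr - \<gamma>"

lemma q: "0 < q" "q < 1"
proof -
  show "0 < q" by simp
  show "q < 1" using gamma powr_less_mono[of "- \<gamma>" 0 2] by simp
qed

definition limit_function :: "real \<Rightarrow> real" where
  "limit_function t = lim (\<lambda>n. A n (cell_index l n t))"

definition tail_const :: real where "tail_const = K / (1 - q)"

lemma tail_const_nonneg: "0 \<le> tail_const" using q K_nonneg by (simp add: tail_const_def)

text \<open>
  A mean differs from those over its two halves by half of their difference, which is the
  difference of adjacent means. So the means along nested cells form a geometrically convergent
  sequence.
\<close>

lemma
  assumes t: "t \<in> {0..l}"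
  shows averages_tendsto: "(\<lambda>n. A n (cell_index l n t)) \<longlonglongrightarrow> limit_function t"
    and averages_near: "\<bar>limit_function t - A n (cell_index l n t)\<bar> \<le> tail_const * q ^ n"
proof -
  have "\<bar>A (Suc n) (cell_index l (Suc n) t) - A n (cell_index l n t)\<bar> \<le> K * q ^ n" for n
  proof -
    define k where "k = cell_index l n t"
    have k: "k < 2 ^ n" unfolding k_def by (rule cell_index_less)
    have "cell_index l (Suc n) t div 2 = k" using cell_index_Suc[OF l_pos t] by (simp add: k_def)
    then have j: "cell_index l (Suc n) t = 2 * k \<or> cell_index l (Suc n) t = Suc (2 * k)" by linarith
    have "Suc (2 * k) < 2 ^ Suc n" using k by simp
    from adjacent[OF this] have adj: "\<bar>A (Suc n) (2 * k) - A (Suc n) (Suc (2 * k))\<bar> \<le> K * q ^ Suc n" .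
    have "K * q ^ Suc n \<le> K * q ^ n" using q K_nonneg by (intro mult_left_mono power_decreasing) auto
    with j adj average[OF k] show ?thesis unfolding k_def[symmetric] by auto
  qed
  from geometric_increments_converge[OF this less_imp_le[OF q(1)] q(2) K_nonneg]
  show "(\<lambda>n. A n (cell_index l n t)) \<longlonglongrightarrow> limit_function t"
    "\<bar>limit_function t - A n (cell_index l n t)\<bar> \<le> tail_const * q ^ n"
    by (simp_all add: limit_function_def tail_const_def)
qed

lemma same_or_adjacent:
  assumes "i \<le> Suc k" "k \<le> Suc i" "i < 2 ^ n" "k < 2 ^ n" shows "\<bar>A n i - A n k\<bar> \<le> K * q ^ n"
proof -
  consider "i = k" | "i = Suc k" | "k = Suc i" using assms by linarith
  then show ?thesis
    using adjacent[of i n] adjacent[of k n] assms K_nonneg q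
    by cases (auto simp: abs_minus_commute)
qed

definition holder_const :: real where "holder_const = (2 * tail_const + K) * (2 / l) powr \<gamma>"

text \<open>
  Compare at the level \<open>n\<close> whose cell length is of the order of \<open>\<bar>s - t\<bar>\<close>: there the points lie in
  the same or in adjacent cells.
\<close>

lemma limit_function_holder:
  assumes s: "s \<in> {0..l}" and t: "t \<in> {0..l}"
  shows "\<bar>limit_function s - limit_function t\<bar> \<le> holder_const * \<bar>s - t\<bar> powr \<gamma>"
proof (cases "s = t")
  case False
  define d where "d = \<bar>s - t\<bar>"
  have d: "0 < d" "d \<le> l" using False s t by (auto simp: d_def)
  (* the first level whose cells are shorter than 2 * d, but not shorter than d *)
  define P where "P n \<longleftrightarrow> l / 2 ^ Suc n < d" for n
  obtain m where "l / d < 2 ^ m" using real_arch_pow[of 2 "l / d"] by auto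
  also have "(2::real) ^ m \<le> 2 ^ Suc m" by simp
  finally have "P m" using d by (simp add: P_def field_simps)
  define n where "n = (LEAST n. P n)"
  have Pn: "P n" unfolding n_def using \<open>P m\<close> by (rule LeastI)
  have near: "d \<le> l / 2 ^ n"
  proof (cases n)
    case (Suc k)
    then have "\<not> P k" unfolding n_def by (intro not_less_Least) simp
    then show ?thesis using Suc by (simp add: P_def)
  qed (use d in simp)
  have "\<bar>A n (cell_index l n s) - A n (cell_index l n t)\<bar> \<le> K * q ^ n"
    using near by (intro same_or_adjacent cell_index_near cell_index_less l_pos s t) (auto simp: d_def abs_minus_commute)
  then have "\<bar>limit_function s - limit_function t\<bar> \<le> (2 * tail_const + K) * q ^ n"
    using averages_near[OF s, of n] averages_near[OF t, of n] by (simp add: distrib_right)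
  also have "\<dots> \<le> (2 * tail_const + K) * (2 * d / l) powr \<gamma>"
  proof (rule mult_left_mono)
    have "q ^ n = (1 / 2 ^ n) powr \<gamma>"
    proof -
      have "q ^ n = 2 powr (- \<gamma> * real n)" by (simp add: powr_powr flip: powr_realpow)
      also have "\<dots> = (2 powr (- real n)) powr \<gamma>" by (simp add: powr_powr mult.commute)
      also have "2 powr (- real n) = 1 / 2 ^ n" by (simp add: powr_minus powr_realpow divide_inverse)
      finally show ?thesis .
    qed
    also have "\<dots> \<le> (2 * d / l) powr \<gamma>"
      using Pn l_pos gamma d by (intro powr_mono2) (auto simp: P_def field_simps)
    finally show "q ^ n \<le> (2 * d / l) powr \<gamma>" .
  qed (use tail_const_nonneg K_nonneg in auto)
  also have "(2 * d / l) powr \<gamma> = (2 / l) powr \<gamma> * d powr \<gamma>"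
    using d l_pos by (simp add: powr_mult[symmetric])
  finally show ?thesis by (simp add: holder_const_def d_def mult.assoc)
qed (use gamma in simp)

lemma limit_function_continuous: "continuous_on {0..l} limit_function"
proof (rule continuous_onI)
  fix t e :: real assume t: "t \<in> {0..l}" and e: "0 < e"
  have H: "0 \<le> holder_const" using tail_const_nonneg K_nonneg by (simp add: holder_const_def)
  (* holder_const * d powr gamma stays below e; the summand 1 excludes division by zero *)
  define d where "d = (e / (holder_const + 1)) powr (1 / \<gamma>)"
  have d: "0 < d" using e H by (simp add: d_def)
  have "dist (limit_function s) (limit_function t) \<le> e" if s: "s \<in> {0..l}" "dist s t < d" for s
  proof -
    have "\<bar>s - t\<bar> powr \<gamma> \<le> d powr \<gamma>" using that gamma by (intro powr_mono2) (auto simp: dist_real_def)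
    also have "d powr \<gamma> = e / (holder_const + 1)" using e H gamma by (simp add: d_def powr_powr)
    finally have "holder_const * \<bar>s - t\<bar> powr \<gamma> \<le> holder_const * (e / (holder_const + 1))"
      by (rule mult_left_mono[OF _ H])
    also have "\<dots> \<le> e" using H e by (simp add: field_simps)
    finally show ?thesis using limit_function_holder[OF s(1) t] by (simp add: dist_real_def)
  qed
  with d show "\<exists>d>0. \<forall>s\<in>{0..l}. dist s t < d \<longrightarrow> dist (limit_function s) (limit_function t) \<le> e" by blast
qed

lemma limit_function_near_cell:
  assumes k: "k < 2 ^ n" and t: "t \<in> {l * real k / 2 ^ n..l * real (Suc k) / 2 ^ n}"
  shows "\<bar>limit_function t - A n k\<bar> \<le> (tail_const + K) * q ^ n"
proof -
  have "real (Suc k) \<le> 2 ^ n" using k by (metis Suc_leI of_nat_le_iff of_nat_numeral of_nat_power)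
  then have "l * real (Suc k) / 2 ^ n \<le> l"
    using l_pos by (simp add: pos_divide_le_eq del: of_nat_Suc)
  moreover have "0 \<le> l * real k / 2 ^ n" using l_pos by simp
  ultimately have t01: "t \<in> {0..l}" using t by auto
  let ?i = "cell_index l n t"
  have "l * real ?i \<le> l * real (Suc k)" "l * real k \<le> l * real (Suc ?i)"
    using cell_index_in_cell[OF l_pos t01, of n] t by (auto simp: field_simps)
  then have "real ?i \<le> real (Suc k)" "real k \<le> real (Suc ?i)"
    using l_pos mult_le_cancel_left_pos by blast+
  then have "\<bar>A n ?i - A n k\<bar> \<le> K * q ^ n"
    by (intro same_or_adjacent cell_index_less k) linarith+
  then show ?thesis using averages_near[OF t01, of n] by (simp add: distrib_right)
qed

lemma integral_uniform_partition:
  assumes "continuous_on {0..l} g" "m \<le> 2 ^ n"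
  shows "integral {0..l * real m / 2 ^ n} g =
    (\<Sum>k<m. integral {l * real k / 2 ^ n..l * real (Suc k) / 2 ^ n} (g :: real \<Rightarrow> real))"
  using assms(2)
proof (induction m)
  case (Suc m)
  have "real (Suc m) \<le> 2 ^ n" using Suc.prems by (metis of_nat_le_iff of_nat_numeral of_nat_power)
  then have le: "l * real (Suc m) / 2 ^ n \<le> l"
    using l_pos by (simp add: pos_divide_le_eq del: of_nat_Suc)
  have "integral {0..l * real m / 2 ^ n} g + integral {l * real m / 2 ^ n..l * real (Suc m) / 2 ^ n} g =
      integral {0..l * real (Suc m) / 2 ^ n} g"
    using l_pos le
    by (intro Henstock_Kurzweil_Integration.integral_combine integrable_continuous_interval continuous_on_subset[OF assms(1)])
      (auto intro!: divide_right_mono)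
  then show ?case using Suc by simp
qed simp

text \<open>
  On a cell both \<open>limit_function\<close> and \<open>\<eta>\<close> are uniformly close to the constants \<open>A n k\<close> and
  \<open>\<eta>\<close> at its left endpoint.
\<close>

lemma riemann_sums_tendsto_integral:
  assumes \<eta>: "continuous_on {0..l} \<eta>"
  shows "(\<lambda>n. \<Sum>k<2 ^ n. A n k * (l / 2 ^ n * \<eta> (l * real k / 2 ^ n)))
    \<longlonglongrightarrow> integral {0..l} (\<lambda>t. limit_function t * \<eta> t)"
proof (rule LIMSEQ_I)
  fix e :: real assume e: "0 < e"
  have "bounded (\<eta> ` {0..l})" "bounded (limit_function ` {0..l})"
    using compact_continuous_image[OF \<eta>] compact_continuous_image[OF limit_function_continuous]
    by (auto intro: compact_imp_bounded)
  then obtain B1 B2 where B: "\<And>t. t \<in> {0..l} \<Longrightarrow> \<bar>\<eta> t\<bar> \<le> B1" "\<And>t. t \<in> {0..l} \<Longrightarrow> \<bar>limit_function t\<bar> \<le> B2"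
    unfolding bounded_real by blast
  (* each cell contributes at most epsilon * (|B1| + |B2|) times its length *)
  define \<epsilon> where "\<epsilon> = e / (2 * l * (\<bar>B1\<bar> + \<bar>B2\<bar> + 1))"
  have \<epsilon>: "0 < \<epsilon>" using e l_pos by (simp add: \<epsilon>_def)
  have "uniformly_continuous_on {0..l} \<eta>" using \<eta> by (intro compact_uniformly_continuous) auto
  then obtain d where d: "0 < d" "\<And>s t. s \<in> {0..l} \<Longrightarrow> t \<in> {0..l} \<Longrightarrow> dist s t < d \<Longrightarrow> dist (\<eta> s) (\<eta> t) < \<epsilon>"
    unfolding uniformly_continuous_on_def using \<epsilon> by metis
  have "(\<lambda>n. l * (1 / 2) ^ n) \<longlonglongrightarrow> l * 0" "(\<lambda>n. (tail_const + K) * q ^ n) \<longlonglongrightarrow> (tail_const + K) * 0"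
    using q by (intro tendsto_intros LIMSEQ_power_zero; simp)+
  from order_tendstoD(2)[OF this(1), of d] order_tendstoD(2)[OF this(2), of \<epsilon>]
  have "\<forall>\<^sub>F n in sequentially. l * (1 / 2) ^ n < d" "\<forall>\<^sub>F n in sequentially. (tail_const + K) * q ^ n < \<epsilon>"
    using d(1) \<epsilon> by simp_all
  then have "\<forall>\<^sub>F n in sequentially. l * (1 / 2) ^ n < d \<and> (tail_const + K) * q ^ n < \<epsilon>"
    by (rule eventually_conj)
  then obtain N where N: "\<And>n. n \<ge> N \<Longrightarrow> l * (1 / 2) ^ n < d \<and> (tail_const + K) * q ^ n < \<epsilon>"
    by (auto simp: eventually_sequentially)
  have "norm ((\<Sum>k<2 ^ n. A n k * (l / 2 ^ n * \<eta> (l * real k / 2 ^ n))) - integral {0..l} (\<lambda>t. limit_function t * \<eta> t)) < e"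
    if n: "n \<ge> N" for n
  proof -
    let ?x = "\<lambda>k. l * real k / 2 ^ n"
    have c: "continuous_on {0..l} (\<lambda>t. limit_function t * \<eta> t)"
      by (intro continuous_intros \<eta> limit_function_continuous)
    have cell: "\<bar>A n k * (l / 2 ^ n * \<eta> (?x k)) - integral {?x k..?x (Suc k)} (\<lambda>t. limit_function t * \<eta> t)\<bar>
        \<le> \<epsilon> * (\<bar>B1\<bar> + \<bar>B2\<bar>) * (l / 2 ^ n)" if k: "k < 2 ^ n" for k
    proof -
      have "real (Suc k) \<le> 2 ^ n" using k by (metis Suc_leI of_nat_le_iff of_nat_numeral of_nat_power)
      then have "?x (Suc k) \<le> l" using l_pos by (simp add: pos_divide_le_eq del: of_nat_Suc)
      moreover have x0: "0 \<le> ?x k" using l_pos by simp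
      ultimately have sub: "{?x k..?x (Suc k)} \<subseteq> {0..l}" by auto
      have w: "?x (Suc k) - ?x k = l / 2 ^ n" by (simp add: field_simps)
      then have xk: "?x k \<in> {?x k..?x (Suc k)}" using l_pos by (simp add: divide_right_mono)
      have pt: "\<bar>A n k * \<eta> (?x k) - limit_function t * \<eta> t\<bar> \<le> \<epsilon> * (\<bar>B1\<bar> + \<bar>B2\<bar>)" if t: "t \<in> {?x k..?x (Suc k)}" for t
      proof -
        have "t - ?x k \<le> l / 2 ^ n" "0 \<le> t - ?x k" using t w by auto
        moreover have "l / 2 ^ n < d" using N[OF n] by (simp add: power_one_over)
        ultimately have "dist (?x k) t < d" unfolding dist_real_def by linarith
        then have 1: "\<bar>\<eta> (?x k) - \<eta> t\<bar> \<le> \<epsilon>" using d(2)[of "?x k" t] xk sub t by (auto simp: dist_real_def)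
        have 2: "\<bar>limit_function t - A n k\<bar> \<le> \<epsilon>"
          using limit_function_near_cell[OF k t] N[OF n] by linarith
        have "A n k * \<eta> (?x k) - limit_function t * \<eta> t =
            (A n k - limit_function t) * \<eta> (?x k) + limit_function t * (\<eta> (?x k) - \<eta> t)"
          by (simp add: algebra_simps)
        also have "\<bar>\<dots>\<bar> \<le> \<bar>A n k - limit_function t\<bar> * \<bar>\<eta> (?x k)\<bar> + \<bar>limit_function t\<bar> * \<bar>\<eta> (?x k) - \<eta> t\<bar>"
          by (simp add: abs_mult[symmetric])
        also have "\<dots> \<le> \<epsilon> * \<bar>B1\<bar> + \<bar>B2\<bar> * \<epsilon>"
          using 1 2 B(1)[of "?x k"] B(2)[of t] xk sub t \<epsilon>
          by (intro add_mono mult_mono) (auto simp: abs_minus_commute)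
        finally show ?thesis by (simp add: algebra_simps)
      qed
      have ci: "continuous_on {?x k..?x (Suc k)} (\<lambda>t. limit_function t * \<eta> t)"
        using c sub by (rule continuous_on_subset)
      have "A n k * (l / 2 ^ n * \<eta> (?x k)) - integral {?x k..?x (Suc k)} (\<lambda>t. limit_function t * \<eta> t) =
          integral {?x k..?x (Suc k)} (\<lambda>t. A n k * \<eta> (?x k)) - integral {?x k..?x (Suc k)} (\<lambda>t. limit_function t * \<eta> t)"
        using xk w by simp
      also have "\<dots> = integral {?x k..?x (Suc k)} (\<lambda>t. A n k * \<eta> (?x k) - limit_function t * \<eta> t)"
        by (intro Henstock_Kurzweil_Integration.integral_diff[symmetric] integrable_continuous_interval ci continuous_intros)
      also have "\<bar>\<dots>\<bar> \<le> integral {?x k..?x (Suc k)} (\<lambda>t. \<epsilon> * (\<bar>B1\<bar> + \<bar>B2\<bar>))"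
        unfolding real_norm_def[symmetric]
        by (rule integral_norm_bound_integral; (intro integrable_continuous_interval ci continuous_intros)?)
          (use pt in auto)
      also have "\<dots> = \<epsilon> * (\<bar>B1\<bar> + \<bar>B2\<bar>) * (l / 2 ^ n)" using xk w by simp
      finally show ?thesis .
    qed
    have "integral {0..l} (\<lambda>t. limit_function t * \<eta> t) =
        (\<Sum>k<2 ^ n. integral {?x k..?x (Suc k)} (\<lambda>t. limit_function t * \<eta> t))"
      using integral_uniform_partition[OF c, of "2 ^ n" n] by simp
    then have "norm ((\<Sum>k<2 ^ n. A n k * (l / 2 ^ n * \<eta> (?x k))) - integral {0..l} (\<lambda>t. limit_function t * \<eta> t))
        = \<bar>\<Sum>k<2 ^ n. A n k * (l / 2 ^ n * \<eta> (?x k)) - integral {?x k..?x (Suc k)} (\<lambda>t. limit_function t * \<eta> t)\<bar>"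
      by (simp add: sum_subtractf)
    also have "\<dots> \<le> (\<Sum>k<2 ^ n. \<bar>A n k * (l / 2 ^ n * \<eta> (?x k)) - integral {?x k..?x (Suc k)} (\<lambda>t. limit_function t * \<eta> t)\<bar>)"
      by (rule sum_abs)
    also have "\<dots> \<le> (\<Sum>k<(2::nat) ^ n. \<epsilon> * (\<bar>B1\<bar> + \<bar>B2\<bar>) * (l / 2 ^ n))"
      by (intro sum_mono cell) simp
    also have "\<dots> = \<epsilon> * (\<bar>B1\<bar> + \<bar>B2\<bar>) * l" by simp
    also have "\<dots> < e"
    proof -
      have "\<epsilon> * (\<bar>B1\<bar> + \<bar>B2\<bar>) * l \<le> \<epsilon> * (\<bar>B1\<bar> + \<bar>B2\<bar> + 1) * l"
        using \<epsilon> l_pos by (intro mult_right_mono mult_left_mono) auto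
      also have "\<dots> = e / 2"
      proof -
        have "e / (2 * l * S) * S * l = e / 2" if "0 < S" for S
          using that l_pos by (simp add: field_simps)
        moreover have "0 < \<bar>B1\<bar> + \<bar>B2\<bar> + 1" by linarith
        ultimately show ?thesis unfolding \<epsilon>_def by blast
      qed
      finally show ?thesis using e by simp
    qed
    finally show ?thesis .
  qed
  then show "\<exists>N. \<forall>n\<ge>N. norm ((\<Sum>k<2 ^ n. A n k * (l / 2 ^ n * \<eta> (l * real k / 2 ^ n))) - integral {0..l} (\<lambda>t. limit_function t * \<eta> t)) < e"
    by blast
qed

end


section \<open>Functions with prescribed square summable coefficients\<close>

context graph_eigenbasis
begin

text \<open>
  The pairing of \<open>\<psi>\<close> with the formal series \<open>\<Sum>i. c i * \<phi> i\<close>.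
\<close>

definition series_functional :: "(nat \<Rightarrow> real) \<Rightarrow> ('e \<Rightarrow> real \<Rightarrow> real) \<Rightarrow> real" where
  "series_functional c \<psi> = (\<Sum>i. c i * L2_inner G \<psi> (\<phi> i))"

lemma coefficients_summable:
  assumes "\<psi> \<in> graph_L2 G" shows "summable (\<lambda>i. (L2_inner G \<psi> (\<phi> i))\<^sup>2)"
  using Bessel_inequality[OF assms] by (intro summableI_nonneg_bounded) auto

lemma series_functional_summable:
  assumes "summable (\<lambda>i. (c i)\<^sup>2)" "\<psi> \<in> graph_L2 G"
  shows "summable (\<lambda>i. c i * L2_inner G \<psi> (\<phi> i))"
proof (rule summable_comparison_test')
  show "summable (\<lambda>i. (c i)\<^sup>2 + (L2_inner G \<psi> (\<phi> i))\<^sup>2)"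
    by (intro summable_add assms(1) coefficients_summable assms(2))
  show "norm (c i * L2_inner G \<psi> (\<phi> i)) \<le> (c i)\<^sup>2 + (L2_inner G \<psi> (\<phi> i))\<^sup>2" for i
    using abs_mult_le_power2_sum by simp
qed

lemma series_functional_tendsto:
  assumes "summable (\<lambda>i. (c i)\<^sup>2)" "\<psi> \<in> graph_L2 G"
  shows "(\<lambda>n. \<Sum>i<n. c i * L2_inner G \<psi> (\<phi> i)) \<longlonglongrightarrow> series_functional c \<psi>"
  using summable_LIMSEQ[OF series_functional_summable[OF assms]] by (simp add: series_functional_def)

lemma series_functional_lincomb:
  assumes c: "summable (\<lambda>i. (c i)\<^sup>2)" and f: "\<And>k. k \<in> I \<Longrightarrow> f k \<in> graph_L2 G"
  shows "series_functional c (\<lambda>e t. \<Sum>k\<in>I. x k * f k e t) = (\<Sum>k\<in>I. x k * series_functional c (f k))"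
proof -
  have "series_functional c (\<lambda>e t. \<Sum>k\<in>I. x k * f k e t) = (\<Sum>i. \<Sum>k\<in>I. x k * (c i * L2_inner G (f k) (\<phi> i)))"
    unfolding series_functional_def
    by (subst L2_inner_lincomb[OF f phi_L2]) (simp_all add: sum_distrib_left mult_ac)
  also have "\<dots> = (\<Sum>k\<in>I. \<Sum>i. x k * (c i * L2_inner G (f k) (\<phi> i)))"
    by (intro suminf_sum summable_mult series_functional_summable c f)
  also have "\<dots> = (\<Sum>k\<in>I. x k * series_functional c (f k))"
    unfolding series_functional_def
    by (intro sum.cong refl suminf_mult series_functional_summable c f)
  finally show ?thesis .
qed

lemma series_functional_diff:
  assumes c: "summable (\<lambda>i. (c i)\<^sup>2)" and fg: "f \<in> graph_L2 G" "g \<in> graph_L2 G"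
  shows "series_functional c (\<lambda>e t. f e t - g e t) = series_functional c f - series_functional c g"
  unfolding series_functional_def
  by (simp add: L2_inner_diff fg phi_L2 right_diff_distrib
      suminf_diff[OF series_functional_summable[OF c fg(1)] series_functional_summable[OF c fg(2)], symmetric])

lemma series_functional_bound:
  assumes c: "summable (\<lambda>i. (c i)\<^sup>2)" and \<psi>: "\<psi> \<in> graph_L2 G"
  shows "(series_functional c \<psi>)\<^sup>2 \<le> (\<Sum>i. (c i)\<^sup>2) * L2_inner G \<psi> \<psi>"
proof (rule LIMSEQ_le_const2)
  show "(\<lambda>n. (\<Sum>i<n. c i * L2_inner G \<psi> (\<phi> i))\<^sup>2) \<longlonglongrightarrow> (series_functional c \<psi>)\<^sup>2"
    by (intro tendsto_intros series_functional_tendsto c \<psi>)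
  have "(\<Sum>i<n. c i * L2_inner G \<psi> (\<phi> i))\<^sup>2 \<le> (\<Sum>i. (c i)\<^sup>2) * L2_inner G \<psi> \<psi>" for n
  proof -
    have "(\<Sum>i<n. c i * L2_inner G \<psi> (\<phi> i))\<^sup>2 \<le> (\<Sum>i<n. (c i)\<^sup>2) * (\<Sum>i<n. (L2_inner G \<psi> (\<phi> i))\<^sup>2)"
      by (rule Cauchy_Schwarz_ineq_sum)
    also have "\<dots> \<le> (\<Sum>i. (c i)\<^sup>2) * L2_inner G \<psi> \<psi>"
      by (intro mult_mono Bessel_inequality \<psi> sum_le_suminf c suminf_nonneg sum_nonneg) auto
    finally show ?thesis .
  qed
  then show "\<exists>N. \<forall>n\<ge>N. (\<Sum>i<n. c i * L2_inner G \<psi> (\<phi> i))\<^sup>2 \<le> (\<Sum>i. (c i)\<^sup>2) * L2_inner G \<psi> \<psi>" by blast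
qed

end

definition dyadic_cell :: "('v, 'e) metric_graph \<Rightarrow> 'e \<Rightarrow> nat \<Rightarrow> nat \<Rightarrow> 'e \<Rightarrow> real \<Rightarrow> real" where
  "dyadic_cell G e n k = cell_average e (len G e * real k / 2 ^ n) (len G e * real (Suc k) / 2 ^ n)"

definition edge_embed :: "'e \<Rightarrow> (real \<Rightarrow> real) \<Rightarrow> 'e \<Rightarrow> real \<Rightarrow> real" where
  "edge_embed e \<eta> e' t = (if e' = e then \<eta> t else 0)"

context metric_graph_space
begin

lemma is_cell_dyadic:
  assumes "e \<in> arcs G" "k < 2 ^ n"
  shows "is_cell e (len G e * real k / 2 ^ n) (len G e * real (Suc k) / 2 ^ n)"
proof -
  have "real (Suc k) \<le> 2 ^ n" using assms(2) by (metis Suc_leI of_nat_le_iff of_nat_numeral of_nat_power)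
  then show ?thesis
    using len_pos[OF assms(1)] assms(1)
    by (auto simp: is_cell_def pos_divide_le_eq divide_strict_right_mono simp del: of_nat_Suc)
qed

lemma dyadic_cell_L2: "e \<in> arcs G \<Longrightarrow> k < 2 ^ n \<Longrightarrow> dyadic_cell G e n k \<in> graph_L2 G"
  unfolding dyadic_cell_def by (intro cell_average_L2 is_cell_dyadic)

lemma edge_embed_L2:
  assumes "e \<in> arcs G" "continuous_on {0..len G e} \<eta>" shows "edge_embed e \<eta> \<in> graph_L2 G"
proof (rule graph_L2_continuous)
  fix e' assume "e' \<in> arcs G"
  show "continuous_on {0..len G e'} (edge_embed e \<eta> e')"
    using assms(2) by (cases "e' = e") (simp_all add: edge_embed_def)
qed

lemma edge_embed_inner:
  assumes "e \<in> arcs G"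
  shows "L2_inner G f (edge_embed e \<eta>) = (LINT t|lebesgue_on {0..len G e}. f e t * \<eta> t)"
proof -
  have "L2_inner G f (edge_embed e \<eta>) =
      (\<Sum>e'\<in>arcs G. if e' = e then LINT t|lebesgue_on {0..len G e}. f e t * \<eta> t else 0)"
    unfolding L2_inner_def by (intro sum.cong refl) (auto simp: edge_embed_def)
  then show ?thesis using assms by simp
qed

lemma dyadic_cell_refine:
  assumes "e \<in> arcs G"
  shows "dyadic_cell G e n k e' t = (1/2) * dyadic_cell G e (Suc n) (2 * k) e' t + (1/2) * dyadic_cell G e (Suc n) (2 * k + 1) e' t"
proof -
  let ?l = "len G e"
  let ?h = "?l / 2 ^ Suc n"
  define a where "a = ?l * real k / 2 ^ n"
  have h: "0 < ?h" using len_pos[OF assms] by simp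
  have eq: "?l * real (Suc k) / 2 ^ n = a + 2 * ?h" "?l * real (2 * k) / 2 ^ Suc n = a"
    "?l * real (Suc (2 * k)) / 2 ^ Suc n = a + ?h" "?l * real (Suc (2 * k + 1)) / 2 ^ Suc n = a + 2 * ?h"
    "?l * real (2 * k + 1) / 2 ^ Suc n = a + ?h"
    by (simp_all add: a_def field_simps)
  have w: "a + 2 * ?h - a = 2 * ?h" "a + 2 * ?h - (a + ?h) = ?h" "a + ?h - a = ?h" by simp_all
  show ?thesis
    unfolding dyadic_cell_def eq a_def[symmetric] cell_average_def w using h by auto
qed

text \<open>
  The step function with value \<open>\<eta>\<close> at the left endpoint of each cell. It vanishes at the end of
  the edge, where a test function vanishes as well.
\<close>

definition step_approx :: "'e \<Rightarrow> nat \<Rightarrow> (real \<Rightarrow> real) \<Rightarrow> 'e \<Rightarrow> real \<Rightarrow> real" where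
  "step_approx e n \<eta> e' t =
     (\<Sum>k<2 ^ n. (len G e / 2 ^ n * \<eta> (len G e * real k / 2 ^ n)) * dyadic_cell G e n k e' t)"

lemma step_approx_L2: "e \<in> arcs G \<Longrightarrow> step_approx e n \<eta> \<in> graph_L2 G"
  unfolding step_approx_def by (intro graph_L2_sum graph_L2_scale dyadic_cell_L2) auto

lemma step_approx_other: "e' \<noteq> e \<Longrightarrow> step_approx e n \<eta> e' t = 0"
  by (simp add: step_approx_def dyadic_cell_def cell_average_def)

lemma step_approx_end: "e \<in> arcs G \<Longrightarrow> step_approx e n \<eta> e (len G e) = 0"
  unfolding step_approx_def
proof (intro sum.neutral ballI)
  fix k assume e: "e \<in> arcs G" and "k \<in> {..<(2::nat) ^ n}"
  then have "is_cell e (len G e * real k / 2 ^ n) (len G e * real (Suc k) / 2 ^ n)"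
    by (intro is_cell_dyadic) auto
  then show "len G e / 2 ^ n * \<eta> (len G e * real k / 2 ^ n) * dyadic_cell G e n k e (len G e) = 0"
    by (simp add: dyadic_cell_def cell_average_def is_cell_def)
qed

lemma step_approx_interior:
  assumes e: "e \<in> arcs G" and t: "0 \<le> t" "t < len G e"
  shows "step_approx e n \<eta> e t = \<eta> (len G e * real (cell_index (len G e) n t) / 2 ^ n)"
proof -
  let ?l = "len G e" and ?i = "cell_index (len G e) n t"
  have l: "0 < ?l" using len_pos[OF e] .
  have t01: "t \<in> {0..?l}" using t by auto
  have iff: "t \<in> {?l * real k / 2 ^ n..<?l * real (Suc k) / 2 ^ n} \<longleftrightarrow> k = ?i" for k
  proof
    assume "t \<in> {?l * real k / 2 ^ n..<?l * real (Suc k) / 2 ^ n}"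
    then have "real k \<le> t / ?l * 2 ^ n" "t / ?l * 2 ^ n < real k + 1"
      using l by (simp_all add: field_simps)
    then have "\<lfloor>t / ?l * 2 ^ n\<rfloor> = int k" by (intro floor_unique) auto
    then show "k = ?i" using cell_index_eq_floor[OF l t] by simp
  next
    assume "k = ?i"
    then show "t \<in> {?l * real k / 2 ^ n..<?l * real (Suc k) / 2 ^ n}"
      using cell_index_in_cell(1,3)[OF l t01, of n] t(2) by auto
  qed
  have w: "?l * real (Suc k) / 2 ^ n - ?l * real k / 2 ^ n = ?l / 2 ^ n" for k
    by (simp add: field_simps)
  have "step_approx e n \<eta> e t = (\<Sum>k<2 ^ n. if k = ?i then \<eta> (?l * real k / 2 ^ n) else 0)"
    unfolding step_approx_def
  proof (intro sum.cong refl)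
    fix k
    show "?l / 2 ^ n * \<eta> (?l * real k / 2 ^ n) * dyadic_cell G e n k e t = (if k = ?i then \<eta> (?l * real k / 2 ^ n) else 0)"
      unfolding dyadic_cell_def cell_average_def iff w using l by simp
  qed
  also have "\<dots> = \<eta> (?l * real ?i / 2 ^ n)" using cell_index_less[of ?l n t] by simp
  finally show ?thesis .
qed

lemma step_approx_uniform:
  assumes e: "e \<in> arcs G" and \<eta>: "continuous_on {0..len G e} \<eta>" "\<eta> (len G e) = 0" and \<epsilon>: "0 < \<epsilon>"
  obtains N where "\<And>n t. n \<ge> N \<Longrightarrow> t \<in> {0..len G e} \<Longrightarrow> \<bar>\<eta> t - step_approx e n \<eta> e t\<bar> \<le> \<epsilon>"
proof -
  let ?l = "len G e"
  have l: "0 < ?l" using len_pos[OF e] .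
  have "uniformly_continuous_on {0..?l} \<eta>" using \<eta> by (intro compact_uniformly_continuous) auto
  then obtain d where d: "0 < d" "\<And>s t. s \<in> {0..?l} \<Longrightarrow> t \<in> {0..?l} \<Longrightarrow> dist s t < d \<Longrightarrow> dist (\<eta> s) (\<eta> t) < \<epsilon>"
    unfolding uniformly_continuous_on_def using \<epsilon> by metis
  have "(\<lambda>n. ?l * (1 / 2) ^ n) \<longlonglongrightarrow> ?l * 0" by (intro tendsto_intros LIMSEQ_power_zero) simp
  from order_tendstoD(2)[OF this, of d] d(1)
  obtain N where N: "\<And>n. n \<ge> N \<Longrightarrow> ?l * (1 / 2) ^ n < d" by (auto simp: eventually_sequentially)
  have "\<bar>\<eta> t - step_approx e n \<eta> e t\<bar> \<le> \<epsilon>" if n: "n \<ge> N" and t: "t \<in> {0..?l}" for n t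
  proof (cases "t = ?l")
    case True
    then show ?thesis using \<eta>(2) \<epsilon> by (simp add: step_approx_end e)
  next
    case False
    then have t': "0 \<le> t" "t < ?l" using t by auto
    let ?x = "?l * real (cell_index ?l n t) / 2 ^ n"
    have x: "?x \<le> t" "t \<le> ?x + ?l / 2 ^ n"
      using cell_index_in_cell(1,2)[OF l t, of n] by (simp_all add: field_simps)
    have "?l / 2 ^ n < d" using N[OF n] by (simp add: power_one_over)
    then have "dist t ?x < d" unfolding dist_real_def using x by linarith
    moreover have "?x \<in> {0..?l}" using x(1) t l by auto
    ultimately have "dist (\<eta> t) (\<eta> ?x) < \<epsilon>" using d(2) t by blast
    then show ?thesis by (simp add: step_approx_interior[OF e t'] dist_real_def)
  qed
  then show ?thesis by (rule that)
qed

definition total_length :: real where "total_length = (\<Sum>e\<in>arcs G. len G e)"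

lemma L2_inner_le_sup:
  assumes "f \<in> graph_L2 G" "\<And>e t. e \<in> arcs G \<Longrightarrow> t \<in> {0..len G e} \<Longrightarrow> \<bar>f e t\<bar> \<le> \<epsilon>"
  shows "L2_inner G f f \<le> \<epsilon>\<^sup>2 * total_length"
proof -
  have "(LINT t|lebesgue_on {0..len G e}. f e t * f e t) \<le> \<epsilon>\<^sup>2 * len G e" if e: "e \<in> arcs G" for e
  proof -
    have "(LINT t|lebesgue_on {0..len G e}. f e t * f e t) \<le> (LINT t|lebesgue_on {0..len G e}. \<epsilon>\<^sup>2)"
    proof (rule integral_mono)
      fix t assume "t \<in> space (lebesgue_on {0..len G e})"
      then have "\<bar>f e t\<bar>\<^sup>2 \<le> \<epsilon>\<^sup>2" using assms(2)[OF e] by (intro power_mono) auto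
      then show "f e t * f e t \<le> \<epsilon>\<^sup>2" by (simp add: power2_eq_square)
    next
      show "integrable (lebesgue_on {0..len G e}) (\<lambda>t. f e t * f e t)"
        by (rule graph_L2_mult_integrable[OF assms(1) assms(1) e])
      show "integrable (lebesgue_on {0..len G e}) (\<lambda>t. \<epsilon>\<^sup>2)"
        by (intro integrable_continuous_interval_on continuous_intros)
    qed
    also have "\<dots> = \<epsilon>\<^sup>2 * len G e"
      using LINT_continuous_eq_integral[of "len G e" "\<lambda>_. \<epsilon>\<^sup>2"] len_pos[OF e] by simp
    finally show ?thesis .
  qed
  then have "L2_inner G f f \<le> (\<Sum>e\<in>arcs G. \<epsilon>\<^sup>2 * len G e)"
    unfolding L2_inner_def by (rule sum_mono)
  then show ?thesis by (simp add: total_length_def sum_distrib_left)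
qed

end

context graph_eigenbasis
begin

lemma series_functional_step_approx_tendsto:
  assumes c: "summable (\<lambda>i. (c i)\<^sup>2)" and e: "e \<in> arcs G"
    and \<eta>: "continuous_on {0..len G e} \<eta>" "\<eta> (len G e) = 0"
  shows "(\<lambda>n. series_functional c (step_approx e n \<eta>)) \<longlonglongrightarrow> series_functional c (edge_embed e \<eta>)"
proof -
  define S where "S = (\<Sum>i. (c i)\<^sup>2) * total_length"
  have S0: "0 \<le> S"
    unfolding S_def total_length_def using len_pos c
    by (intro mult_nonneg_nonneg suminf_nonneg sum_nonneg) (auto simp: less_imp_le)
  define d where "d n = series_functional c (edge_embed e \<eta>) - series_functional c (step_approx e n \<eta>)" for n
  have "(\<lambda>n. (d n)\<^sup>2) \<longlonglongrightarrow> 0"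
  proof (rule LIMSEQ_I)
    fix r :: real assume r: "0 < r"
    (* a uniform error epsilon changes the functional by at most epsilon * sqrt S *)
    define \<epsilon> where "\<epsilon> = sqrt (r / (2 * (S + 1)))"
    have \<epsilon>: "0 < \<epsilon>" "\<epsilon>\<^sup>2 = r / (2 * (S + 1))" using r S0 by (simp_all add: \<epsilon>_def)
    obtain N where N: "\<And>n t. n \<ge> N \<Longrightarrow> t \<in> {0..len G e} \<Longrightarrow> \<bar>\<eta> t - step_approx e n \<eta> e t\<bar> \<le> \<epsilon>"
      using step_approx_uniform[OF e \<eta> \<epsilon>(1)] by blast
    have "norm ((d n)\<^sup>2 - 0) < r" if n: "n \<ge> N" for n
    proof -
      let ?D = "\<lambda>e' t. edge_embed e \<eta> e' t - step_approx e n \<eta> e' t"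
      have D: "?D \<in> graph_L2 G" by (intro graph_L2_diff edge_embed_L2 step_approx_L2 e \<eta>)
      have "L2_inner G ?D ?D \<le> \<epsilon>\<^sup>2 * total_length"
      proof (rule L2_inner_le_sup[OF D])
        fix e' t assume "e' \<in> arcs G" "t \<in> {0..len G e'}"
        then show "\<bar>?D e' t\<bar> \<le> \<epsilon>"
          using N[OF n, of t] \<epsilon>(1) by (cases "e' = e") (auto simp: edge_embed_def step_approx_other)
      qed
      then have "(\<Sum>i. (c i)\<^sup>2) * L2_inner G ?D ?D \<le> (\<Sum>i. (c i)\<^sup>2) * (\<epsilon>\<^sup>2 * total_length)"
        using c by (intro mult_left_mono suminf_nonneg) auto
      moreover have "d n = series_functional c ?D"
        unfolding d_def by (rule series_functional_diff[symmetric]) (intro c edge_embed_L2 step_approx_L2 e \<eta>)+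
      ultimately have "(d n)\<^sup>2 \<le> \<epsilon>\<^sup>2 * S"
        using series_functional_bound[OF c D] by (simp add: S_def mult_ac)
      also have "\<dots> \<le> \<epsilon>\<^sup>2 * (S + 1)" by (intro mult_left_mono) auto
      also have "\<dots> = r / 2"
      proof -
        have "r / (2 * s) * s = r / 2" if "0 < s" for s using that by simp
        moreover have "0 < S + 1" using S0 by linarith
        ultimately show ?thesis unfolding \<epsilon>(2) by blast
      qed
      finally show ?thesis using r by simp
    qed
    then show "\<exists>N. \<forall>n\<ge>N. norm ((d n)\<^sup>2 - 0) < r" by blast
  qed
  then have "(\<lambda>n. sqrt ((d n)\<^sup>2)) \<longlonglongrightarrow> sqrt 0" by (rule tendsto_real_sqrt)
  then have "d \<longlonglongrightarrow> 0" by (simp add: tendsto_rabs_zero_iff)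
  then have "(\<lambda>n. series_functional c (edge_embed e \<eta>) - d n) \<longlonglongrightarrow> series_functional c (edge_embed e \<eta>) - 0"
    by (intro tendsto_intros)
  then show ?thesis by (simp add: d_def)
qed

definition level_touching :: "nat \<Rightarrow> 'e \<Rightarrow> nat \<Rightarrow> 'e \<Rightarrow> nat \<Rightarrow> bool" where
  "level_touching n e k e' k' \<longleftrightarrow> e \<in> arcs G \<and> e' \<in> arcs G \<and> k < 2 ^ n \<and> k' < 2 ^ n \<and>
     touching e (len G e * real k / 2 ^ n) (len G e * real (Suc k) / 2 ^ n)
       e' (len G e' * real k' / 2 ^ n) (len G e' * real (Suc k') / 2 ^ n)"

lemma level_touching_adjacent:
  assumes "e \<in> arcs G" "Suc k < 2 ^ n" shows "level_touching n e k e (Suc k)"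
proof -
  have p: "same_point G (e, len G e * real (Suc k) / 2 ^ n) (e, len G e * real (Suc k) / 2 ^ n)"
    by (simp add: same_point_def)
  have k: "k < 2 ^ n" using assms by simp
  have "len G e * real (Suc k) / 2 ^ n \<in> {len G e * real k / 2 ^ n..len G e * real (Suc k) / 2 ^ n}"
    "len G e * real (Suc k) / 2 ^ n \<in> {len G e * real (Suc k) / 2 ^ n..len G e * real (Suc (Suc k)) / 2 ^ n}"
    using is_cell_dyadic[OF assms(1) k] is_cell_dyadic[OF assms] by (simp_all add: is_cell_def)
  then show ?thesis
    unfolding level_touching_def touching_def
    using is_cell_dyadic[OF assms(1) k] is_cell_dyadic[OF assms] assms k p by blast
qed

lemma level_touching_vertex:
  assumes "represents_vertex G v (e, s)" "represents_vertex G v (e', t)"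
  shows "level_touching n e (cell_index (len G e) n s) e' (cell_index (len G e') n t)"
proof -
  have rep: "e \<in> arcs G \<and> s \<in> {0..len G e}" if "represents_vertex G v (e, s)" for e s
    using that len_pos[of e] by (auto simp: represents_vertex_def)
  note es = conjunct1[OF rep[OF assms(1)]] conjunct2[OF rep[OF assms(1)]]
  note et = conjunct1[OF rep[OF assms(2)]] conjunct2[OF rep[OF assms(2)]]
  have "same_point G (e, s) (e', t)" using assms unfolding same_point_def by blast
  moreover have "s \<in> {len G e * real (cell_index (len G e) n s) / 2 ^ n..len G e * real (Suc (cell_index (len G e) n s)) / 2 ^ n}"
    using cell_index_in_cell(1,2)[OF len_pos[OF es(1)] es(2)] by simp
  moreover have "t \<in> {len G e' * real (cell_index (len G e') n t) / 2 ^ n..len G e' * real (Suc (cell_index (len G e') n t)) / 2 ^ n}"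
    using cell_index_in_cell(1,2)[OF len_pos[OF et(1)] et(2)] by simp
  ultimately show ?thesis
    unfolding level_touching_def touching_def
    using is_cell_dyadic[OF es(1) cell_index_less] is_cell_dyadic[OF et(1) cell_index_less] es et cell_index_less
    by blast
qed

text \<open>
  The function with coefficients \<open>c\<close> in the eigenbasis, obtained as the limit of its means over
  nested cells. These means are well defined for every square summable \<open>c\<close>.
\<close>

definition reconstruction :: "(nat \<Rightarrow> real) \<Rightarrow> 'e \<Rightarrow> real \<Rightarrow> real" where
  "reconstruction c e t = lim (\<lambda>n. series_functional c (dyadic_cell G e n (cell_index (len G e) n t)))"

text \<open>
  Kolmogorov's criterion for the averages of the formal series. Cells that touch at a vertex are
  included, so that the limits on different edges match there.
\<close>

definition regular_coeffs :: "real \<Rightarrow> real \<Rightarrow> (nat \<Rightarrow> real) \<Rightarrow> bool" where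
  "regular_coeffs \<gamma> K c \<longleftrightarrow> 0 < \<gamma> \<and> 0 \<le> K \<and> summable (\<lambda>i. (c i)\<^sup>2) \<and>
     (\<forall>n e k e' k'. level_touching n e k e' k' \<longrightarrow>
        \<bar>series_functional c (dyadic_cell G e n k) - series_functional c (dyadic_cell G e' n k')\<bar>
          \<le> K * (2 powr - \<gamma>) ^ n)"

context
  fixes c :: "nat \<Rightarrow> real" and \<gamma> K :: real
  assumes regular: "regular_coeffs \<gamma> K c"
begin

lemma regular_exponent: "0 < \<gamma>" and regular_constant: "0 \<le> K" and regular_summable: "summable (\<lambda>i. (c i)\<^sup>2)"
  using regular by (auto simp: regular_coeffs_def)

lemma regular_increments: "level_touching n e k e' k' \<Longrightarrow>
    \<bar>series_functional c (dyadic_cell G e n k) - series_functional c (dyadic_cell G e' n k')\<bar>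
      \<le> K * (2 powr - \<gamma>) ^ n"
  using regular unfolding regular_coeffs_def by blast

text \<open>
  A cell average is the mean of the averages over the two halves of the cell, and
  \<open>series_functional c\<close> is linear.
\<close>

lemma dyadic_averages_edge:
  assumes e: "e \<in> arcs G"
  shows "dyadic_averages (len G e) \<gamma> K (\<lambda>n k. series_functional c (dyadic_cell G e n k))"
proof
  fix k n :: nat
  show "\<bar>series_functional c (dyadic_cell G e n k) - series_functional c (dyadic_cell G e n (Suc k))\<bar> \<le> K * (2 powr - \<gamma>) ^ n"
    if "Suc k < 2 ^ n" by (intro regular_increments level_touching_adjacent e that)
  assume k: "k < 2 ^ n"
  define I where "I = {2 * k, 2 * k + 1}"
  have "dyadic_cell G e n k = (\<lambda>e' t. \<Sum>j\<in>I. (1/2) * dyadic_cell G e (Suc n) j e' t)"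
    by (intro ext) (simp add: I_def dyadic_cell_refine[OF e, of n k])
  then have "series_functional c (dyadic_cell G e n k) =
      series_functional c (\<lambda>e' t. \<Sum>j\<in>I. (1/2) * dyadic_cell G e (Suc n) j e' t)" by simp
  also have "\<dots> = (\<Sum>j\<in>I. (1/2) * series_functional c (dyadic_cell G e (Suc n) j))"
    using k by (intro series_functional_lincomb regular_summable dyadic_cell_L2 e) (auto simp: I_def)
  also have "\<dots> = (series_functional c (dyadic_cell G e (Suc n) (2 * k)) +
      series_functional c (dyadic_cell G e (Suc n) (2 * k + 1))) / 2"
    by (simp add: I_def)
  finally show "series_functional c (dyadic_cell G e n k) = (series_functional c (dyadic_cell G e (Suc n) (2 * k)) +
      series_functional c (dyadic_cell G e (Suc n) (2 * k + 1))) / 2" .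
qed (use len_pos[OF e] regular_exponent regular_constant in auto)

lemma reconstruction_limit_function:
  assumes e: "e \<in> arcs G"
  shows "reconstruction c e = dyadic_averages.limit_function (len G e) (\<lambda>n k. series_functional c (dyadic_cell G e n k))"
  by (intro ext) (simp add: reconstruction_def dyadic_averages.limit_function_def[OF dyadic_averages_edge[OF e]])

lemma reconstruction_continuous: "e \<in> arcs G \<Longrightarrow> continuous_on {0..len G e} (reconstruction c e)"
  unfolding reconstruction_limit_function
  by (rule dyadic_averages.limit_function_continuous[OF dyadic_averages_edge])

lemma reconstruction_holder:
  obtains C where "0 \<le> C"
    "\<And>e s t. e \<in> arcs G \<Longrightarrow> s \<in> {0..len G e} \<Longrightarrow> t \<in> {0..len G e} \<Longrightarrow>
      \<bar>reconstruction c e s - reconstruction c e t\<bar> \<le> C * \<bar>s - t\<bar> powr \<gamma>"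
proof -
  have ex: "\<exists>C. \<forall>s\<in>{0..len G e}. \<forall>t\<in>{0..len G e}. \<bar>reconstruction c e s - reconstruction c e t\<bar> \<le> C * \<bar>s - t\<bar> powr \<gamma>"
    if "e \<in> arcs G" for e
    unfolding reconstruction_limit_function[OF that]
    using dyadic_averages.limit_function_holder[OF dyadic_averages_edge[OF that]] by blast
  then obtain C where C: "\<And>e s t. e \<in> arcs G \<Longrightarrow> s \<in> {0..len G e} \<Longrightarrow> t \<in> {0..len G e} \<Longrightarrow>
      \<bar>reconstruction c e s - reconstruction c e t\<bar> \<le> C e * \<bar>s - t\<bar> powr \<gamma>"
    by metis
  show ?thesis
  proof (rule that[of "\<Sum>e\<in>arcs G. \<bar>C e\<bar>"])
    fix e s t assume e: "e \<in> arcs G" "s \<in> {0..len G e}" "t \<in> {0..len G e}"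
    have "C e \<le> (\<Sum>e\<in>arcs G. \<bar>C e\<bar>)"
      using member_le_sum[of e "arcs G" "\<lambda>e. \<bar>C e\<bar>"] e(1) by simp
    then have "C e * \<bar>s - t\<bar> powr \<gamma> \<le> (\<Sum>e\<in>arcs G. \<bar>C e\<bar>) * \<bar>s - t\<bar> powr \<gamma>"
      by (rule mult_right_mono) simp
    with C[OF e] show "\<bar>reconstruction c e s - reconstruction c e t\<bar> \<le> (\<Sum>e\<in>arcs G. \<bar>C e\<bar>) * \<bar>s - t\<bar> powr \<gamma>"
      by linarith
  qed (simp add: sum_nonneg)
qed

lemma reconstruction_vertex:
  assumes "represents_vertex G v (e, s)" "represents_vertex G v (e', t)"
  shows "reconstruction c e s = reconstruction c e' t"
proof -
  have rep: "e \<in> arcs G \<and> s \<in> {0..len G e}" if "represents_vertex G v (e, s)" for e s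
    using that len_pos[of e] by (auto simp: represents_vertex_def)
  have lim: "(\<lambda>n. series_functional c (dyadic_cell G e n (cell_index (len G e) n s))) \<longlonglongrightarrow> reconstruction c e s"
    if "represents_vertex G v (e, s)" for e s
    using dyadic_averages.averages_tendsto[OF dyadic_averages_edge conjunct2[OF rep[OF that]]] rep[OF that]
    by (simp add: reconstruction_limit_function)
  have "(\<lambda>n. series_functional c (dyadic_cell G e n (cell_index (len G e) n s)) -
      series_functional c (dyadic_cell G e' n (cell_index (len G e') n t))) \<longlonglongrightarrow> 0"
  proof (rule Lim_null_comparison)
    show "\<forall>\<^sub>F n in sequentially. norm (series_functional c (dyadic_cell G e n (cell_index (len G e) n s)) -
        series_functional c (dyadic_cell G e' n (cell_index (len G e') n t))) \<le> K * (2 powr - \<gamma>) ^ n"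
      using regular_increments[OF level_touching_vertex[OF assms]] by simp
    have "2 powr - \<gamma> < 1" using regular_exponent powr_less_mono[of "- \<gamma>" 0 2] by simp
    then have "(\<lambda>n. K * (2 powr - \<gamma>) ^ n) \<longlonglongrightarrow> K * 0"
      by (intro tendsto_intros LIMSEQ_power_zero) simp
    then show "(\<lambda>n. K * (2 powr - \<gamma>) ^ n) \<longlonglongrightarrow> 0" by simp
  qed
  moreover have "(\<lambda>n. series_functional c (dyadic_cell G e n (cell_index (len G e) n s)) -
      series_functional c (dyadic_cell G e' n (cell_index (len G e') n t))) \<longlonglongrightarrow> reconstruction c e s - reconstruction c e' t"
    by (intro tendsto_intros lim assms)
  ultimately have "reconstruction c e s - reconstruction c e' t = 0" by (rule LIMSEQ_unique[symmetric])
  then show ?thesis by simp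
qed

text \<open>
  Both sides are limits of the same Riemann sums: on the right, because step functions approximate
  \<open>\<eta>\<close> in \<open>L\<^sub>2\<close> and \<open>series_functional c\<close> is bounded there.
\<close>

lemma reconstruction_moments:
  assumes e: "e \<in> arcs G" and \<eta>: "continuous_on {0..len G e} \<eta>" "\<eta> (len G e) = 0"
  shows "integral {0..len G e} (\<lambda>t. reconstruction c e t * \<eta> t) = series_functional c (edge_embed e \<eta>)"
proof -
  have "series_functional c (step_approx e n \<eta>) =
      (\<Sum>k<2 ^ n. series_functional c (dyadic_cell G e n k) * (len G e / 2 ^ n * \<eta> (len G e * real k / 2 ^ n)))" for n
  proof -
    have "series_functional c (step_approx e n \<eta>) =
      (\<Sum>k<2 ^ n. (len G e / 2 ^ n * \<eta> (len G e * real k / 2 ^ n)) * series_functional c (dyadic_cell G e n k))"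
      unfolding step_approx_def[abs_def]
      by (rule series_functional_lincomb[OF regular_summable]) (simp add: dyadic_cell_L2 e)
    then show ?thesis by (simp add: mult.commute)
  qed
  then have "(\<lambda>n. series_functional c (step_approx e n \<eta>)) \<longlonglongrightarrow> integral {0..len G e} (\<lambda>t. reconstruction c e t * \<eta> t)"
    using dyadic_averages.riemann_sums_tendsto_integral[OF dyadic_averages_edge[OF e] \<eta>(1)]
    by (simp add: reconstruction_limit_function[OF e])
  then show ?thesis
    using series_functional_step_approx_tendsto[OF regular_summable e \<eta>] by (rule LIMSEQ_unique)
qed

end

end


section \<open>Hoelder continuity with respect to the path distance\<close>

context metric_graph_space
begin

lemma represents_vertex_point:
  assumes "represents_vertex G v (e, t)" shows "e \<in> arcs G" "(e, t) \<in> points G" "t = 0 \<or> t = len G e"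
  using assms len_pos[of e] by (auto simp: represents_vertex_def points_def)

lemma represents_vertex_unique:
  "represents_vertex G v (e, t) \<Longrightarrow> represents_vertex G w (e, t) \<Longrightarrow> v = w"
  using len_pos[of e] by (auto simp: represents_vertex_def)

lemma path_length_nonneg: "path_length G p q a \<Longrightarrow> 0 \<le> a"
  by (induction rule: path_length.induct) auto

definition near :: "'e \<times> real \<Rightarrow> 'e \<times> real \<Rightarrow> real \<Rightarrow> bool" where
  "near p q a \<longleftrightarrow> fst p = fst q \<and> \<bar>snd p - snd q\<bar> \<le> a \<or>
     (\<exists>v x y. represents_vertex G v (fst p, x) \<and> represents_vertex G v (fst q, y) \<and> \<bar>snd p - x\<bar> + \<bar>snd q - y\<bar> \<le> a)"

text \<open>
  A path shorter than every edge cannot reach two different vertices, so it stays in one edge or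
  passes through a single vertex.
\<close>

lemma short_path_near:
  assumes "path_length G p q a" "a < \<epsilon>" "\<And>e. e \<in> arcs G \<Longrightarrow> \<epsilon> \<le> len G e"
  shows "near p q a"
  using assms(1,2)
proof (induction rule: path_length.induct)
  case (segment e s t)
  then show ?case by (simp add: near_def)
next
  case (same_vertex v p q)
  then show ?case
    unfolding near_def by (intro disjI2 exI[of _ v] exI[of _ "snd p"] exI[of _ "snd q"]) simp
next
  case (join p q a r b)
  have "0 \<le> a" "0 \<le> b" using join.hyps by (auto intro: path_length_nonneg)
  then have IH: "near p q a" "near q r b" using join.IH join.prems by auto
  consider (ee) "fst p = fst q" "\<bar>snd p - snd q\<bar> \<le> a" "fst q = fst r" "\<bar>snd q - snd r\<bar> \<le> b"
    | (ev) v x y where "fst p = fst q" "\<bar>snd p - snd q\<bar> \<le> a" "represents_vertex G v (fst q, x)"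
        "represents_vertex G v (fst r, y)" "\<bar>snd q - x\<bar> + \<bar>snd r - y\<bar> \<le> b"
    | (ve) v x y where "fst q = fst r" "\<bar>snd q - snd r\<bar> \<le> b" "represents_vertex G v (fst p, x)"
        "represents_vertex G v (fst q, y)" "\<bar>snd p - x\<bar> + \<bar>snd q - y\<bar> \<le> a"
    | (vv) v x y w x' y' where "represents_vertex G v (fst p, x)"
        "represents_vertex G v (fst q, y)" "\<bar>snd p - x\<bar> + \<bar>snd q - y\<bar> \<le> a"
        "represents_vertex G w (fst q, x')"
        "represents_vertex G w (fst r, y')" "\<bar>snd q - x'\<bar> + \<bar>snd r - y'\<bar> \<le> b"
    using IH unfolding near_def by metis
  then show ?case
  proof cases
    case ee
    have "\<bar>snd p - snd r\<bar> \<le> a + b" using ee(2,4) by linarith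
    then show ?thesis using ee unfolding near_def by simp
  next
    case ev
    have "\<bar>snd p - x\<bar> + \<bar>snd r - y\<bar> \<le> a + b" using ev(2,5) by linarith
    then show ?thesis using ev unfolding near_def by metis
  next
    case ve
    have "\<bar>snd p - x\<bar> + \<bar>snd r - y\<bar> \<le> a + b" using ve(2,5) by linarith
    then show ?thesis using ve unfolding near_def by metis
  next
    case vv
    have y: "y = 0 \<or> y = len G (fst q)" and x': "x' = 0 \<or> x' = len G (fst q)" and e: "fst q \<in> arcs G"
      using vv(2,4) represents_vertex_point by blast+
    have "\<bar>y - x'\<bar> \<le> a + b" using vv(3,6) by linarith
    also have "a + b < len G (fst q)" using join.prems assms(3)[OF e] by linarith
    finally have "y = x'" using x' y by auto
    then have "v = w" using vv(2,4) represents_vertex_unique by blast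
    moreover have "\<bar>snd p - x\<bar> + \<bar>snd r - y'\<bar> \<le> a + b" using vv(3,6) by linarith
    ultimately show ?thesis using vv(1,5) unfolding near_def by metis
  qed
qed

text \<open>
  Induction along a path in the underlying undirected graph, each of whose arcs is traversed by one
  segment. Connectedness enters here: it makes the infimum that defines the distance one over a
  nonempty set.
\<close>

lemma path_between_vertices:
  assumes "v \<in> verts G" "w \<in> verts G"
    and "represents_vertex G v p" "represents_vertex G w q"
  shows "\<exists>a. path_length G p q a"
proof -
  let ?H = "pre_digraph.truncate G"
  have "Digraph_Component.connected ?H" using compact_graph by (simp add: compact_metric_graph_def)
  then have "reachable (with_proj (mk_symmetric ?H)) v w"
    using assms(1,2) by (simp add: Digraph_Component.connected_def strongly_connected_def pre_digraph.defs)
  then have "\<forall>q. represents_vertex G w q \<longrightarrow> (\<exists>a. path_length G p q a)"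
    unfolding reachable_def
  proof (induction rule: rtrancl_on_induct)
    case base
    show ?case
    proof (intro allI impI)
      fix q assume q: "represents_vertex G v q"
      have "path_length G p q 0" by (rule path_length.same_vertex[OF assms(3) q])
      then show "\<exists>a. path_length G p q a" by blast
    qed
  next
    case (step x y)
    note IH = step.IH
    show ?case
    proof (intro allI impI)
      fix q assume q: "represents_vertex G y q"
      have "(x, y) \<in> parcs (mk_symmetric ?H)" using step.hyps(2) by simp
      then obtain e where e: "e \<in> arcs G" "(x, y) = (tail G e, head G e) \<or> (x, y) = (head G e, tail G e)"
        by (auto simp: parcs_mk_symmetric pre_digraph.defs)
      obtain s t where st: "represents_vertex G x (e, s)" "represents_vertex G y (e, t)"
        using e by (auto simp: represents_vertex_def)
      obtain a where "path_length G p (e, s) a" using IH st(1) by blast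
      moreover have "path_length G (e, s) (e, t) \<bar>s - t\<bar>"
        by (rule path_length.segment) (use st represents_vertex_point in blast)+
      moreover have "path_length G (e, t) q 0" by (rule path_length.same_vertex[OF st(2) q])
      ultimately show "\<exists>a. path_length G p q a" by (meson path_length.join)
    qed
  qed
  then show ?thesis using assms(4) by blast
qed

lemma path_exists:
  assumes "(e, s) \<in> points G" "(e', t) \<in> points G" shows "\<exists>a. path_length G (e, s) (e', t) a"
proof -
  have e: "e \<in> arcs G" "e' \<in> arcs G" using assms by (auto simp: points_def)
  have rep: "represents_vertex G (tail G e) (e, 0)" "represents_vertex G (tail G e') (e', 0)"
    using e by (auto simp: represents_vertex_def)
  obtain a where "path_length G (e, 0) (e', 0) a"
    using path_between_vertices[OF tail_head_verts(1)[OF e(1)] tail_head_verts(1)[OF e(2)] rep] by blast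
  moreover have "path_length G (e, s) (e, 0) \<bar>s - 0\<bar>" "path_length G (e', 0) (e', t) \<bar>0 - t\<bar>"
    using assms rep[THEN represents_vertex_point(2)] by (auto intro: path_length.segment simp del: diff_0 diff_0_right diff_zero)
  ultimately show ?thesis by (meson path_length.join)
qed

text \<open>
  Short paths cross at most one vertex, so two edgewise estimates suffice; for paths longer than the
  shortest edge the boundedness of \<open>f\<close> is enough.
\<close>

lemma graph_holder_if_edgewise:
  assumes gamma: "0 < \<gamma>" and C: "0 \<le> C"
    and holder: "\<And>e s t. e \<in> arcs G \<Longrightarrow> s \<in> {0..len G e} \<Longrightarrow> t \<in> {0..len G e} \<Longrightarrow>
      \<bar>f e s - f e t\<bar> \<le> C * \<bar>s - t\<bar> powr \<gamma>"
    and cont: "\<And>e. e \<in> arcs G \<Longrightarrow> continuous_on {0..len G e} (f e)"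
    and vertex: "\<And>v e s e' t. represents_vertex G v (e, s) \<Longrightarrow> represents_vertex G v (e', t) \<Longrightarrow> f e s = f e' t"
  shows "graph_holder G \<gamma> f"
proof -
  have "\<forall>e\<in>arcs G. \<exists>B. \<forall>t\<in>{0..len G e}. \<bar>f e t\<bar> \<le> B"
  proof
    fix e assume "e \<in> arcs G"
    from compact_continuous_image[OF cont[OF this]] have "bounded (f e ` {0..len G e})"
      by (auto intro: compact_imp_bounded)
    then show "\<exists>B. \<forall>t\<in>{0..len G e}. \<bar>f e t\<bar> \<le> B" unfolding bounded_real by blast
  qed
  then obtain B' where B': "\<And>e t. e \<in> arcs G \<Longrightarrow> t \<in> {0..len G e} \<Longrightarrow> \<bar>f e t\<bar> \<le> B' e" by metis
  define B where "B = (\<Sum>e\<in>arcs G. \<bar>B' e\<bar>)"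
  have B: "\<bar>f e t\<bar> \<le> B" if "e \<in> arcs G" "t \<in> {0..len G e}" for e t
    using B'[OF that] member_le_sum[of e "arcs G" "\<lambda>e. \<bar>B' e\<bar>"] that(1) by (simp add: B_def)
  have B0: "0 \<le> B" unfolding B_def by (intro sum_nonneg) auto
  define \<epsilon> where "\<epsilon> = Min (insert 1 (len G ` arcs G))"
  have \<epsilon>: "0 < \<epsilon>" "\<And>e. e \<in> arcs G \<Longrightarrow> \<epsilon> \<le> len G e"
    using len_pos by (auto simp: \<epsilon>_def)
  (* 2 * C for short paths, the other term for paths longer than the shortest edge *)
  define M where "M = 2 * C + 2 * B / \<epsilon> powr \<gamma> + 1"
  have M: "0 < M" using C B0 by (simp add: M_def add_nonneg_pos)
  have path: "\<bar>f e s - f e' t\<bar> \<le> M * a powr \<gamma>"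
    if p: "(e, s) \<in> points G" "(e', t) \<in> points G" and path: "path_length G (e, s) (e', t) a" for e s e' t a
  proof -
    have a: "0 \<le> a" using path by (rule path_length_nonneg)
    have pts: "e \<in> arcs G" "s \<in> {0..len G e}" "e' \<in> arcs G" "t \<in> {0..len G e'}" using p by (auto simp: points_def)
    show ?thesis
    proof (cases "a < \<epsilon>")
      case True
      have short: "near (e, s) (e', t) a"
        using path True by (rule short_path_near) (rule \<epsilon>(2))
      have "\<bar>f e s - f e' t\<bar> \<le> 2 * C * a powr \<gamma>"
        using short unfolding near_def fst_conv snd_conv
      proof (elim disjE conjE exE)
        assume eq: "e = e'" and le: "\<bar>s - t\<bar> \<le> a"
        have "\<bar>s - t\<bar> powr \<gamma> \<le> a powr \<gamma>" using le gamma by (intro powr_mono2) auto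
        then have "C * \<bar>s - t\<bar> powr \<gamma> \<le> C * a powr \<gamma>" using C by (rule mult_left_mono)
        moreover have "\<bar>f e s - f e' t\<bar> \<le> C * \<bar>s - t\<bar> powr \<gamma>" using holder[OF pts(1,2)] pts(4) eq by blast
        moreover have "0 \<le> C * a powr \<gamma>" using C by simp
        ultimately show ?thesis by linarith
      next
        fix v x y assume v: "represents_vertex G v (e, x)" "represents_vertex G v (e', y)" and le: "\<bar>s - x\<bar> + \<bar>t - y\<bar> \<le> a"
        have xy: "x \<in> {0..len G e}" "y \<in> {0..len G e'}"
          using v[THEN represents_vertex_point(2)] by (auto simp: points_def)
        have "\<bar>s - x\<bar> powr \<gamma> \<le> a powr \<gamma>" "\<bar>t - y\<bar> powr \<gamma> \<le> a powr \<gamma>" using le gamma by (auto intro!: powr_mono2)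
        from this[THEN mult_left_mono[OF _ C]]
        have "\<bar>f e s - f e x\<bar> \<le> C * a powr \<gamma>" "\<bar>f e' t - f e' y\<bar> \<le> C * a powr \<gamma>"
          using holder[OF pts(1,2) xy(1)] holder[OF pts(3,4) xy(2)] by linarith+
        then show ?thesis using vertex[OF v] by linarith
      qed
      also have "\<dots> \<le> M * a powr \<gamma>"
        using B0 \<epsilon>(1) by (intro mult_right_mono) (auto simp: M_def)
      finally show ?thesis .
    next
      case False
      have "\<bar>f e s - f e' t\<bar> \<le> 2 * B" using B[OF pts(1,2)] B[OF pts(3,4)] by linarith
      also have "\<dots> \<le> 2 * B * (a powr \<gamma> / \<epsilon> powr \<gamma>)"
      proof -
        have "\<epsilon> powr \<gamma> \<le> a powr \<gamma>" using False \<epsilon>(1) gamma by (intro powr_mono2) auto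
        then have "1 \<le> a powr \<gamma> / \<epsilon> powr \<gamma>" using \<epsilon>(1) by simp
        from mult_left_mono[OF this, of "2 * B"] show ?thesis using B0 by simp
      qed
      also have "\<dots> = 2 * B / \<epsilon> powr \<gamma> * a powr \<gamma>" by simp
      also have "\<dots> \<le> M * a powr \<gamma>" using C by (intro mult_right_mono) (auto simp: M_def)
      finally show ?thesis .
    qed
  qed
  have "\<bar>f e s - f e' t\<bar> \<le> M * graph_dist G (e, s) (e', t) powr \<gamma>"
    if p: "(e, s) \<in> points G" "(e', t) \<in> points G" for e s e' t
  proof -
    define d where "d = (\<bar>f e s - f e' t\<bar> / M) powr (1 / \<gamma>)"
    have "d \<le> graph_dist G (e, s) (e', t)"
      unfolding graph_dist_def
    proof (rule cInf_greatest)
      show "{a. path_length G (e, s) (e', t) a} \<noteq> {}" using path_exists[OF p] by blast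
      fix a assume "a \<in> {a. path_length G (e, s) (e', t) a}"
      then have pa: "path_length G (e, s) (e', t) a" by simp
      have "\<bar>f e s - f e' t\<bar> / M \<le> a powr \<gamma>" using path[OF p pa] M by (simp add: field_simps)
      then have "d \<le> (a powr \<gamma>) powr (1 / \<gamma>)" unfolding d_def using M gamma by (intro powr_mono2) auto
      then show "d \<le> a" using path_length_nonneg[OF pa] gamma by (simp add: powr_powr)
    qed
    then have "d powr \<gamma> \<le> graph_dist G (e, s) (e', t) powr \<gamma>"
      using gamma by (intro powr_mono2) (auto simp: d_def)
    moreover have "d powr \<gamma> = \<bar>f e s - f e' t\<bar> / M" using gamma M by (simp add: d_def powr_powr)
    ultimately show ?thesis using M by (simp add: field_simps)
  qed
  then have "\<forall>(e, s)\<in>points G. \<forall>(e', t)\<in>points G. \<bar>f e s - f e' t\<bar> \<le> M * graph_dist G (e, s) (e', t) powr \<gamma>"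
    by blast
  moreover have "graph_continuous G f" unfolding graph_continuous_def using cont vertex by blast
  ultimately show ?thesis unfolding graph_holder_def by blast
qed

end


section \<open>Gaussian moments\<close>

lemma normal_even_moment:
  assumes "0 < \<sigma>"
  shows "has_bochner_integral lborel (\<lambda>x. normal_density 0 \<sigma> x * x ^ (2 * p)) (fact (2 * p) / (2 ^ p * fact p) * (\<sigma>\<^sup>2) ^ p)"
proof -
  have "fact (2 * p) / ((2 / \<sigma>\<^sup>2) ^ p * fact p) = fact (2 * p) / (2 ^ p * fact p) * (\<sigma>\<^sup>2) ^ p"
    using assms by (simp add: power_divide)
  then show ?thesis using normal_moment_even[OF assms, of 0 p] by simp
qed

text \<open>
  The moment formula of the normal density, where \<open>p = 1\<close> identifies the variance. For the degenerate
  distribution both sides vanish, as the exponent is positive.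
\<close>

lemma gaussian_moment:
  assumes g: "centered_gaussian M X" and p: "0 < p"
  shows "(\<integral>\<^sup>+\<omega>. ennreal (X \<omega> ^ (2 * p)) \<partial>M) = ennreal (fact (2 * p) / (2 ^ p * fact p) * (LINT \<omega>|M. (X \<omega>)\<^sup>2) ^ p)"
    and "integrable M (\<lambda>\<omega>. (X \<omega>)\<^sup>2)"
proof -
  have X[measurable]: "X \<in> borel_measurable M" using g by (simp add: centered_gaussian_def)
  have "(\<integral>\<^sup>+\<omega>. ennreal (X \<omega> ^ (2 * p)) \<partial>M) = ennreal (fact (2 * p) / (2 ^ p * fact p) * (LINT \<omega>|M. (X \<omega>)\<^sup>2) ^ p) \<and>
     integrable M (\<lambda>\<omega>. (X \<omega>)\<^sup>2)"
    using g unfolding centered_gaussian_def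
  proof (elim conjE disjE exE)
    assume z: "AE \<omega> in M. X \<omega> = 0"
    have "(\<integral>\<^sup>+\<omega>. ennreal (X \<omega> ^ (2 * p)) \<partial>M) = (\<integral>\<^sup>+\<omega>. 0 \<partial>M)"
      using z p by (intro nn_integral_cong_AE) (auto elim!: eventually_mono simp: zero_power)
    moreover have "(LINT \<omega>|M. (X \<omega>)\<^sup>2) = 0"
      using z by (intro integral_eq_zero_AE) (auto elim!: eventually_mono)
    moreover have "integrable M (\<lambda>\<omega>. (X \<omega>)\<^sup>2)"
      by (rule Bochner_Integration.integrable_bound[of M "\<lambda>_. 0 :: real"])
        (use z in \<open>auto elim!: eventually_mono\<close>)
    ultimately show ?thesis using p by (simp add: zero_power)
  next
    fix \<sigma> :: real assume s: "0 < \<sigma>" and d: "distributed M lborel X (\<lambda>x. ennreal (normal_density 0 \<sigma> x))"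
    have mom: "(\<integral>\<^sup>+\<omega>. ennreal (X \<omega> ^ (2 * m)) \<partial>M) = ennreal (fact (2 * m) / (2 ^ m * fact m) * (\<sigma>\<^sup>2) ^ m)" for m
    proof -
      have "(\<integral>\<^sup>+\<omega>. ennreal (X \<omega> ^ (2 * m)) \<partial>M) = (\<integral>\<^sup>+x. ennreal (normal_density 0 \<sigma> x) * ennreal (x ^ (2 * m)) \<partial>lborel)"
        by (intro distributed_nn_integral[OF d, symmetric]) measurable
      also have "\<dots> = (\<integral>\<^sup>+x. ennreal (normal_density 0 \<sigma> x * x ^ (2 * m)) \<partial>lborel)"
        by (intro nn_integral_cong) (simp add: ennreal_mult'' power_mult)
      also have "\<dots> = ennreal (fact (2 * m) / (2 ^ m * fact m) * (\<sigma>\<^sup>2) ^ m)"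
        using normal_even_moment[OF s, of m]
        by (subst nn_integral_eq_integral)
          (auto simp: has_bochner_integral_iff power_mult intro!: mult_nonneg_nonneg)
      finally show ?thesis .
    qed
    have two: "(\<integral>\<^sup>+\<omega>. ennreal ((X \<omega>)\<^sup>2) \<partial>M) = ennreal (\<sigma>\<^sup>2)" using mom[of 1] by (simp add: numeral_2_eq_2)
    then have int: "integrable M (\<lambda>\<omega>. (X \<omega>)\<^sup>2)" by (intro integrableI_nn_integral_finite) auto
    moreover have "(LINT \<omega>|M. (X \<omega>)\<^sup>2) = \<sigma>\<^sup>2"
      using two by (subst integral_eq_nn_integral) auto
    ultimately show ?thesis using mom[of p] by simp
  qed
  then show "(\<integral>\<^sup>+\<omega>. ennreal (X \<omega> ^ (2 * p)) \<partial>M) = ennreal (fact (2 * p) / (2 ^ p * fact p) * (LINT \<omega>|M. (X \<omega>)\<^sup>2) ^ p)"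
    "integrable M (\<lambda>\<omega>. (X \<omega>)\<^sup>2)" by auto
qed

lemma power2_integrable_mult:
  fixes X Y :: "'w \<Rightarrow> real"
  assumes [measurable]: "X \<in> borel_measurable M" "Y \<in> borel_measurable M"
    and "integrable M (\<lambda>\<omega>. (X \<omega>)\<^sup>2)" "integrable M (\<lambda>\<omega>. (Y \<omega>)\<^sup>2)"
  shows "integrable M (\<lambda>\<omega>. X \<omega> * Y \<omega>)"
proof (rule Bochner_Integration.integrable_bound)
  show "integrable M (\<lambda>\<omega>. (X \<omega>)\<^sup>2 + (Y \<omega>)\<^sup>2)" by (intro Bochner_Integration.integrable_add assms)
  show "AE \<omega> in M. norm (X \<omega> * Y \<omega>) \<le> norm ((X \<omega>)\<^sup>2 + (Y \<omega>)\<^sup>2)"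
    using abs_mult_le_power2_sum by simp
qed measurable


section \<open>Geometric decay of families with small moments\<close>

text \<open>
  The sum over all levels of the moments of \<open>D n x / q ^ n\<close> is finite, so almost surely the sum of
  the powers themselves is finite, and each of them is bounded by that sum.
\<close>

lemma AE_geometric_bound:
  fixes D :: "nat \<Rightarrow> 'i \<Rightarrow> 'w \<Rightarrow> real"
  assumes fin: "\<And>n. finite (P n)" and meas: "\<And>n x. x \<in> P n \<Longrightarrow> D n x \<in> borel_measurable M"
    and p: "0 < p" and q: "0 < q" and B: "\<And>n. 0 \<le> B n"
    and mom: "\<And>n x. x \<in> P n \<Longrightarrow> (\<integral>\<^sup>+\<omega>. ennreal (D n x \<omega> ^ (2 * p)) \<partial>M) \<le> ennreal (B n)"
    and summ: "summable (\<lambda>n. real (card (P n)) * (B n / (q ^ n) ^ (2 * p)))"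
  shows "AE \<omega> in M. \<exists>K\<ge>0. \<forall>n. \<forall>x\<in>P n. \<bar>D n x \<omega>\<bar> \<le> K * q ^ n"
proof -
  define f where "f n \<omega> = (\<Sum>x\<in>P n. ennreal (1 / (q ^ n) ^ (2 * p)) * ennreal (D n x \<omega> ^ (2 * p)))" for n \<omega>
  have m1: "(\<lambda>\<omega>. ennreal (D n x \<omega> ^ (2 * p))) \<in> borel_measurable M" if "x \<in> P n" for n x
  proof -
    note [measurable] = meas[OF that]
    show ?thesis by measurable
  qed
  have m2: "(\<lambda>\<omega>. r * ennreal (D n x \<omega> ^ (2 * p))) \<in> borel_measurable M" if "x \<in> P n" for n x r
    using m1[OF that] by measurable
  have [measurable]: "f n \<in> borel_measurable M" for n
    unfolding f_def by (rule borel_measurable_sum) (rule m2)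
  have fint: "(\<integral>\<^sup>+\<omega>. f n \<omega> \<partial>M) \<le> ennreal (real (card (P n)) * (B n / (q ^ n) ^ (2 * p)))" for n
  proof -
    have "(\<integral>\<^sup>+\<omega>. f n \<omega> \<partial>M) = (\<Sum>x\<in>P n. \<integral>\<^sup>+\<omega>. ennreal (1 / (q ^ n) ^ (2 * p)) * ennreal (D n x \<omega> ^ (2 * p)) \<partial>M)"
      unfolding f_def by (rule nn_integral_sum) (rule m2)
    also have "\<dots> = (\<Sum>x\<in>P n. ennreal (1 / (q ^ n) ^ (2 * p)) * (\<integral>\<^sup>+\<omega>. ennreal (D n x \<omega> ^ (2 * p)) \<partial>M))"
      by (rule sum.cong[OF refl]) (rule nn_integral_cmult[OF m1])
    also have "\<dots> \<le> (\<Sum>x\<in>P n. ennreal (1 / (q ^ n) ^ (2 * p)) * ennreal (B n))"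
      by (intro sum_mono mult_left_mono mom) auto
    also have "\<dots> = ennreal (real (card (P n)) * (B n / (q ^ n) ^ (2 * p)))"
      using q B by (simp add: ennreal_mult[symmetric] ennreal_of_nat_eq_real_of_nat)
    finally show ?thesis .
  qed
  have "(\<integral>\<^sup>+\<omega>. (\<Sum>n. f n \<omega>) \<partial>M) = (\<Sum>n. \<integral>\<^sup>+\<omega>. f n \<omega> \<partial>M)" by (rule nn_integral_suminf) measurable
  also have "\<dots> \<le> (\<Sum>n. ennreal (real (card (P n)) * (B n / (q ^ n) ^ (2 * p))))"
    by (intro suminf_le fint) auto
  also have "\<dots> = ennreal (\<Sum>n. real (card (P n)) * (B n / (q ^ n) ^ (2 * p)))"
    using q B summ by (intro suminf_ennreal2) (auto simp flip: power_mult)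
  also have "\<dots> < \<infinity>" by simp
  finally have "AE \<omega> in M. (\<Sum>n. f n \<omega>) \<noteq> \<infinity>"
    by (intro nn_integral_noteq_infinite) auto
  then show ?thesis
  proof eventually_elim
    case (elim \<omega>)
    then obtain Z where Z: "0 \<le> Z" "(\<Sum>n. f n \<omega>) = ennreal Z" by (cases "\<Sum>n. f n \<omega>") auto
    define K where "K = max Z 1"
    have "\<bar>D n x \<omega>\<bar> \<le> K * q ^ n" if x: "x \<in> P n" for n x
    proof (rule ccontr)
      assume "\<not> ?thesis"
      then have lt: "K < \<bar>D n x \<omega>\<bar> / q ^ n" using q by (simp add: field_simps)
      define y where "y = \<bar>D n x \<omega>\<bar> / q ^ n"
      have y: "1 < y" "Z < y" using lt by (auto simp: y_def K_def)
      have "y ^ 1 \<le> y ^ (2 * p)" using y p by (intro power_increasing) auto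
      also have "y ^ (2 * p) = 1 / (q ^ n) ^ (2 * p) * D n x \<omega> ^ (2 * p)"
        by (simp add: y_def power_divide power_mult)
      finally have "y \<le> 1 / (q ^ n) ^ (2 * p) * D n x \<omega> ^ (2 * p)" by simp
      then have "ennreal y \<le> ennreal (1 / (q ^ n) ^ (2 * p)) * ennreal (D n x \<omega> ^ (2 * p))"
        using q by (simp add: ennreal_mult[symmetric] power_mult ennreal_leI)
      also have "\<dots> \<le> f n \<omega>"
        unfolding f_def using x fin
        by (intro member_le_sum[where f = "\<lambda>x. ennreal (1 / (q ^ n) ^ (2 * p)) * ennreal (D n x \<omega> ^ (2 * p))"]) auto
      also have "f n \<omega> \<le> (\<Sum>n. f n \<omega>)"
        using sum_le_suminf[of "\<lambda>n. f n \<omega>" "{n}"] by simp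
      finally have "y \<le> Z" using Z y by (simp add: ennreal_le_iff)
      then show False using y by simp
    qed
    moreover have "0 \<le> K" by (simp add: K_def)
    ultimately show ?case by blast
  qed
qed


section \<open>Random series in the eigenbasis\<close>

locale graph_noise = graph_eigenbasis G \<kappa> \<phi> \<mu>
  for G :: "('v, 'e) metric_graph" and \<kappa> \<phi> \<mu> +
  fixes M :: "'w measure" and W :: "('e \<Rightarrow> real \<Rightarrow> real) \<Rightarrow> 'w \<Rightarrow> real"
  assumes prob: "prob_space M" and noise: "white_noise G M W"
begin

lemma noise_gaussian:
  "finite F \<Longrightarrow> F \<subseteq> graph_L2 G \<Longrightarrow> centered_gaussian M (\<lambda>\<omega>. \<Sum>h\<in>F. c h * W h \<omega>)"
  using noise by (simp add: white_noise_def)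

lemma noise_covariance:
  "h \<in> graph_L2 G \<Longrightarrow> g \<in> graph_L2 G \<Longrightarrow> (LINT \<omega>|M. W h \<omega> * W g \<omega>) = L2_inner G h g"
  using noise by (simp add: white_noise_def)

lemma noise_single: "h \<in> graph_L2 G \<Longrightarrow> centered_gaussian M (W h)"
  using noise_gaussian[of "{h}" "\<lambda>_. 1"] by simp

lemma noise_measurable: "h \<in> graph_L2 G \<Longrightarrow> W h \<in> borel_measurable M"
  using noise_single by (simp add: centered_gaussian_def)

lemma noise_mult_integrable:
  "h \<in> graph_L2 G \<Longrightarrow> g \<in> graph_L2 G \<Longrightarrow> integrable M (\<lambda>\<omega>. W h \<omega> * W g \<omega>)"
  by (intro power2_integrable_mult noise_measurable gaussian_moment(2)[OF noise_single zero_less_one])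

lemma phi_inj: "inj \<phi>"
proof (rule injI)
  fix i j assume "\<phi> i = \<phi> j"
  then show "i = j" using phi_orthonormal[of i j] phi_orthonormal[of i i] by (auto split: if_splits)
qed

lemma random_series_gaussian: "centered_gaussian M (\<lambda>\<omega>. \<Sum>i<n. c i * W (\<phi> i) \<omega>)"
proof -
  have "centered_gaussian M (\<lambda>\<omega>. \<Sum>h\<in>\<phi> ` {..<n}. c (inv \<phi> h) * W h \<omega>)"
    using phi_L2 by (intro noise_gaussian) auto
  moreover have "(\<Sum>h\<in>\<phi> ` {..<n}. c (inv \<phi> h) * W h \<omega>) = (\<Sum>i<n. c i * W (\<phi> i) \<omega>)" for \<omega>
    using phi_inj by (subst sum.reindex) (auto simp: inj_on_def inj_def)
  ultimately show ?thesis by simp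
qed

lemma random_series_variance: "(LINT \<omega>|M. (\<Sum>i<n. c i * W (\<phi> i) \<omega>)\<^sup>2) = (\<Sum>i<n. (c i)\<^sup>2)"
proof -
  have "(\<Sum>i<n. c i * W (\<phi> i) \<omega>)\<^sup>2 = (\<Sum>i<n. \<Sum>j<n. c i * c j * (W (\<phi> i) \<omega> * W (\<phi> j) \<omega>))" for \<omega>
    by (simp add: power2_eq_square sum_product mult_ac)
  then have "(LINT \<omega>|M. (\<Sum>i<n. c i * W (\<phi> i) \<omega>)\<^sup>2) =
      (\<Sum>i<n. \<Sum>j<n. c i * c j * (LINT \<omega>|M. W (\<phi> i) \<omega> * W (\<phi> j) \<omega>))"
    by (simp add: noise_mult_integrable phi_L2)
  also have "\<dots> = (\<Sum>i<n. (c i)\<^sup>2)"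
    by (simp add: noise_covariance phi_L2 phi_orthonormal power2_eq_square if_distrib[of "\<lambda>y. _ * y"] cong: if_cong)
  finally show ?thesis .
qed

definition noise_coeff :: "(nat \<Rightarrow> real) \<Rightarrow> 'w \<Rightarrow> nat \<Rightarrow> real" where
  "noise_coeff a \<omega> i = a i * W (\<phi> i) \<omega>"

lemma noise_coeff_measurable: "(\<lambda>\<omega>. noise_coeff a \<omega> i) \<in> borel_measurable M"
  unfolding noise_coeff_def by (intro borel_measurable_times borel_measurable_const noise_measurable phi_L2)

lemma noise_coeff_summable:
  assumes "summable (\<lambda>i. (a i)\<^sup>2)"
  shows "AE \<omega> in M. summable (\<lambda>i. (noise_coeff a \<omega> i)\<^sup>2)"
proof -
  note [measurable] = noise_coeff_measurable
  have one: "(\<integral>\<^sup>+\<omega>. ennreal ((noise_coeff a \<omega> i)\<^sup>2) \<partial>M) = ennreal ((a i)\<^sup>2)" for i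
  proof -
    have int: "integrable M (\<lambda>\<omega>. (noise_coeff a \<omega> i)\<^sup>2)"
      unfolding noise_coeff_def power_mult_distrib
      using noise_mult_integrable[OF phi_L2 phi_L2] by (simp add: power2_eq_square)
    have "(LINT \<omega>|M. (noise_coeff a \<omega> i)\<^sup>2) = (a i)\<^sup>2"
      unfolding noise_coeff_def power_mult_distrib
      using noise_covariance[OF phi_L2 phi_L2, of i i] by (simp add: power2_eq_square phi_orthonormal)
    then show ?thesis using nn_integral_eq_integral[OF int] by simp
  qed
  have "(\<integral>\<^sup>+\<omega>. (\<Sum>i. ennreal ((noise_coeff a \<omega> i)\<^sup>2)) \<partial>M) = (\<Sum>i. ennreal ((a i)\<^sup>2))"
    by (subst nn_integral_suminf) (auto simp: one)
  also have "\<dots> = ennreal (\<Sum>i. (a i)\<^sup>2)" using assms by (intro suminf_ennreal2) auto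
  finally have "AE \<omega> in M. (\<Sum>i. ennreal ((noise_coeff a \<omega> i)\<^sup>2)) \<noteq> \<infinity>"
    by (intro nn_integral_noteq_infinite) auto
  then show ?thesis
    by eventually_elim (auto intro!: summable_suminf_not_top)
qed

lemma series_functional_measurable: "(\<lambda>\<omega>. series_functional (noise_coeff a \<omega>) \<psi>) \<in> borel_measurable M"
proof -
  note [measurable] = noise_coeff_measurable
  show ?thesis unfolding series_functional_def by measurable
qed

text \<open>
  Partial sums are Gaussian with variance at most \<open>V\<close>; Fatou's lemma carries the moment bound over
  to the limit.
\<close>

lemma series_functional_moment:
  assumes a: "summable (\<lambda>i. (a i)\<^sup>2)" and \<psi>: "\<psi> \<in> graph_L2 G" and p: "0 < p"
    and V: "\<And>n. (\<Sum>i<n. (a i * L2_inner G \<psi> (\<phi> i))\<^sup>2) \<le> V"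
  shows "(\<integral>\<^sup>+\<omega>. ennreal (series_functional (noise_coeff a \<omega>) \<psi> ^ (2 * p)) \<partial>M)
    \<le> ennreal (fact (2 * p) / (2 ^ p * fact p) * V ^ p)"
proof -
  define S where "S n \<omega> = (\<Sum>i<n. (a i * L2_inner G \<psi> (\<phi> i)) * W (\<phi> i) \<omega>)" for n \<omega>
  have [measurable]: "S n \<in> borel_measurable M" for n
    unfolding S_def by (rule conjunct1[OF random_series_gaussian[unfolded centered_gaussian_def]])
  have mom: "(\<integral>\<^sup>+\<omega>. ennreal (S n \<omega> ^ (2 * p)) \<partial>M) \<le> ennreal (fact (2 * p) / (2 ^ p * fact p) * V ^ p)" for n
  proof -
    have "(\<integral>\<^sup>+\<omega>. ennreal (S n \<omega> ^ (2 * p)) \<partial>M) =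
        ennreal (fact (2 * p) / (2 ^ p * fact p) * (\<Sum>i<n. (a i * L2_inner G \<psi> (\<phi> i))\<^sup>2) ^ p)"
      unfolding S_def using gaussian_moment(1)[OF random_series_gaussian p] by (simp only: random_series_variance)
    also have "\<dots> \<le> ennreal (fact (2 * p) / (2 ^ p * fact p) * V ^ p)"
      by (intro ennreal_leI mult_left_mono power_mono V sum_nonneg) auto
    finally show ?thesis .
  qed
  have "AE \<omega> in M. liminf (\<lambda>n. ennreal (S n \<omega> ^ (2 * p))) = ennreal (series_functional (noise_coeff a \<omega>) \<psi> ^ (2 * p))"
    using noise_coeff_summable[OF a]
  proof eventually_elim
    case (elim \<omega>)
    have "(\<lambda>n. S n \<omega>) \<longlonglongrightarrow> series_functional (noise_coeff a \<omega>) \<psi>"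
    proof -
      have "S n \<omega> = (\<Sum>i<n. noise_coeff a \<omega> i * L2_inner G \<psi> (\<phi> i))" for n
        by (simp add: S_def noise_coeff_def mult_ac)
      then show ?thesis using series_functional_tendsto[OF elim \<psi>] by (simp only:)
    qed
    then have "(\<lambda>n. ennreal (S n \<omega> ^ (2 * p))) \<longlonglongrightarrow> ennreal (series_functional (noise_coeff a \<omega>) \<psi> ^ (2 * p))"
      by (intro tendsto_intros)
    then show ?case by (intro lim_imp_Liminf) auto
  qed
  then have "(\<integral>\<^sup>+\<omega>. ennreal (series_functional (noise_coeff a \<omega>) \<psi> ^ (2 * p)) \<partial>M) =
      (\<integral>\<^sup>+\<omega>. liminf (\<lambda>n. ennreal (S n \<omega> ^ (2 * p))) \<partial>M)"
    by (intro nn_integral_cong_AE) (auto elim!: eventually_mono)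
  also have "\<dots> \<le> liminf (\<lambda>n. \<integral>\<^sup>+\<omega>. ennreal (S n \<omega> ^ (2 * p)) \<partial>M)"
    by (rule nn_integral_liminf) measurable
  also have "\<dots> \<le> liminf (\<lambda>n. ennreal (fact (2 * p) / (2 ^ p * fact p) * V ^ p))"
    by (intro Liminf_mono always_eventually allI mom)
  also have "\<dots> = ennreal (fact (2 * p) / (2 ^ p * fact p) * V ^ p)" by (simp add: Liminf_const)
  finally show ?thesis .
qed

lemma len_le_total_length: "e \<in> arcs G \<Longrightarrow> len G e \<le> total_length"
  unfolding total_length_def using len_pos by (intro member_le_sum) (auto simp: less_imp_le)

lemma finite_level_touching: "finite {(e, k, e', k'). level_touching n e k e' k'}"
  and card_level_touching: "card {(e, k, e', k'). level_touching n e k e' k'} \<le> (card (arcs G))\<^sup>2 * 4 ^ n"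
proof -
  let ?R = "arcs G \<times> {..<(2::nat) ^ n} \<times> arcs G \<times> {..<(2::nat) ^ n}"
  have sub: "{(e, k, e', k'). level_touching n e k e' k'} \<subseteq> ?R" by (auto simp: level_touching_def)
  have fin: "finite ?R" by simp
  show "finite {(e, k, e', k'). level_touching n e k e' k'}" using sub fin by (rule finite_subset)
  have "card {(e, k, e', k'). level_touching n e k e' k'} \<le> card ?R" using fin sub by (rule card_mono)
  also have "\<dots> = (card (arcs G))\<^sup>2 * ((2 * 2) ^ n)"
    by (simp only: card_cartesian_product card_lessThan power_mult_distrib) (simp add: power2_eq_square)
  finally show "card {(e, k, e', k'). level_touching n e k e' k'} \<le> (card (arcs G))\<^sup>2 * 4 ^ n" by simp
qed

text \<open>
  The variance bound for touching cells of level \<open>n\<close> is of order \<open>2 powr (- \<theta> * n)\<close> for some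
  \<open>\<theta> > 2 * \<gamma>\<close>, so the moment of order \<open>2 * p\<close> of a difference divided by \<open>2 powr (- \<gamma> * n)\<close> is of
  order \<open>2 powr (- p * (\<theta> - 2 * \<gamma>) * n)\<close>. For \<open>p\<close> large this beats the number of pairs of cells,
  which is at most of order \<open>4 ^ n\<close>.
\<close>

lemma random_series_regular_coeffs:
  assumes beta: "1 / 2 < \<beta>" and a: "\<And>i. (a i)\<^sup>2 \<le> A * \<mu> i powr (- \<beta>)"
    and gamma: "0 < \<gamma>" "\<gamma> < \<beta> - 1 / 2" "\<gamma> < 1 / 2"
  shows "AE \<omega> in M. \<exists>K. regular_coeffs \<gamma> K (noise_coeff a \<omega>)"
proof -
  have sa: "summable (\<lambda>i. (a i)\<^sup>2)"
    by (rule summable_comparison_test'[of "\<lambda>i. A * \<mu> i powr (- \<beta>)" 0])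
      (use a negative_powers_summable[OF beta] in \<open>auto intro!: summable_mult\<close>)
  have A0: "0 \<le> A"
  proof -
    have "0 \<le> A * \<mu> 0 powr (- \<beta>)" using a[of 0] zero_le_power2[of "a 0"] by linarith
    then show ?thesis using mu0_pos by (simp add: zero_le_mult_iff)
  qed
  (* theta lies strictly between 2 * gamma and the bound min (2 * beta - 1) 1 for the variance *)
  define m where "m = min (\<beta> - 1 / 2) (1 / 2)"
  define \<theta> where "\<theta> = \<gamma> + m"
  have gm: "\<gamma> < m" using gamma by (simp add: m_def)
  have mle: "m \<le> \<beta> - 1 / 2" "m \<le> 1 / 2"
    unfolding m_def by (rule min.cobounded1, rule min.cobounded2)
  have th: "0 \<le> \<theta>" "\<theta> \<le> 1" "\<theta> < 2 * \<beta> - 1" "2 * \<gamma> < \<theta>"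
    unfolding \<theta>_def using gm mle gamma by linarith+
  obtain K0 where K0: "0 \<le> K0"
    "\<And>n e a b e' a' b' h. touching e a b e' a' b' \<Longrightarrow> b - a \<le> h \<Longrightarrow> b' - a' \<le> h \<Longrightarrow>
      (\<Sum>i<n. \<mu> i powr (- \<beta>) *
        (L2_inner G (cell_average e a b) (\<phi> i) - L2_inner G (cell_average e' a' b') (\<phi> i))\<^sup>2) \<le> K0 * h powr \<theta>"
    using cell_difference_variance[OF beta th(1-3)] by blast
  (* the gain per level must beat the factor 4 = 2 powr 2 in the number of pairs of cells *)
  obtain p :: nat where p: "2 / (\<theta> - 2 * \<gamma>) < real p" using reals_Archimedean2 by blast
  have p_big: "2 < real p * (\<theta> - 2 * \<gamma>)" using p th(4) by (simp add: field_simps)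
  have p0: "0 < p" using p_big by (cases p) auto
  define q where "q = 2 powr - \<gamma>"
  have q: "0 < q" by (simp add: q_def)
  define P where "P n = {(e, k, e', k'). level_touching n e k e' k'}" for n
  define \<psi> where "\<psi> n = (\<lambda>(e, k, e', k') e0 t. dyadic_cell G e n k e0 t - dyadic_cell G e' n k' e0 t)" for n
  define D where "D n x \<omega> = series_functional (noise_coeff a \<omega>) (\<psi> n x)" for n x \<omega>
  define h where "h n = total_length / 2 ^ n" for n :: nat
  define c where "c = fact (2 * p) / (2 ^ p * fact p) * (A * K0 * total_length powr \<theta>) ^ p"
  have c0: "0 \<le> c" using A0 K0 by (simp add: c_def)
  have "AE \<omega> in M. \<exists>K\<ge>0. \<forall>n. \<forall>x\<in>P n. \<bar>D n x \<omega>\<bar> \<le> K * q ^ n"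
  proof (rule AE_geometric_bound[where p = p and B = "\<lambda>n. c * ((2 powr - \<theta>) ^ n) ^ p"])
    show "finite (P n)" for n unfolding P_def by (rule finite_level_touching)
    show "D n x \<in> borel_measurable M" for n x unfolding D_def by (rule series_functional_measurable)
    show "0 \<le> c * ((2 powr - \<theta>) ^ n) ^ p" for n using c0 by simp
    show "(\<integral>\<^sup>+\<omega>. ennreal (D n x \<omega> ^ (2 * p)) \<partial>M) \<le> ennreal (c * ((2 powr - \<theta>) ^ n) ^ p)" if x: "x \<in> P n" for n x
    proof -
      obtain e k e' k' where xe: "x = (e, k, e', k')" by (cases x) auto
      have lt: "level_touching n e k e' k'" using x by (simp add: P_def xe)
      have ar: "e \<in> arcs G" "e' \<in> arcs G" "k < 2 ^ n" "k' < 2 ^ n" using lt by (auto simp: level_touching_def)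
      have cL: "dyadic_cell G e n k \<in> graph_L2 G" "dyadic_cell G e' n k' \<in> graph_L2 G"
        using ar by (auto intro: dyadic_cell_L2)
      have \<psi>L: "\<psi> n x \<in> graph_L2 G" using graph_L2_diff[OF cL] by (simp add: \<psi>_def xe)
      have in\<psi>: "L2_inner G (\<psi> n x) (\<phi> i) = L2_inner G (dyadic_cell G e n k) (\<phi> i) - L2_inner G (dyadic_cell G e' n k') (\<phi> i)" for i
        using L2_inner_diff[OF cL phi_L2] by (simp add: \<psi>_def xe)
      have w: "len G e * real (Suc k) / 2 ^ n - len G e * real k / 2 ^ n \<le> h n" if "e \<in> arcs G" for e k
      proof -
        have "len G e * real (Suc k) / 2 ^ n - len G e * real k / 2 ^ n = len G e / 2 ^ n" by (simp add: field_simps)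
        then show ?thesis using len_le_total_length[OF that] by (simp add: h_def divide_right_mono)
      qed
      have var: "(\<Sum>i<N. (a i * L2_inner G (\<psi> n x) (\<phi> i))\<^sup>2) \<le> A * (K0 * h n powr \<theta>)" for N
      proof -
        have "(\<Sum>i<N. (a i * L2_inner G (\<psi> n x) (\<phi> i))\<^sup>2) \<le> (\<Sum>i<N. A * (\<mu> i powr (- \<beta>) * (L2_inner G (\<psi> n x) (\<phi> i))\<^sup>2))"
          using mult_right_mono[OF a zero_le_power2] by (intro sum_mono) (simp add: power_mult_distrib mult.assoc)
        also have "\<dots> = A * (\<Sum>i<N. \<mu> i powr (- \<beta>) * (L2_inner G (\<psi> n x) (\<phi> i))\<^sup>2)" by (simp add: sum_distrib_left)
        also have "\<dots> \<le> A * (K0 * h n powr \<theta>)"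
          using K0(2)[OF conjunct2[OF conjunct2[OF conjunct2[OF conjunct2[OF lt[unfolded level_touching_def]]]]] w[OF ar(1)] w[OF ar(2)]]
          unfolding in\<psi> dyadic_cell_def by (intro mult_left_mono A0)
        finally show ?thesis .
      qed
      have "(\<integral>\<^sup>+\<omega>. ennreal (D n x \<omega> ^ (2 * p)) \<partial>M) \<le> ennreal (fact (2 * p) / (2 ^ p * fact p) * (A * (K0 * h n powr \<theta>)) ^ p)"
        unfolding D_def by (rule series_functional_moment[OF sa \<psi>L p0 var])
      also have "fact (2 * p) / (2 ^ p * fact p) * (A * (K0 * h n powr \<theta>)) ^ p = c * ((2 powr - \<theta>) ^ n) ^ p"
      proof -
        have "0 \<le> total_length" unfolding total_length_def using len_pos by (intro sum_nonneg) (simp add: less_imp_le)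
        moreover have "h n = total_length * 2 powr (- real n)"
          by (simp add: h_def powr_minus powr_realpow divide_inverse)
        ultimately have "h n powr \<theta> = total_length powr \<theta> * (2 powr (- real n)) powr \<theta>"
          by (simp add: powr_mult)
        also have "(2 powr (- real n)) powr \<theta> = (2 powr - \<theta>) ^ n"
          by (simp add: powr_powr mult.commute flip: powr_realpow)
        finally have "h n powr \<theta> = total_length powr \<theta> * (2 powr - \<theta>) ^ n" .
        then show ?thesis by (simp add: c_def power_mult_distrib mult_ac)
      qed
      finally show ?thesis .
    qed
    show "summable (\<lambda>n. real (card (P n)) * (c * ((2 powr - \<theta>) ^ n) ^ p / (q ^ n) ^ (2 * p)))"
    proof (rule summable_comparison_test')
      define r where "r = 4 * ((2 powr - \<theta>) ^ p / q ^ (2 * p))"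
      have "r = 2 powr (2 - real p * (\<theta> - 2 * \<gamma>))"
        by (simp add: r_def q_def powr_powr powr_add powr_diff algebra_simps powr_minus field_simps flip: powr_realpow)
      also have "\<dots> < 2 powr 0" using p_big by (intro powr_less_mono) auto
      finally have r: "r < 1" "0 \<le> r" using q by (simp_all add: r_def)
      show "summable (\<lambda>n. (real (card (arcs G)))\<^sup>2 * c * r ^ n)"
        using r by (intro summable_mult summable_geometric) auto
      fix n
      have "real (card (P n)) \<le> real ((card (arcs G))\<^sup>2 * 4 ^ n)"
        unfolding P_def of_nat_le_iff by (rule card_level_touching)
      then have card: "real (card (P n)) \<le> (real (card (arcs G)))\<^sup>2 * 4 ^ n" by simp
      have nn: "0 \<le> c * ((2 powr - \<theta>) ^ n) ^ p / (q ^ n) ^ (2 * p)" using c0 q by simp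
      have "norm (real (card (P n)) * (c * ((2 powr - \<theta>) ^ n) ^ p / (q ^ n) ^ (2 * p))) =
          real (card (P n)) * (c * ((2 powr - \<theta>) ^ n) ^ p / (q ^ n) ^ (2 * p))"
        using nn by (simp only: real_norm_def abs_of_nonneg mult_nonneg_nonneg of_nat_0_le_iff)
      also have "\<dots> \<le> ((real (card (arcs G)))\<^sup>2 * 4 ^ n) * (c * ((2 powr - \<theta>) ^ n) ^ p / (q ^ n) ^ (2 * p))"
        by (rule mult_right_mono[OF card nn])
      also have "\<dots> = (real (card (arcs G)))\<^sup>2 * c * r ^ n"
        unfolding r_def power_mult_distrib power_divide power_mult[symmetric] by (simp add: mult.commute[of n])
      finally show "norm (real (card (P n)) * (c * ((2 powr - \<theta>) ^ n) ^ p / (q ^ n) ^ (2 * p))) \<le> (real (card (arcs G)))\<^sup>2 * c * r ^ n" .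
    qed
  qed (use p0 q in auto)
  then show ?thesis
    using noise_coeff_summable[OF sa]
  proof eventually_elim
    case (elim \<omega>)
    then obtain K where K: "0 \<le> K" "\<And>n x. x \<in> P n \<Longrightarrow> \<bar>D n x \<omega>\<bar> \<le> K * q ^ n" by blast
    have "\<bar>series_functional (noise_coeff a \<omega>) (dyadic_cell G e n k) -
        series_functional (noise_coeff a \<omega>) (dyadic_cell G e' n k')\<bar> \<le> K * (2 powr - \<gamma>) ^ n"
      if lt: "level_touching n e k e' k'" for n e k e' k'
    proof -
      have cL: "dyadic_cell G e n k \<in> graph_L2 G" "dyadic_cell G e' n k' \<in> graph_L2 G"
        using lt by (auto intro: dyadic_cell_L2 simp: level_touching_def)
      have "D n (e, k, e', k') \<omega> = series_functional (noise_coeff a \<omega>) (dyadic_cell G e n k) -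
        series_functional (noise_coeff a \<omega>) (dyadic_cell G e' n k')"
        unfolding D_def \<psi>_def using series_functional_diff[OF elim(2) cL] by simp
      then show ?thesis using K(2)[of "(e, k, e', k')" n] lt by (simp add: P_def q_def)
    qed
    then show ?case using K(1) elim(2) gamma(1) unfolding regular_coeffs_def by blast
  qed
qed

end


section \<open>Even weak derivatives in the eigenbasis\<close>

context graph_eigenbasis
begin

text \<open>
  By the eigenvalue equation, each pair of derivatives moved from the test function to \<open>\<phi> i\<close> costs
  the factor \<open>\<kappa>\<^sup>2 - \<mu> i\<close>.
\<close>

lemma test_function_deriv_inner:
  assumes e: "e \<in> arcs G" and \<eta>: "test_function (len G e) \<eta>"
  shows "L2_inner G (edge_embed e ((deriv ^^ (2 * j)) \<eta>)) (\<phi> i) =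
    (\<kappa>\<^sup>2 - \<mu> i) ^ j * L2_inner G (edge_embed e \<eta>) (\<phi> i)"
proof (induction j)
  case (Suc j)
  let ?\<theta> = "(deriv ^^ (2 * j)) \<eta>"
  have \<theta>: "test_function (len G e) ?\<theta>" by (rule test_function_higher_deriv[OF \<eta>])
  have "(deriv ^^ (2 * Suc j)) \<eta> = (deriv ^^ 2) ?\<theta>" by (simp add: numeral_2_eq_2)
  then have "L2_inner G (edge_embed e ((deriv ^^ (2 * Suc j)) \<eta>)) (\<phi> i) =
      (LINT t|lebesgue_on {0..len G e}. \<phi> i e t * (deriv ^^ 2) ?\<theta> t)"
    by (simp only: L2_inner_commute[of "edge_embed _ _"] edge_embed_inner[OF e])
  also have "\<dots> = (LINT t|lebesgue_on {0..len G e}. (\<kappa>\<^sup>2 - \<mu> i) * \<phi> i e t * ?\<theta> t)"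
    using phi_weak_deriv[OF e, of i] \<theta> unfolding weak_deriv_def by simp
  also have "\<dots> = (\<kappa>\<^sup>2 - \<mu> i) * L2_inner G (edge_embed e ?\<theta>) (\<phi> i)"
    by (simp add: L2_inner_commute[of "edge_embed _ _"] edge_embed_inner[OF e] mult.assoc)
  finally show ?case by (simp add: Suc)
qed simp

lemma series_functional_higher_deriv:
  assumes e: "e \<in> arcs G" and \<eta>: "test_function (len G e) \<eta>"
  shows "series_functional c (edge_embed e ((deriv ^^ (2 * j)) \<eta>)) =
    series_functional (\<lambda>i. c i * (\<kappa>\<^sup>2 - \<mu> i) ^ j) (edge_embed e \<eta>)"
  unfolding series_functional_def test_function_deriv_inner[OF assms] by (simp add: mult.assoc)

lemma L2_function_test_integral:
  assumes f: "f \<in> graph_L2 G" and e: "e \<in> arcs G" and \<eta>: "test_function (len G e) \<eta>"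
  shows "(LINT t|lebesgue_on {0..len G e}. f e t * \<eta> t) =
    series_functional (\<lambda>i. L2_inner G f (\<phi> i)) (edge_embed e \<eta>)"
  using sums_unique[OF Parseval[OF f edge_embed_L2[OF e test_function_continuous[OF \<eta>]]]]
  by (simp add: edge_embed_inner[OF e] series_functional_def)

end

text \<open>
  Consecutive functions \<open>v j\<close> and \<open>v (Suc j)\<close> are continuous and related by a weak second
  derivative, which is then classical. The first derivative of \<open>v j\<close> is the weak derivative of \<open>f\<close>
  of order \<open>2 * j + 1\<close>.
\<close>

lemma edge_sobolev_if_even_derivs:
  assumes l: "0 < l" and f: "f \<in> edge_L2 l"
    and v: "\<And>j. j \<le> J \<Longrightarrow> continuous_on {0..l} (v j)"
    and f_v: "\<And>j. j \<le> J \<Longrightarrow> weak_deriv l (2 * j) f (v j)"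
    and v_v: "\<And>j. j < J \<Longrightarrow> weak_deriv l 2 (v j) (v (Suc j))"
  shows "f \<in> edge_sobolev (2 * J) l"
proof -
  have "\<exists>g\<in>edge_L2 l. weak_deriv l m f g" if m: "m \<le> 2 * J" for m
  proof (cases "even m")
    case True
    then obtain j where j: "m = 2 * j" by (elim evenE)
    then have "j \<le> J" using m by simp
    then show ?thesis using f_v[of j] edge_L2_continuous[OF v[of j]] j by blast
  next
    case False
    then obtain j where j: "m = Suc (2 * j)" by (elim oddE) simp
    then have J: "j < J" "j \<le> J" "Suc j \<le> J" using m by auto
    obtain g where g: "\<And>t. t \<in> {0..l} \<Longrightarrow> (v j has_real_derivative g t) (at t within {0..l})"
      "\<And>t. t \<in> {0..l} \<Longrightarrow> (g has_real_derivative v (Suc j) t) (at t within {0..l})"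
      using weak_second_derivative_classical[OF l v[OF J(2)] v[OF J(3)] v_v[OF J(1)]] by blast
    have cg: "continuous_on {0..l} g" by (rule DERIV_continuous_on[OF g(2)])
    have "weak_deriv l m f g"
      unfolding weak_deriv_def
    proof (intro allI impI)
      fix \<eta> assume \<eta>: "test_function l \<eta>"
      note \<eta>' = test_function_deriv[OF \<eta>]
      have "(LINT t|lebesgue_on {0..l}. f t * (deriv ^^ m) \<eta> t) =
          (LINT t|lebesgue_on {0..l}. f t * (deriv ^^ (2 * j)) (deriv \<eta>) t)"
        by (simp add: j funpow_Suc_right del: funpow.simps)
      also have "\<dots> = (LINT t|lebesgue_on {0..l}. v j t * deriv \<eta> t)"
        using f_v[OF J(2), unfolded weak_deriv_def, rule_format, OF \<eta>'] by simp
      also have "\<dots> = integral {0..l} (\<lambda>t. v j t * deriv \<eta> t)"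
        by (intro LINT_continuous_eq_integral continuous_on_mult v J test_function_continuous[OF \<eta>'])
      also have "\<dots> = - integral {0..l} (\<lambda>t. g t * \<eta> t)"
        by (rule test_function_by_parts[OF l g(1) cg \<eta>])
      also have "integral {0..l} (\<lambda>t. g t * \<eta> t) = (LINT t|lebesgue_on {0..l}. g t * \<eta> t)"
        by (intro LINT_continuous_eq_integral[symmetric] continuous_on_mult cg test_function_continuous[OF \<eta>])
      finally show "(LINT t|lebesgue_on {0..l}. f t * (deriv ^^ m) \<eta> t) = (- 1) ^ m * (LINT t|lebesgue_on {0..l}. g t * \<eta> t)"
        by (simp add: j)
    qed
    then show ?thesis using edge_L2_continuous[OF cg] by blast
  qed
  then show ?thesis using f by (simp add: edge_sobolev_def)
qed

section \<open>Hoelder regularity of the solution\<close>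

locale graph_spde = graph_noise G \<kappa> \<phi> \<mu> M W
  for G :: "('v, 'e) metric_graph" and \<kappa> \<phi> \<mu> and M :: "'w measure" and W +
  fixes \<tau> \<alpha> :: real and u :: "'w \<Rightarrow> 'e \<Rightarrow> real \<Rightarrow> real"
  assumes tau_pos: "0 < \<tau>" and solution: "spde_solution G M \<phi> \<mu> \<tau> \<alpha> W u"
begin

text \<open>
  The factor of \<open>W (\<phi> i)\<close> in the coefficient of \<open>D\<^bsup>2j\<^esup> u\<close> with respect to \<open>\<phi> i\<close>: the solution has the
  factor \<open>\<mu> i powr (- \<alpha> / 2) / \<tau>\<close>, and \<open>D\<^sup>2\<close> acts on \<open>\<phi> i\<close> as multiplication by \<open>\<kappa>\<^sup>2 - \<mu> i\<close>.
\<close>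

definition deriv_coeff :: "nat \<Rightarrow> nat \<Rightarrow> real" where
  "deriv_coeff j i = inverse \<tau> * \<mu> i powr (- \<alpha> / 2) * (\<kappa>\<^sup>2 - \<mu> i) ^ j"



lemma deriv_coeff_bound:
  obtains A where "\<And>i. (deriv_coeff j i)\<^sup>2 \<le> A * \<mu> i powr (- (\<alpha> - 2 * real j))"
proof
  fix i
  (* |kappa^2 - mu i| <= B * mu i, because mu i >= mu 0 *)
  define B where "B = 1 + \<kappa>\<^sup>2 / \<mu> 0"
  have B0: "0 \<le> B" using mu0_pos by (simp add: B_def)
  have "\<kappa>\<^sup>2 / \<mu> 0 * \<mu> 0 \<le> \<kappa>\<^sup>2 / \<mu> 0 * \<mu> i" using mu_ge[of i] mu0_pos by (intro mult_left_mono) auto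
  then have "\<kappa>\<^sup>2 \<le> \<kappa>\<^sup>2 / \<mu> 0 * \<mu> i" using mu0_pos by simp
  then have "\<bar>\<kappa>\<^sup>2 - \<mu> i\<bar> \<le> B * \<mu> i"
    using mu_pos[of i] zero_le_power2[of \<kappa>] unfolding B_def distrib_right by linarith
  then have "\<bar>\<kappa>\<^sup>2 - \<mu> i\<bar> ^ (2 * j) \<le> (B * \<mu> i) ^ (2 * j)" by (intro power_mono) auto
  then have pw: "((\<kappa>\<^sup>2 - \<mu> i) ^ j)\<^sup>2 \<le> B ^ (2 * j) * \<mu> i powr (2 * real j)"
    using mu_pos[of i] by (simp add: power_mult_distrib power_even_abs flip: power_mult powr_realpow) (simp add: mult.commute)
  have "(deriv_coeff j i)\<^sup>2 = (inverse \<tau>)\<^sup>2 * \<mu> i powr (- \<alpha>) * ((\<kappa>\<^sup>2 - \<mu> i) ^ j)\<^sup>2"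
    by (simp add: deriv_coeff_def power_mult_distrib power2_eq_square flip: powr_add)
  also have "\<dots> \<le> (inverse \<tau>)\<^sup>2 * \<mu> i powr (- \<alpha>) * (B ^ (2 * j) * \<mu> i powr (2 * real j))"
    by (intro mult_left_mono pw) auto
  also have "\<dots> = (inverse \<tau>)\<^sup>2 * B ^ (2 * j) * \<mu> i powr (- (\<alpha> - 2 * real j))"
    by (simp add: powr_add[symmetric] algebra_simps)
  finally show "(deriv_coeff j i)\<^sup>2 \<le> (inverse \<tau>)\<^sup>2 * (1 + \<kappa>\<^sup>2 / \<mu> 0) ^ (2 * j) * \<mu> i powr (- (\<alpha> - 2 * real j))"
    by (simp only: B_def)
qed

text \<open>
  For an eigenfunction the defining series has a single nonzero term. The chosen sum is known only up
  to equality in \<open>L\<^sub>2\<close>, so it is described by its inner products.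
\<close>

lemma spectral_power_phi:
  shows "spectral_power G \<phi> \<mu> \<beta> (\<phi> i) \<in> graph_L2 G"
    and "\<psi> \<in> graph_L2 G \<Longrightarrow>
      L2_inner G (spectral_power G \<phi> \<mu> \<beta> (\<phi> i)) \<psi> = \<mu> i powr \<beta> * L2_inner G (\<phi> i) \<psi>"
proof -
  let ?F = "\<lambda>k e t. \<mu> k powr \<beta> * L2_inner G (\<phi> i) (\<phi> k) * \<phi> k e t"
  have part: "(\<Sum>k<n. ?F k e t) = \<mu> i powr \<beta> * \<phi> i e t" if "i < n" for n e t
    using that by (simp add: phi_orthonormal if_distrib[of "\<lambda>x. _ * x"] if_distrib[of "\<lambda>x. x * _"] cong: if_cong)
  have "L2_sums G ?F (\<lambda>e t. \<mu> i powr \<beta> * \<phi> i e t)"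
    unfolding L2_sums_def
  proof
    show "(\<lambda>e t. \<mu> i powr \<beta> * \<phi> i e t) \<in> graph_L2 G" by (intro graph_L2_scale phi_L2)
    have "L2_norm G (\<lambda>e t. \<mu> i powr \<beta> * \<phi> i e t - (\<Sum>k<n. ?F k e t)) = 0" if "n > i" for n
      unfolding part[OF that] by (simp add: L2_norm_def L2_inner_def)
    then show "(\<lambda>n. L2_norm G (\<lambda>e t. \<mu> i powr \<beta> * \<phi> i e t - (\<Sum>k<n. ?F k e t))) \<longlonglongrightarrow> 0"
      by (intro tendsto_eventually eventually_sequentiallyI[of "Suc i"]) simp
  qed
  then have "\<exists>g. L2_sums G ?F g" by blast
  from someI_ex[OF this] have sums: "L2_sums G ?F (spectral_power G \<phi> \<mu> \<beta> (\<phi> i))"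
    by (simp only: spectral_power_def)
  then show "spectral_power G \<phi> \<mu> \<beta> (\<phi> i) \<in> graph_L2 G" by (simp add: L2_sums_def)
  assume \<psi>: "\<psi> \<in> graph_L2 G"
  have "(\<lambda>k. L2_inner G (?F k) \<psi>) sums L2_inner G (spectral_power G \<phi> \<mu> \<beta> (\<phi> i)) \<psi>"
    using sums by (rule L2_sums_inner) (intro graph_L2_scale phi_L2 \<psi>)+
  moreover have "(\<lambda>k. L2_inner G (?F k) \<psi>) = (\<lambda>k. if k = i then \<mu> i powr \<beta> * L2_inner G (\<phi> i) \<psi> else 0)"
    by (intro ext) (simp add: L2_inner_scale phi_orthonormal)
  ultimately show "L2_inner G (spectral_power G \<phi> \<mu> \<beta> (\<phi> i)) \<psi> = \<mu> i powr \<beta> * L2_inner G (\<phi> i) \<psi>"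
    using sums_unique2[OF _ sums_single[of i "\<lambda>_. \<mu> i powr \<beta> * L2_inner G (\<phi> i) \<psi>"]] by simp
qed

text \<open>
  Testing the equation with \<open>\<phi> i\<close> expresses the coefficient by the noise at a representative of
  \<open>L\<^bsup>-\<alpha>/2\<^esup> \<phi> i / \<tau>\<close>. This is almost surely a multiple of \<open>W (\<phi> i)\<close>, because the covariance of the
  noise shows that their difference has variance zero.
\<close>

lemma solution_coefficients: "AE \<omega> in M. u \<omega> \<in> graph_L2 G \<and> (\<forall>i. L2_inner G (u \<omega>) (\<phi> i) = noise_coeff (deriv_coeff 0) \<omega> i)"
proof -
  have "AE \<omega> in M. L2_inner G (u \<omega>) (\<phi> i) = noise_coeff (deriv_coeff 0) \<omega> i" for i
  proof -
    define g where "g = (\<lambda>e t. inverse \<tau> * spectral_power G \<phi> \<mu> (- \<alpha> / 2) (\<phi> i) e t)"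
    define a where "a = inverse \<tau> * \<mu> i powr (- \<alpha> / 2)"
    have g: "g \<in> graph_L2 G" unfolding g_def by (intro graph_L2_scale spectral_power_phi(1))
    have inner: "L2_inner G g \<psi> = a * L2_inner G (\<phi> i) \<psi>" if "\<psi> \<in> graph_L2 G" for \<psi>
      unfolding g_def L2_inner_scale spectral_power_phi(2)[OF that] by (simp add: a_def)
    have gg: "L2_inner G g g = a\<^sup>2" "L2_inner G g (\<phi> i) = a"
      using inner[OF g] inner[OF phi_L2, of i] by (simp_all add: L2_inner_commute[of "\<phi> i" g] phi_orthonormal power2_eq_square)
    have sq: "(W g \<omega> - a * W (\<phi> i) \<omega>)\<^sup>2 =
        W g \<omega> * W g \<omega> - 2 * a * (W g \<omega> * W (\<phi> i) \<omega>) + a\<^sup>2 * (W (\<phi> i) \<omega> * W (\<phi> i) \<omega>)" for \<omega>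
      by (simp add: power2_eq_square algebra_simps)
    note int = noise_mult_integrable[OF g g] noise_mult_integrable[OF g phi_L2, of i]
      noise_mult_integrable[OF phi_L2 phi_L2, of i i]
    have "(LINT \<omega>|M. (W g \<omega> - a * W (\<phi> i) \<omega>)\<^sup>2) = 0"
      unfolding sq using int by (simp add: noise_covariance g phi_L2 gg phi_orthonormal power2_eq_square)
    moreover have "integrable M (\<lambda>\<omega>. (W g \<omega> - a * W (\<phi> i) \<omega>)\<^sup>2)"
      unfolding sq using int by simp
    ultimately have "AE \<omega> in M. (W g \<omega> - a * W (\<phi> i) \<omega>)\<^sup>2 = 0"
      by (subst (asm) integral_nonneg_eq_0_iff_AE) auto
    moreover have "AE \<omega> in M. L2_inner G (u \<omega>) (\<phi> i) = W g \<omega>"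
      using solution phi_L2 unfolding spde_solution_def g_def by blast
    ultimately show ?thesis
      by eventually_elim (simp add: noise_coeff_def deriv_coeff_def a_def)
  qed
  then have "AE \<omega> in M. \<forall>i. L2_inner G (u \<omega>) (\<phi> i) = noise_coeff (deriv_coeff 0) \<omega> i"
    by (simp add: AE_all_countable)
  moreover have "AE \<omega> in M. u \<omega> \<in> graph_L2 G"
  proof (rule AE_I2)
    have "space (L2_borel G) = graph_L2 G"
      unfolding L2_borel_def by (rule space_measure_of) (auto simp: L2_open_def)
    then show "u \<omega> \<in> graph_L2 G" if "\<omega> \<in> space M" for \<omega>
      using solution that measurable_space[of u M "L2_borel G" \<omega>] by (auto simp: spde_solution_def)
  qed
  ultimately show ?thesis by eventually_elim blast
qed

text \<open>
  The modification of \<open>D\<^bsup>2J\<^esup> u\<close> is the function reconstructed from the coefficients \<open>deriv_coeff J\<close>. The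
  lower orders \<open>j \<le> J\<close> satisfy the same hypotheses, since \<open>\<alpha> - 2 * j\<close> decreases in \<open>j\<close>; their
  reconstructions provide the remaining weak derivatives that membership in the Sobolev space
  requires. On the exceptional null set the field is set to zero.
\<close>

lemma even_derivative_modification:
  assumes beta: "1 / 2 < \<alpha> - 2 * real J" and gamma: "0 < \<gamma>" "\<gamma> < min (\<alpha> - 2 * real J - 1 / 2) (1 / 2)"
  obtains v where "\<And>e t. (\<lambda>\<omega>. v \<omega> e t) \<in> borel_measurable M"
    "\<And>\<omega>. graph_holder G \<gamma> (v \<omega>)"
    "AE \<omega> in M. u \<omega> \<in> graph_sobolev G (2 * J) \<and>
      (\<forall>e\<in>arcs G. v \<omega> e \<in> edge_L2 (len G e) \<and> weak_deriv (len G e) (2 * J) (u \<omega> e) (v \<omega> e))"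
proof -
  define c where "c j \<omega> = noise_coeff (deriv_coeff j) \<omega>" for j \<omega>
  define good where "good \<omega> \<longleftrightarrow> (\<forall>j\<in>{..J}. \<exists>K. regular_coeffs \<gamma> K (c j \<omega>))" for \<omega>
  have "AE \<omega> in M. \<exists>K. regular_coeffs \<gamma> K (c j \<omega>)" if j: "j \<in> {..J}" for j
  proof -
    obtain A where A: "\<And>i. (deriv_coeff j i)\<^sup>2 \<le> A * \<mu> i powr (- (\<alpha> - 2 * real j))"
      using deriv_coeff_bound by blast
    have "real j \<le> real J" using j by simp
    then have "1 / 2 < \<alpha> - 2 * real j" "\<gamma> < \<alpha> - 2 * real j - 1 / 2" "\<gamma> < 1 / 2"
      using beta gamma by auto
    from random_series_regular_coeffs[OF this(1) A gamma(1) this(2,3)] show ?thesis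
      unfolding c_def .
  qed
  then have "AE \<omega> in M. good \<omega>"
    unfolding good_def by (intro AE_finite_allI) auto
  then obtain N where N: "N \<in> null_sets M" "{\<omega> \<in> space M. \<not> good \<omega>} \<subseteq> N"
    unfolding eventually_ae_filter by blast
  define v where "v \<omega> e t = (if \<omega> \<in> space M - N then reconstruction (c J \<omega>) e t else 0)" for \<omega> e t
  have goodI: "good \<omega>" if "\<omega> \<in> space M - N" for \<omega> using that N(2) by auto
  have meas: "(\<lambda>\<omega>. v \<omega> e t) \<in> borel_measurable M" for e t
  proof -
    note [measurable] = series_functional_measurable
    have "(\<lambda>\<omega>. reconstruction (c J \<omega>) e t) \<in> borel_measurable M"
      unfolding reconstruction_def c_def by measurable
    moreover have "{\<omega> \<in> space M. \<omega> \<in> space M - N} \<in> sets M"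
    proof -
      have "{\<omega> \<in> space M. \<omega> \<in> space M - N} = space M - N" by auto
      then show ?thesis using N(1) by auto
    qed
    ultimately show ?thesis unfolding v_def by (intro measurable_If borel_measurable_const)
  qed
  have holder: "graph_holder G \<gamma> (v \<omega>)" for \<omega>
  proof (cases "\<omega> \<in> space M - N")
    case True
    then have v: "v \<omega> = reconstruction (c J \<omega>)" by (simp add: v_def fun_eq_iff)
    obtain K where K: "regular_coeffs \<gamma> K (c J \<omega>)"
      using goodI[OF True] unfolding good_def by blast
    obtain C where C: "0 \<le> C" "\<And>e s t. e \<in> arcs G \<Longrightarrow> s \<in> {0..len G e} \<Longrightarrow> t \<in> {0..len G e} \<Longrightarrow>
      \<bar>reconstruction (c J \<omega>) e s - reconstruction (c J \<omega>) e t\<bar> \<le> C * \<bar>s - t\<bar> powr \<gamma>"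
      using reconstruction_holder[OF K] by blast
    show ?thesis
      unfolding v
      by (rule graph_holder_if_edgewise[OF gamma(1) C])
        (use reconstruction_continuous[OF K] reconstruction_vertex[OF K] in blast)+
  next
    case False
    have v: "v \<omega> = (\<lambda>e t. 0)" by (intro ext) (simp only: v_def False if_False)
    show ?thesis unfolding v by (rule graph_holder_if_edgewise[OF gamma(1), of 0]) auto
  qed
  have "AE \<omega> in M. \<omega> \<in> space M - N"
    using AE_not_in[OF N(1)] AE_space by eventually_elim simp
  then have "AE \<omega> in M. u \<omega> \<in> graph_sobolev G (2 * J) \<and>
      (\<forall>e\<in>arcs G. v \<omega> e \<in> edge_L2 (len G e) \<and> weak_deriv (len G e) (2 * J) (u \<omega> e) (v \<omega> e))"
    using solution_coefficients
  proof eventually_elim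
    case (elim \<omega>)
    then have uL: "u \<omega> \<in> graph_L2 G" and coef: "\<And>i. L2_inner G (u \<omega>) (\<phi> i) = c 0 \<omega> i"
      by (auto simp: c_def)
    have c_shift: "c (j + m) \<omega> = (\<lambda>i. c j \<omega> i * (\<kappa>\<^sup>2 - \<mu> i) ^ m)" for j m
      by (intro ext) (simp add: c_def noise_coeff_def deriv_coeff_def power_add)
    define r where "r j = reconstruction (c j \<omega>)" for j
    have rec: "continuous_on {0..len G e} (r j e)"
      "test_function (len G e) \<eta> \<Longrightarrow> (LINT t|lebesgue_on {0..len G e}. r j e t * \<eta> t) = series_functional (c j \<omega>) (edge_embed e \<eta>)"
      if e: "e \<in> arcs G" and j: "j \<le> J" for e j \<eta>
    proof -
      obtain K where K: "regular_coeffs \<gamma> K (c j \<omega>)"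
        using goodI[OF elim(1)] j unfolding good_def by blast
      show cont: "continuous_on {0..len G e} (r j e)"
        unfolding r_def by (rule reconstruction_continuous[OF K e])
      assume \<eta>: "test_function (len G e) \<eta>"
      have "(LINT t|lebesgue_on {0..len G e}. r j e t * \<eta> t) = integral {0..len G e} (\<lambda>t. r j e t * \<eta> t)"
        by (intro LINT_continuous_eq_integral continuous_on_mult cont test_function_continuous[OF \<eta>])
      also have "\<dots> = series_functional (c j \<omega>) (edge_embed e \<eta>)"
        unfolding r_def
        by (rule reconstruction_moments[OF K e test_function_continuous[OF \<eta>] test_function_endpoints(2)[OF \<eta>]])
      finally show "(LINT t|lebesgue_on {0..len G e}. r j e t * \<eta> t) = series_functional (c j \<omega>) (edge_embed e \<eta>)" .
    qed
    have u_r: "weak_deriv (len G e) (2 * j) (u \<omega> e) (r j e)" if e: "e \<in> arcs G" and j: "j \<le> J" for e j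
      unfolding weak_deriv_def
    proof (intro allI impI)
      fix \<eta> assume \<eta>: "test_function (len G e) \<eta>"
      have "(LINT t|lebesgue_on {0..len G e}. u \<omega> e t * (deriv ^^ (2 * j)) \<eta> t) =
          series_functional (c 0 \<omega>) (edge_embed e ((deriv ^^ (2 * j)) \<eta>))"
        using L2_function_test_integral[OF uL e test_function_higher_deriv[OF \<eta>]] by (simp add: coef)
      also have "\<dots> = series_functional (c j \<omega>) (edge_embed e \<eta>)"
        using series_functional_higher_deriv[OF e \<eta>, of "c 0 \<omega>" j] c_shift[of 0 j] by simp
      finally show "(LINT t|lebesgue_on {0..len G e}. u \<omega> e t * (deriv ^^ (2 * j)) \<eta> t) =
          (- 1) ^ (2 * j) * (LINT t|lebesgue_on {0..len G e}. r j e t * \<eta> t)"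
        using rec(2)[OF e j \<eta>] by simp
    qed
    have r_r: "weak_deriv (len G e) 2 (r j e) (r (Suc j) e)" if e: "e \<in> arcs G" and j: "j < J" for e j
      unfolding weak_deriv_def
    proof (intro allI impI)
      fix \<eta> assume \<eta>: "test_function (len G e) \<eta>"
      have jj: "j \<le> J" "Suc j \<le> J" using j by auto
      have "series_functional (c j \<omega>) (edge_embed e ((deriv ^^ 2) \<eta>)) = series_functional (c (Suc j) \<omega>) (edge_embed e \<eta>)"
        using series_functional_higher_deriv[OF e \<eta>, of "c j \<omega>" 1] c_shift[of j 1] by simp
      then show "(LINT t|lebesgue_on {0..len G e}. r j e t * (deriv ^^ 2) \<eta> t) =
          (- 1) ^ 2 * (LINT t|lebesgue_on {0..len G e}. r (Suc j) e t * \<eta> t)"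
        using rec(2)[OF e jj(1) test_function_higher_deriv[OF \<eta>]] rec(2)[OF e jj(2) \<eta>] by simp
    qed
    have "u \<omega> \<in> graph_sobolev G (2 * J)"
      unfolding graph_sobolev_def
    proof (intro CollectI ballI)
      fix e assume e: "e \<in> arcs G"
      have "u \<omega> e \<in> edge_L2 (len G e)" using uL e by (simp add: graph_L2_def)
      then show "u \<omega> e \<in> edge_sobolev (2 * J) (len G e)"
        by (rule edge_sobolev_if_even_derivs[OF len_pos[OF e], where v = "\<lambda>j. r j e"])
          (rule rec(1)[OF e] u_r[OF e] r_r[OF e], assumption)+
    qed
    moreover have "v \<omega> = r J" using elim(1) by (simp add: v_def r_def fun_eq_iff)
    ultimately show ?case
      using edge_L2_continuous[OF rec(1)[OF _ order_refl]] u_r[OF _ order_refl] by simp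
  qed
  then show ?thesis using that[of v] meas holder by blast
qed

lemma even_derivative_has_holder_modification:
  assumes "1 / 2 < \<alpha> - 2 * real J" "0 < \<gamma>" "\<gamma> < min (\<alpha> - 2 * real J - 1 / 2) (1 / 2)"
  shows "deriv_has_holder_modification G M (2 * J) u \<gamma>"
proof -
  obtain v where v: "\<And>e t. (\<lambda>\<omega>. v \<omega> e t) \<in> borel_measurable M" "\<And>\<omega>. graph_holder G \<gamma> (v \<omega>)"
    and AE: "AE \<omega> in M. u \<omega> \<in> graph_sobolev G (2 * J) \<and>
      (\<forall>e\<in>arcs G. v \<omega> e \<in> edge_L2 (len G e) \<and> weak_deriv (len G e) (2 * J) (u \<omega> e) (v \<omega> e))"
    using even_derivative_modification[OF assms] by blast
  from AE have "AE \<omega> in M. L2_eq G (v \<omega>) (edgewise_deriv G (2 * J) (u \<omega>))"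
  proof eventually_elim
    case (elim \<omega>)
    show ?case
      unfolding L2_eq_def
    proof
      fix e assume e: "e \<in> arcs G"
      then have ve: "v \<omega> e \<in> edge_L2 (len G e)" "weak_deriv (len G e) (2 * J) (u \<omega> e) (v \<omega> e)" using elim by auto
      then have "\<exists>g. g \<in> edge_L2 (len G e) \<and> weak_deriv (len G e) (2 * J) (u \<omega> e) g" by blast
      from someI_ex[OF this]
      have "edgewise_deriv G (2 * J) (u \<omega>) e \<in> edge_L2 (len G e)"
        "weak_deriv (len G e) (2 * J) (u \<omega> e) (edgewise_deriv G (2 * J) (u \<omega>) e)"
        by (simp_all add: edgewise_deriv_def)
      then show "AE t in lebesgue_on {0..len G e}. v \<omega> e t = edgewise_deriv G (2 * J) (u \<omega>) e t"
        using weak_deriv_unique[OF len_pos[OF e]] ve by blast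
    qed
  qed
  moreover have "AE \<omega> in M. u \<omega> \<in> graph_sobolev G (2 * J)" using AE by eventually_elim blast
  ultimately show ?thesis
    unfolding deriv_has_holder_modification_def has_holder_modification_def using v by blast
qed

lemma solution_has_holder_modification:
  assumes "1 / 2 < \<alpha>" "0 < \<gamma>" "\<gamma> < min (\<alpha> - 1 / 2) (1 / 2)"
  shows "has_holder_modification G M u \<gamma>"
proof -
  obtain v where v: "\<And>e t. (\<lambda>\<omega>. v \<omega> e t) \<in> borel_measurable M" "\<And>\<omega>. graph_holder G \<gamma> (v \<omega>)"
    and AE: "AE \<omega> in M. u \<omega> \<in> graph_sobolev G (2 * 0) \<and>
      (\<forall>e\<in>arcs G. v \<omega> e \<in> edge_L2 (len G e) \<and> weak_deriv (len G e) (2 * 0) (u \<omega> e) (v \<omega> e))"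
    using even_derivative_modification[of 0 \<gamma>] assms by auto
  from AE have "AE \<omega> in M. L2_eq G (v \<omega>) (u \<omega>)"
  proof eventually_elim
    case (elim \<omega>)
    show ?case
      unfolding L2_eq_def
    proof
      fix e assume e: "e \<in> arcs G"
      then have ve: "v \<omega> e \<in> edge_L2 (len G e)" "weak_deriv (len G e) 0 (u \<omega> e) (v \<omega> e)" using elim by auto
      have "u \<omega> e \<in> edge_L2 (len G e)" using elim e by (auto simp: graph_sobolev_def edge_sobolev_def)
      moreover have "weak_deriv (len G e) 0 (u \<omega> e) (u \<omega> e)" by (simp add: weak_deriv_def)
      ultimately show "AE t in lebesgue_on {0..len G e}. v \<omega> e t = u \<omega> e t"
        using weak_deriv_unique[OF len_pos[OF e]] ve by blast
    qed
  qed
  then show ?thesis unfolding has_holder_modification_def using v by blast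
qed

end

theorem theorem3:
  fixes G :: "('v, 'e) metric_graph"
    and M :: "'w measure"
    and \<phi> :: "nat \<Rightarrow> 'e \<Rightarrow> real \<Rightarrow> real"
    and \<mu> :: "nat \<Rightarrow> real"
    and W :: "('e \<Rightarrow> real \<Rightarrow> real) \<Rightarrow> 'w \<Rightarrow> real"
    and u :: "'w \<Rightarrow> 'e \<Rightarrow> real \<Rightarrow> real"
    and \<kappa> \<tau> \<alpha> :: real
  assumes "compact_metric_graph G"
    and "\<kappa> > 0" and "\<tau> > 0" and "\<alpha> > 1 / 2"
    and "orthonormal_eigenbasis G \<kappa> \<phi> \<mu>"
    and "prob_space M" and "complete_measure M"
    and "white_noise G M W"
    and "spde_solution G M \<phi> \<mu> \<tau> \<alpha> W u"
  shows
    "(\<forall>\<gamma>. 0 < \<gamma> \<and> \<gamma> < min (\<alpha> - 1 / 2) (1 / 2) \<longrightarrow> has_holder_modification G M u \<gamma>) \<and>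
     (even \<lfloor>\<alpha>\<rfloor> \<and> \<alpha> - of_int \<lfloor>\<alpha>\<rfloor> > 1 / 2 \<longrightarrow>
        (\<forall>\<gamma>. 0 < \<gamma> \<and> \<gamma> < \<alpha> - of_int \<lfloor>\<alpha>\<rfloor> - 1 / 2 \<longrightarrow>
           deriv_has_holder_modification G M (nat \<lfloor>\<alpha>\<rfloor>) u \<gamma>)) \<and>
     (\<alpha> \<ge> 2 \<and> odd \<lfloor>\<alpha>\<rfloor> \<longrightarrow>
        (\<forall>\<gamma>. 0 < \<gamma> \<and> \<gamma> < min (\<alpha> - of_int \<lfloor>\<alpha>\<rfloor>) (1 / 2) \<longrightarrow>
           deriv_has_holder_modification G M (nat (\<lfloor>\<alpha>\<rfloor> - 1)) u \<gamma>)) \<and>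
     (\<alpha> \<ge> 3 \<longrightarrow>
        (\<forall>\<gamma>. 0 < \<gamma> \<and> \<gamma> < 1 / 2 \<longrightarrow>
           (\<forall>j::nat. int j \<le> \<lfloor>(\<alpha> - 3) / 2\<rfloor> \<longrightarrow>
              deriv_has_holder_modification G M (2 * j) u \<gamma>)))"
proof (intro conjI allI impI)
  interpret graph_spde G \<kappa> \<phi> \<mu> M W \<tau> \<alpha> u
    by (intro graph_spde.intro graph_noise.intro graph_eigenbasis.intro metric_graph_space.intro
        graph_spde_axioms.intro graph_noise_axioms.intro graph_eigenbasis_axioms.intro) (fact assms)+
  note main = even_derivative_has_holder_modification
  have floor: "of_int \<lfloor>\<alpha>\<rfloor> \<le> \<alpha>" "\<alpha> < of_int \<lfloor>\<alpha>\<rfloor> + 1" by linarith+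
  have floor0: "0 \<le> \<lfloor>\<alpha>\<rfloor>" using assms(4) by simp
  show "has_holder_modification G M u \<gamma>" if "0 < \<gamma> \<and> \<gamma> < min (\<alpha> - 1 / 2) (1 / 2)" for \<gamma>
    by (rule solution_has_holder_modification[OF assms(4)]) (use that in auto)
  show "deriv_has_holder_modification G M (nat \<lfloor>\<alpha>\<rfloor>) u \<gamma>"
    if h: "even \<lfloor>\<alpha>\<rfloor> \<and> \<alpha> - of_int \<lfloor>\<alpha>\<rfloor> > 1 / 2" and g: "0 < \<gamma> \<and> \<gamma> < \<alpha> - of_int \<lfloor>\<alpha>\<rfloor> - 1 / 2" for \<gamma>
  proof -
    obtain m where m: "\<lfloor>\<alpha>\<rfloor> = 2 * m" using h by (elim conjE evenE)
    have J: "nat \<lfloor>\<alpha>\<rfloor> = 2 * nat m" "2 * real (nat m) = of_int \<lfloor>\<alpha>\<rfloor>" using m floor0 by auto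
    have "\<gamma> < 1 / 2" using g floor by linarith
    then show ?thesis unfolding J(1) by (intro main) (use h g in \<open>auto simp: J(2)\<close>)
  qed
  show "deriv_has_holder_modification G M (nat (\<lfloor>\<alpha>\<rfloor> - 1)) u \<gamma>"
    if h: "\<alpha> \<ge> 2 \<and> odd \<lfloor>\<alpha>\<rfloor>" and g: "0 < \<gamma> \<and> \<gamma> < min (\<alpha> - of_int \<lfloor>\<alpha>\<rfloor>) (1 / 2)" for \<gamma>
  proof -
    obtain m where m: "\<lfloor>\<alpha>\<rfloor> = 2 * m + 1" using h by (elim conjE oddE)
    have J: "nat (\<lfloor>\<alpha>\<rfloor> - 1) = 2 * nat m" "2 * real (nat m) = of_int \<lfloor>\<alpha>\<rfloor> - 1" using m floor0 by auto
    show ?thesis unfolding J(1) by (rule main) (use h g floor in \<open>auto simp: J(2)\<close>)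
  qed
  show "deriv_has_holder_modification G M (2 * j) u \<gamma>"
    if h: "\<alpha> \<ge> 3" and g: "0 < \<gamma> \<and> \<gamma> < 1 / 2" and j: "int j \<le> \<lfloor>(\<alpha> - 3) / 2\<rfloor>" for \<gamma> j
  proof -
    have "real j \<le> (\<alpha> - 3) / 2" using j by (simp add: le_floor_iff)
    then have "2 * real j \<le> \<alpha> - 3" by simp
    then show ?thesis by (intro main) (use g in auto)
  qed
qed

end
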